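(* There exists an almost surely positive stopping time $T$ such that for $0\le t<T$ the series $$\|x_0\|+\sum_{k=1}^\infty\|g_k(t)\|$$ almost surely converges and almost surely $$X_t=x_0+\sum_{k=1}^{+\infty}g_k(t).$$
   Context: Setting: $(B^1,\dots,B^d)$ is a $d$-dimensional fractional Brownian motion with Hurst parameter $H>1/2$ ($H\in(1/2,1)$), i.e. the $B^i$ are independent continuous centered Gaussian processes with covariance $R(t,s)=\frac12(s^{2H}+t^{2H}-|t-s|^{2H})$; by convention $B^0_t=t$. $V_0,\dots,V_d$ are Lipschitz $C^\infty$ vector fields on $\mathbb{R}^n$ with Lipschitz derivatives, analytic on $\{x:\|x-x_0\|\le C\}$ for some $C>0$, where $x_0\in\mathbb{R}^n$. $X$ is the unique solution of $dX_t=\sum_{i=0}^dV_i(X_t)\,dB^i_t$, $X_0=x_0$, the integrals being understood pathwise in Young's sense (almost surely the paths of $B$ are locally $\beta$-Hölder for each $\beta<H$). Stopping times are with respect to the usual (complete, right-continuous) filtration generated by $B$. For a word $I=(i_1,\dots,i_k)\in\{0,\dots,d\}^k$ of length $|I|=k$: $\int_{\triangle^k[0,t]}dB^I=\int_{0<t_1<\cdots<t_k<t}dB^{i_1}_{t_1}\cdots dB^{i_k}_{t_k}$ and $P_I^j=(V_{i_1}\cdots V_{i_k}\pi^j)(x_0)$, where $\pi^j(x)=x_j$ and vector fields act as differential operators. The vector $g_k(t)\in\mathbb{R}^n$ has coordinates $g_k^j(t)=\sum_{|I|=k}P_I^j\int_{\triangle^k[0,t]}dB^I$. *)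

theory Defs
  imports "HOL-Probability.Probability"
begin

section \<open>Vector fields\<close>

text \<open>\<open>Ck k f\<close>: all partial derivatives of \<open>f\<close> up to order \<open>k\<close> exist and are continuous.\<close>

fun Ck :: "nat \<Rightarrow> ('a::euclidean_space \<Rightarrow> 'b::real_normed_vector) \<Rightarrow> bool" where
  "Ck 0 f \<longleftrightarrow> continuous_on UNIV f"
| "Ck (Suc k) f \<longleftrightarrow>
     f differentiable_on UNIV \<and> (\<forall>v. Ck k (\<lambda>x. frechet_derivative f (at x) v))"

definition smooth :: "('a::euclidean_space \<Rightarrow> 'b::real_normed_vector) \<Rightarrow> bool" where
  "smooth f \<longleftrightarrow> (\<forall>k. Ck k f)"

definition lipschitz :: "('a::metric_space \<Rightarrow> 'b::metric_space) \<Rightarrow> bool" where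
  "lipschitz f \<longleftrightarrow> (\<exists>L. L-lipschitz_on UNIV f)"

text \<open>On a finite-dimensional space the Lipschitz property of the derivative \<open>x \<mapsto> Df(x)\<close> is that
  of all directional derivatives \<open>x \<mapsto> Df(x) v\<close>.\<close>

definition lipschitz_derivative :: "('a::euclidean_space \<Rightarrow> 'b::real_normed_vector) \<Rightarrow> bool" where
  "lipschitz_derivative f \<longleftrightarrow> (\<forall>v. lipschitz (\<lambda>x. frechet_derivative f (at x) v))"

text \<open>Real analyticity: around each point of \<open>S\<close> the function is the sum of an (unconditionally
  convergent) power series in several variables; a multi-index is a function \<open>\<alpha> :: 'n \<Rightarrow> nat\<close>. The
  expansion holds on a full ball, so \<open>f\<close> is analytic in a neighbourhood of \<open>S\<close>.\<close>

definition real_analytic_on ::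
    "(real ^ 'n \<Rightarrow> 'b::real_normed_vector) \<Rightarrow> (real ^ 'n) set \<Rightarrow> bool" where
  "real_analytic_on f S \<longleftrightarrow>
     (\<forall>a\<in>S. \<exists>r>0. \<exists>c :: ('n \<Rightarrow> nat) \<Rightarrow> 'b. \<forall>x\<in>ball a r.
        ((\<lambda>\<alpha>. (\<Prod>i\<in>UNIV. (x $ i - a $ i) ^ \<alpha> i) *\<^sub>R c \<alpha>) has_sum f x) UNIV)"

text \<open>The vector field \<open>v\<close> acting as a differential operator: \<open>\<Sum>\<^sub>l v\<^sup>l \<partial>\<^sub>l f\<close>.\<close>

definition vf_apply :: "('a::real_normed_vector \<Rightarrow> 'a) \<Rightarrow> ('a \<Rightarrow> real) \<Rightarrow> ('a \<Rightarrow> real)" where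
  "vf_apply v f = (\<lambda>x. frechet_derivative f (at x) (v x))"

text \<open>\<open>(V\<^bsub>i1\<^esub> \<dots> V\<^bsub>ik\<^esub> \<pi>\<^sup>j)(x0)\<close> for the word \<open>I = [i1, \<dots>, ik]\<close>; the last letter acts first.\<close>

definition P_coeff ::
    "(nat \<Rightarrow> real ^ 'n \<Rightarrow> real ^ 'n) \<Rightarrow> real ^ 'n \<Rightarrow> nat list \<Rightarrow> 'n \<Rightarrow> real" where
  "P_coeff V x0 I j = foldr (\<lambda>i. vf_apply (V i)) I (\<lambda>x. x $ j) x0"


section \<open>Pathwise integration in Young's sense\<close>

text \<open>\<open>\<integral>\<^sub>a\<^sup>b f dg\<close> as the limit of Riemann--Stieltjes sums with mesh tending to 0. Under Young's
  condition (\<open>f\<close>, \<open>g\<close> Hoelder continuous with exponents adding up to more than 1) it exists.\<close>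

definition has_young_integral ::
    "(real \<Rightarrow> 'b::real_normed_vector) \<Rightarrow> (real \<Rightarrow> real) \<Rightarrow> real \<Rightarrow> real \<Rightarrow> 'b \<Rightarrow> bool" where
  "has_young_integral f g a b y \<longleftrightarrow>
     (\<forall>\<epsilon>>0. \<exists>\<delta>>0. \<forall>p. p tagged_division_of {a..b} \<and> (\<forall>(\<xi>, K)\<in>p. diameter K < \<delta>) \<longrightarrow>
        norm ((\<Sum>(\<xi>, K)\<in>p. (g (Sup K) - g (Inf K)) *\<^sub>R f \<xi>) - y) < \<epsilon>)"

definition young_integrable ::
    "(real \<Rightarrow> 'b::real_normed_vector) \<Rightarrow> (real \<Rightarrow> real) \<Rightarrow> real \<Rightarrow> real \<Rightarrow> bool" where
  "young_integrable f g a b \<longleftrightarrow> (\<exists>y. has_young_integral f g a b y)"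

definition young_integral ::
    "(real \<Rightarrow> 'b::real_normed_vector) \<Rightarrow> (real \<Rightarrow> real) \<Rightarrow> real \<Rightarrow> real \<Rightarrow> 'b" where
  "young_integral f g a b = (THE y. has_young_integral f g a b y)"

definition locally_holder :: "real \<Rightarrow> (real \<Rightarrow> 'b::metric_space) \<Rightarrow> bool" where
  "locally_holder \<alpha> f \<longleftrightarrow>
     (\<forall>\<tau>. \<exists>K. \<forall>s\<in>{0..\<tau>}. \<forall>t\<in>{0..\<tau>}. dist (f s) (f t) \<le> K * \<bar>s - t\<bar> powr \<alpha>)"

text \<open>The integral of \<open>db\<^sup>I\<close> over \<open>0 < t1 < \<dots> < tk < t\<close> as an iterated integral; the first letter
  of the word belongs to the innermost variable \<open>t1\<close>.\<close>

definition iterated_integral :: "(nat \<Rightarrow> real \<Rightarrow> real) \<Rightarrow> nat list \<Rightarrow> real \<Rightarrow> real" where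
  "iterated_integral b I = foldl (\<lambda>J i t. young_integral J (b i) 0 t) (\<lambda>t. 1) I"

text \<open>The term \<open>g\<^sub>k(t)\<close> for the driving path \<open>b = (b 0, \<dots>, b d)\<close>.\<close>

definition taylor_term ::
    "(nat \<Rightarrow> real ^ 'n \<Rightarrow> real ^ 'n) \<Rightarrow> real ^ 'n \<Rightarrow> nat \<Rightarrow> (nat \<Rightarrow> real \<Rightarrow> real)
      \<Rightarrow> nat \<Rightarrow> real \<Rightarrow> real ^ 'n" where
  "taylor_term V x0 d b k t =
     (\<chi> j. \<Sum>I | set I \<subseteq> {0..d} \<and> length I = k. P_coeff V x0 I j * iterated_integral b I t)"

text \<open>\<open>x\<close> solves \<open>dx\<^sub>t = \<Sum>\<^sub>i V\<^sub>i(x\<^sub>t) db\<^sup>i\<^sub>t\<close>, \<open>x 0 = x0\<close>, on \<open>[0, \<infinity>)\<close>. The paths \<open>b i\<close> are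
  meant to be locally \<open>\<beta>\<close>-Hoelder for each \<open>\<beta> < H\<close>; Young's condition is then that \<open>x\<close> is locally
  \<open>\<alpha>\<close>-Hoelder for some \<open>\<alpha>\<close> with \<open>\<alpha> + H > 1\<close>. This is the class in which the solution is unique.\<close>

definition young_solution ::
    "real \<Rightarrow> (nat \<Rightarrow> real ^ 'n \<Rightarrow> real ^ 'n) \<Rightarrow> real ^ 'n \<Rightarrow> nat \<Rightarrow> (nat \<Rightarrow> real \<Rightarrow> real)
      \<Rightarrow> (real \<Rightarrow> real ^ 'n) \<Rightarrow> bool" where
  "young_solution H V x0 d b x \<longleftrightarrow>
     (\<exists>\<alpha>>1 - H. locally_holder \<alpha> x) \<and>
     (\<forall>t\<ge>0. (\<forall>i\<le>d. young_integrable (\<lambda>s. V i (x s)) (b i) 0 t) \<and>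
            x t = x0 + (\<Sum>i\<le>d. young_integral (\<lambda>s. V i (x s)) (b i) 0 t))"


section \<open>Fractional Brownian motion\<close>

text \<open>Normally distributed, where a constant counts as normal with variance 0.\<close>

definition gaussian_rv :: "'w measure \<Rightarrow> ('w \<Rightarrow> real) \<Rightarrow> bool" where
  "gaussian_rv M Y \<longleftrightarrow> Y \<in> borel_measurable M \<and>
     ((\<exists>\<mu>. AE \<omega> in M. Y \<omega> = \<mu>) \<or>
      (\<exists>\<mu> \<sigma>. \<sigma> > 0 \<and> distributed M lborel Y (normal_density \<mu> \<sigma>)))"

text \<open>All processes have time set \<open>[0, \<infinity>)\<close>; their values at negative times are irrelevant.\<close>

definition gaussian_process :: "'w measure \<Rightarrow> (real \<Rightarrow> 'w \<Rightarrow> real) \<Rightarrow> bool" where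
  "gaussian_process M Z \<longleftrightarrow>
     (\<forall>S c. finite S \<and> S \<subseteq> {0..} \<longrightarrow> gaussian_rv M (\<lambda>\<omega>. \<Sum>t\<in>S. c t * Z t \<omega>))"

definition fbm_cov :: "real \<Rightarrow> real \<Rightarrow> real \<Rightarrow> real" where
  "fbm_cov H t s = (s powr (2 * H) + t powr (2 * H) - \<bar>t - s\<bar> powr (2 * H)) / 2"

text \<open>The components are \<open>B 1, \<dots>, B d\<close>. Independence is that of the processes, regarded as random
  elements of the product space over \<open>[0, \<infinity>)\<close>.\<close>

definition fractional_brownian_motion ::
    "'w measure \<Rightarrow> real \<Rightarrow> nat \<Rightarrow> (nat \<Rightarrow> real \<Rightarrow> 'w \<Rightarrow> real) \<Rightarrow> bool" where
  "fractional_brownian_motion M H d B \<longleftrightarrow>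
     prob_space.indep_vars M (\<lambda>i. \<Pi>\<^sub>M t\<in>{0..}. borel) (\<lambda>i \<omega>. \<lambda>t\<in>{0..}. B i t \<omega>) {1..d} \<and>
     (\<forall>i\<in>{1..d}.
        (AE \<omega> in M. continuous_on {0..} (\<lambda>t. B i t \<omega>)) \<and>
        gaussian_process M (B i) \<and>
        (\<forall>t\<ge>0. (\<integral>\<omega>. B i t \<omega> \<partial>M) = 0) \<and>
        (\<forall>t\<ge>0. \<forall>s\<ge>0. (\<integral>\<omega>. B i t \<omega> * B i s \<omega> \<partial>M) = fbm_cov H t s))"


section \<open>The usual filtration\<close>

text \<open>The time index is \<open>ennreal\<close>, so that stopping times take values in \<open>[0, \<infinity>]\<close>. First the
  completed filtration, which contains all subsets of null sets, whether or not \<open>M\<close> is complete.\<close>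

definition completed_filtration ::
    "'w measure \<Rightarrow> nat \<Rightarrow> (nat \<Rightarrow> real \<Rightarrow> 'w \<Rightarrow> real) \<Rightarrow> ennreal \<Rightarrow> 'w measure" where
  "completed_filtration M d B t = sigma (space M)
     ({B i s -` A \<inter> space M | i s A. i \<in> {1..d} \<and> 0 \<le> s \<and> ennreal s \<le> t \<and> A \<in> sets borel}
      \<union> null_sets (completion M))"

text \<open>Its right-continuous version; the index \<open>\<infinity>\<close> is inserted only to cover \<open>t = \<infinity>\<close>.\<close>

definition usual_filtration ::
    "'w measure \<Rightarrow> nat \<Rightarrow> (nat \<Rightarrow> real \<Rightarrow> 'w \<Rightarrow> real) \<Rightarrow> ennreal \<Rightarrow> 'w measure" where
  "usual_filtration M d B t =
     sigma (space M) (\<Inter>s\<in>insert \<infinity> {t<..}. sets (completed_filtration M d B s))"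

lemma space_completed_filtration [simp]: "space (completed_filtration M d B t) = space M"
  by (simp add: completed_filtration_def space_measure_of_conv)

lemma sets_usual_filtration:
  "sets (usual_filtration M d B t) = (\<Inter>s\<in>insert \<infinity> {t<..}. sets (completed_filtration M d B s))"
proof -
  let ?A = "\<lambda>s. sets (completed_filtration M d B s)"
  have pow: "(\<Inter>s\<in>insert \<infinity> {t<..}. ?A s) \<subseteq> Pow (space M)"
    using sets.space_closed[of "completed_filtration M d B \<infinity>"] by auto
  have "sigma_sets (space M) (\<Inter>s\<in>insert \<infinity> {t<..}. ?A s) \<subseteq> ?A s" if "s \<in> insert \<infinity> {t<..}" for s
    using sets.sigma_sets_subset[of "\<Inter>s\<in>insert \<infinity> {t<..}. ?A s" "completed_filtration M d B s"] that
    by auto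
  then show ?thesis
    using pow by (auto simp: usual_filtration_def sets_measure_of)
qed

lemma filtration_usual_filtration: "filtration (space M) (usual_filtration M d B)"
proof
  fix t u :: ennreal assume "t \<le> u"
  then show "sets (usual_filtration M d B t) \<subseteq> sets (usual_filtration M d B u)"
    unfolding sets_usual_filtration by (intro INF_superset_mono) auto
qed (simp add: usual_filtration_def space_measure_of_conv)

end

theory Submission
  imports Defs "HOL-Library.Landau_Symbols"
begin

text \<open>
  Write \<open>\<xi>\<^sup>j = x\<^sup>j - x0\<^sup>j\<close>. By the product rule for Young integrals, replacing \<open>f (X\<^sub>t)\<close> by the formal
  series with coefficients \<open>\<Sum>\<^bsub>\<bar>I\<bar>=k\<^esub> (V\<^sub>I f)(x0) \<integral>dB\<^sup>I\<close> is multiplicative in \<open>f\<close>. Estimating the iterated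
  integrals word by word does not suffice: the coefficients grow like \<open>k!\<close>, the integrals only decay
  like \<open>1/(k!)\<^sup>H\<close>. Instead one bounds the sum of the norms of the coefficients of \<open>\<xi>\<^sup>j\<close> in the
  Banach algebra of \<open>\<beta>\<close>-Hoelder functions, \<open>1/2 < \<beta> < H\<close>, up to degree \<open>N\<close> by
  induction on \<open>N\<close>: if it is at most \<open>\<rho>\<close>, the power series of \<open>V\<^sub>i\<close> bounds the series of \<open>V\<^sub>i\<close> by a
  constant, and integration against \<open>B\<close>, an operator whose norm is controlled by the Hoelder
  constant of \<open>B\<close>, returns a bound by \<open>\<rho>\<close> up to degree \<open>N + 1\<close>. The sum solves the equation, and so does
  \<open>X - x0\<close>, which cannot leave the ball of radius \<open>\<rho>\<close>; there the equation is a contraction. Finally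
  \<open>T\<close> is the first time at which the Hoelder constant of \<open>B\<close> exceeds a fixed \<open>\<kappa>\<close>. It is positive as
  the paths are Hoelder continuous for a larger exponent.
\<close>

section \<open>Young integrals\<close>

text \<open>Relations between paths are handled through \<open>germ\<close>:
  \<open>dy = sum p_i db_i\<close> becomes an error of order \<open>2 * \<beta>\<close> over each
  [s, t]. As \<open>2 * \<beta> > 1\<close>, such an error determines y up to a constant, absorbs
  the cross terms of products and, with a fixed constant, survives pointwise limits. Product rule
  and passage to the limit thus become estimates on single intervals. Truncation at degree N keeps
  the induction free of convergence questions: up to degree N only monomials of degree at most N
  matter, because every vector field lowers the order of vanishing at x0 by one. This is why orders
  of vanishing of smooth functions are studied at all. The power series are taken on radius
  \<open>2 * \<rho>\<close>, since a Lipschitz bound on radius \<open>\<rho>\<close> consumes the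
  factor 2. Integrating fields of norm M must return at most \<open>\<rho> / 4\<close>: the quarter
  leaves a gap below \<open>\<rho>\<close> for continuing the a priori bound and makes the
  contraction factor 1/4. Time is itself a driver; its Hoelder constant is controlled by a
  deterministic cap on T.\<close>

lemma has_young_integral_unique:
  fixes f :: "real \<Rightarrow> 'b::real_normed_vector"
  assumes "has_young_integral f g a b y" "has_young_integral f g a b z"
  shows "y = z"
proof (rule ccontr)
  assume "y \<noteq> z"
  define e where "e = norm (y - z) / 2"
  have e: "e > 0" using \<open>y \<noteq> z\<close> by (simp add: e_def)
  let ?S = "\<lambda>p. \<Sum>(\<xi>, K)\<in>p. (g (Sup K) - g (Inf K)) *\<^sub>R f \<xi>"
  obtain d1 where d1: "d1 > 0" "\<And>p. p tagged_division_of {a..b} \<Longrightarrow>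
      (\<forall>(\<xi>, K)\<in>p. diameter K < d1) \<Longrightarrow> norm (?S p - y) < e"
    using assms(1) e unfolding has_young_integral_def by meson
  obtain d2 where d2: "d2 > 0" "\<And>p. p tagged_division_of {a..b} \<Longrightarrow>
      (\<forall>(\<xi>, K)\<in>p. diameter K < d2) \<Longrightarrow> norm (?S p - z) < e"
    using assms(2) e unfolding has_young_integral_def by meson
  define d where "d = min d1 d2"
  have d: "d > 0" using d1 d2 by (simp add: d_def)
  \<comment> \<open>A constant gauge makes fine divisions have small mesh: every cell lies in a ball
    of radius d/3, whose diameter 2d/3 is below d.\<close>
  have "gauge (\<lambda>x::real. ball x (d/3))" using d by (simp add: gauge_def)
  then obtain p where p: "p tagged_division_of {a..b}" "(\<lambda>x. ball x (d/3)) fine p"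
    using fine_division_exists_real by blast
  have small: "diameter K < d" if "(x, K) \<in> p" for x K
  proof -
    have "K \<subseteq> ball x (d/3)" using p(2) that by (auto simp: fine_def)
    then have "diameter K \<le> diameter (ball x (d/3))" by (rule diameter_subset) simp
    also have "\<dots> < d" using d by simp
    finally show ?thesis .
  qed
  have "norm (?S p - y) < e" using small d_def by (intro d1(2) p) fastforce
  moreover have "norm (?S p - z) < e" using small d_def by (intro d2(2) p) fastforce
  ultimately have "dist y z < e + e"
    by (metis dist_norm dist_triangle_less_add dist_commute)
  then show False by (simp add: e_def dist_norm)
qed

lemma young_integral_eq: "has_young_integral f g a b y \<Longrightarrow> young_integral f g a b = y"
  unfolding young_integral_def by (blast intro: has_young_integral_unique)

lemma has_young_integral_vec_nth:
  fixes f :: "real \<Rightarrow> real ^ 'n"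
  assumes "has_young_integral f g a b y"
  shows "has_young_integral (\<lambda>s. f s $ j) g a b (y $ j)"
  unfolding has_young_integral_def
proof (intro allI impI)
  fix e :: real assume "e > 0"
  let ?S = "\<lambda>p. \<Sum>(\<xi>, K)\<in>p. (g (Sup K) - g (Inf K)) *\<^sub>R f \<xi>"
  obtain \<delta> where \<delta>: "\<delta> > 0" "\<And>p. p tagged_division_of {a..b} \<Longrightarrow>
      (\<forall>(\<xi>, K)\<in>p. diameter K < \<delta>) \<Longrightarrow> norm (?S p - y) < e"
    using assms \<open>e > 0\<close> unfolding has_young_integral_def by meson
  show "\<exists>\<delta>>0. \<forall>p. p tagged_division_of {a..b} \<and> (\<forall>(\<xi>, K)\<in>p. diameter K < \<delta>) \<longrightarrow>
      norm ((\<Sum>(\<xi>, K)\<in>p. (g (Sup K) - g (Inf K)) *\<^sub>R f \<xi> $ j) - y $ j) < e"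
  proof (intro exI[of _ \<delta>] conjI allI impI \<delta>(1))
    fix p assume p: "p tagged_division_of {a..b} \<and> (\<forall>(\<xi>, K)\<in>p. diameter K < \<delta>)"
    have "(\<Sum>(\<xi>, K)\<in>p. (g (Sup K) - g (Inf K)) *\<^sub>R f \<xi> $ j) - y $ j = (?S p - y) $ j"
      by (simp add: case_prod_unfold sum_component)
    also have "norm \<dots> \<le> norm (?S p - y)" unfolding real_norm_def by (rule component_le_norm_cart)
    also have "\<dots> < e" using \<delta>(2) p by blast
    finally show "norm ((\<Sum>(\<xi>, K)\<in>p. (g (Sup K) - g (Inf K)) *\<^sub>R f \<xi> $ j) - y $ j) < e" .
  qed
qed

section \<open>Hoelder bounds, dyadic Riemann sums and the Young-Loeve estimate\<close>

definition holder_bound :: "real \<Rightarrow> real \<Rightarrow> real \<Rightarrow> (real \<Rightarrow> real) \<Rightarrow> bool" where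
  "holder_bound \<alpha> \<tau> K f \<longleftrightarrow> (\<forall>s\<in>{0..\<tau>}. \<forall>t\<in>{0..\<tau>}. \<bar>f t - f s\<bar> \<le> K * \<bar>t - s\<bar> powr \<alpha>)"

lemma holder_boundD:
  "holder_bound \<alpha> \<tau> K f \<Longrightarrow> 0 \<le> s \<Longrightarrow> s \<le> \<tau> \<Longrightarrow> 0 \<le> t \<Longrightarrow> t \<le> \<tau> \<Longrightarrow>
    \<bar>f t - f s\<bar> \<le> K * \<bar>t - s\<bar> powr \<alpha>"
  by (auto simp: holder_bound_def)

lemma holder_boundI:
  assumes "\<And>s t. 0 \<le> s \<Longrightarrow> s < t \<Longrightarrow> t \<le> \<tau> \<Longrightarrow> \<bar>f t - f s\<bar> \<le> K * (t - s) powr \<alpha>"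
  shows "holder_bound \<alpha> \<tau> K f"
  unfolding holder_bound_def
proof (intro ballI)
  fix s t assume "s \<in> {0..\<tau>}" "t \<in> {0..\<tau>}"
  then show "\<bar>f t - f s\<bar> \<le> K * \<bar>t - s\<bar> powr \<alpha>"
    using assms[of s t] assms[of t s] by (cases s t rule: linorder_cases) (auto simp: abs_minus_commute)
qed

lemma holder_bound_mono_interval:
  "holder_bound \<alpha> \<tau> K f \<Longrightarrow> \<sigma> \<le> \<tau> \<Longrightarrow> holder_bound \<alpha> \<sigma> K f"
  by (auto simp: holder_bound_def)

text \<open>On a short interval the surplus exponent is worth a small factor; smallness in time is
  obtained in this way.\<close>

lemma holder_bound_lower_exponent:
  assumes "holder_bound \<gamma> \<tau> K f" "\<beta> \<le> \<gamma>" "0 \<le> K"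
  shows "holder_bound \<beta> \<tau> (K * \<tau> powr (\<gamma> - \<beta>)) f"
  unfolding holder_bound_def
proof (intro ballI)
  fix s t assume st: "s \<in> {0..\<tau>}" "t \<in> {0..\<tau>}"
  have "\<bar>f t - f s\<bar> \<le> K * \<bar>t - s\<bar> powr \<gamma>" using assms st by (auto simp: holder_bound_def)
  also have "\<bar>t - s\<bar> powr \<gamma> = \<bar>t - s\<bar> powr (\<gamma> - \<beta>) * \<bar>t - s\<bar> powr \<beta>" by (simp flip: powr_add)
  also have "K * \<dots> \<le> K * (\<tau> powr (\<gamma> - \<beta>) * \<bar>t - s\<bar> powr \<beta>)"
    using st assms by (intro mult_left_mono mult_right_mono powr_mono2) auto
  finally show "\<bar>f t - f s\<bar> \<le> K * \<tau> powr (\<gamma> - \<beta>) * \<bar>t - s\<bar> powr \<beta>" by (simp add: mult.assoc)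
qed

text \<open>Riemann sums over a single interval that are exact up to order \<open>\<theta> > 1\<close> add up over a
  partition to an error of order \<open>\<theta> - 1\<close> in the mesh.\<close>

lemma has_young_integral_germ:
  fixes f g y :: "real \<Rightarrow> real"
  assumes th: "\<alpha> + \<beta> > 1" and "0 \<le> \<alpha>" and "0 \<le> t" and "0 \<le> a" and "0 \<le> c" and "0 \<le> C"
    and f: "holder_bound \<alpha> t a f" and g: "holder_bound \<beta> t c g"
    and germ: "\<And>u v. 0 \<le> u \<Longrightarrow> u \<le> v \<Longrightarrow> v \<le> t \<Longrightarrow>
       \<bar>y v - y u - f u * (g v - g u)\<bar> \<le> C * (v - u) powr (\<alpha> + \<beta>)"
  shows "has_young_integral f g 0 t (y t - y 0)"
  unfolding has_young_integral_def
proof (intro allI impI)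
  fix e :: real assume e: "e > 0"
  \<comment> \<open>\<open>C\<close> is the error with the tag at the left endpoint and
    \<open>a * c\<close> the cost of moving the tag from there to \<xi>; the 1 makes
    \<open>D\<close> positive, so that one may divide by it.\<close>
  define D where "D = C + a * c + 1"
  have D: "D > 0" using assms by (simp add: D_def add_nonneg_pos)
  \<comment> \<open>Solves \<open>D * (t + 1) * \<delta> powr (\<alpha> + \<beta> - 1) = e\<close>.
    With t + 1 in place of t the final bound \<open>e * (t / (t + 1))\<close> is strict, also for t
    = 0.\<close>
  define \<delta> where "\<delta> = (e / (D * (t + 1))) powr (1 / (\<alpha> + \<beta> - 1))"
  have \<delta>0: "\<delta> > 0" using e D \<open>0 \<le> t\<close> by (simp add: \<delta>_def)
  have \<delta>p: "\<delta> powr (\<alpha> + \<beta> - 1) = e / (D * (t + 1))"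
    using th e D \<open>0 \<le> t\<close> by (simp add: \<delta>_def powr_powr)
  show "\<exists>\<delta>>0. \<forall>p. p tagged_division_of {0..t} \<and> (\<forall>(\<xi>, K)\<in>p. diameter K < \<delta>) \<longrightarrow>
      norm ((\<Sum>(\<xi>, K)\<in>p. (g (Sup K) - g (Inf K)) *\<^sub>R f \<xi>) - (y t - y 0)) < e"
  proof (intro exI[of _ \<delta>] conjI allI impI \<delta>0)
    fix p assume p: "p tagged_division_of {0..t} \<and> (\<forall>(\<xi>, K)\<in>p. diameter K < \<delta>)"
    have tele: "(\<Sum>(\<xi>, K)\<in>p. h (Sup K) - h (Inf K)) = h t - h 0" for h :: "real \<Rightarrow> real"
      using p additive_tagged_division_1[OF \<open>0 \<le> t\<close>] by blast
    have pt: "\<bar>(g (Sup K) - g (Inf K)) * f \<xi> - (y (Sup K) - y (Inf K))\<bar>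
        \<le> D * \<delta> powr (\<alpha> + \<beta> - 1) * (Sup K - Inf K)" if xiK: "(\<xi>, K) \<in> p" for \<xi> K
    proof -
      obtain u v where K: "K = {u..v}"
        using tagged_division_ofD(4)[OF conjunct1[OF p] xiK] by auto
      have xi: "\<xi> \<in> K" and sub: "K \<subseteq> {0..t}"
        using p that by (auto dest: tagged_division_ofD(2,3))
      have uv: "u \<le> \<xi>" "\<xi> \<le> v" "0 \<le> u" "v \<le> t" using xi sub K by auto
      have SI: "Sup K = v" "Inf K = u" using uv K by auto
      have "diameter K < \<delta>" using p that by auto
      moreover have "dist u v \<le> diameter K"
        by (rule diameter_bounded_bound) (use K uv in auto)
      ultimately have uvd: "v - u < \<delta>" using uv by (simp add: dist_real_def)
      have 1: "\<bar>f \<xi> - f u\<bar> \<le> a * (v - u) powr \<alpha>"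
      proof -
        have "\<bar>f \<xi> - f u\<bar> \<le> a * \<bar>\<xi> - u\<bar> powr \<alpha>" using uv by (intro holder_boundD[OF f]) auto
        also have "\<dots> \<le> a * (v - u) powr \<alpha>"
          using uv \<open>0 \<le> a\<close> \<open>0 \<le> \<alpha>\<close> by (intro mult_left_mono powr_mono2) auto
        finally show ?thesis .
      qed
      have 2: "\<bar>g v - g u\<bar> \<le> c * (v - u) powr \<beta>"
        using uv holder_boundD[OF g, of u v] by auto
      have "\<bar>(f \<xi> - f u) * (g v - g u)\<bar> \<le> (a * (v - u) powr \<alpha>) * (c * (v - u) powr \<beta>)"
        unfolding abs_mult using 1 2 \<open>0 \<le> a\<close> by (intro mult_mono) auto
      also have "\<dots> = a * c * (v - u) powr (\<alpha> + \<beta>)" by (simp add: powr_add)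
      finally have "\<bar>(g v - g u) * f \<xi> - (y v - y u)\<bar> \<le> C * (v - u) powr (\<alpha> + \<beta>) + a * c * (v - u) powr (\<alpha> + \<beta>)"
        using germ[OF uv(3) order_trans[OF uv(1,2)] uv(4)] by (simp add: algebra_simps)
      also have "\<dots> \<le> D * (v - u) powr (\<alpha> + \<beta>)" by (simp add: D_def algebra_simps)
      also have "(v - u) powr (\<alpha> + \<beta>) = (v - u) powr (\<alpha> + \<beta> - 1) * (v - u)"
        using uv powr_add[of "v - u" "\<alpha> + \<beta> - 1" 1] by (cases "u = v") auto
      also have "D * \<dots> \<le> D * (\<delta> powr (\<alpha> + \<beta> - 1) * (v - u))"
        using uv uvd D th by (intro mult_left_mono mult_right_mono powr_mono2) auto
      finally show ?thesis by (simp add: SI mult.assoc)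
    qed
    have "norm ((\<Sum>(\<xi>, K)\<in>p. (g (Sup K) - g (Inf K)) *\<^sub>R f \<xi>) - (y t - y 0))
      = \<bar>\<Sum>(\<xi>, K)\<in>p. (g (Sup K) - g (Inf K)) * f \<xi> - (y (Sup K) - y (Inf K))\<bar>"
      by (simp only: tele[symmetric] sum_subtractf case_prod_unfold real_norm_def real_scaleR_def)
    also have "\<dots> \<le> (\<Sum>(\<xi>, K)\<in>p. \<bar>(g (Sup K) - g (Inf K)) * f \<xi> - (y (Sup K) - y (Inf K))\<bar>)"
      unfolding case_prod_unfold by (rule sum_abs)
    also have "\<dots> \<le> (\<Sum>(\<xi>, K)\<in>p. D * \<delta> powr (\<alpha> + \<beta> - 1) * (Sup K - Inf K))"
      using pt by (intro sum_mono) auto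
    also have "\<dots> = D * \<delta> powr (\<alpha> + \<beta> - 1) * (t - 0)"
      unfolding tele[of "\<lambda>x. x", symmetric] sum_distrib_left case_prod_unfold ..
    also have "\<dots> = e * (t / (t + 1))" using D by (simp add: \<delta>p)
    also have "\<dots> < e" using e \<open>0 \<le> t\<close> by (simp add: field_simps)
    finally show "norm ((\<Sum>(\<xi>, K)\<in>p. (g (Sup K) - g (Inf K)) *\<^sub>R f \<xi>) - (y t - y 0)) < e" .
  qed
qed

text \<open>The integrator is stopped at \<open>t\<close>, so that one partition serves all \<open>t\<close>.\<close>

definition dyadic_sum :: "(real \<Rightarrow> real) \<Rightarrow> (real \<Rightarrow> real) \<Rightarrow> nat \<Rightarrow> real \<Rightarrow> real" where
  "dyadic_sum f g n t = (\<Sum>j<2^n. f (real j / 2^n) * (g (min ((real j + 1) / 2^n) t) - g (min (real j / 2^n) t)))"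

lemma card_nat_between: 
  fixes x y :: real
  assumes "x \<le> y"
  shows "finite {j::nat. x < j \<and> j < y}" "real (card {j::nat. x < j \<and> j < y}) \<le> y - x + 1"
proof -
  have sub: "int ` {j::nat. x < j \<and> j < y} \<subseteq> {\<lfloor>x\<rfloor> + 1..\<lceil>y\<rceil> - 1}"
    by (auto; linarith)
  show fin: "finite {j::nat. x < j \<and> j < y}"
    using finite_subset[OF sub] by (simp add: finite_image_iff)
  have "card {j::nat. x < j \<and> j < y} = card (int ` {j::nat. x < j \<and> j < y})"
    by (simp add: card_image)
  also have "\<dots> \<le> card {\<lfloor>x\<rfloor> + 1..\<lceil>y\<rceil> - 1}" by (intro card_mono sub) simp
  finally have "real (card {j::nat. x < j \<and> j < y}) \<le> real (nat (\<lceil>y\<rceil> - 1 - \<lfloor>x\<rfloor>))" by simp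
  also have "\<dots> \<le> y - x + 1" using assms by linarith
  finally show "real (card {j::nat. x < j \<and> j < y}) \<le> y - x + 1" .
qed

text \<open>Only cells that meet the open interval (s, t) contribute, and counting integers between
  \<open>s * 2^n - 1\<close> and \<open>t * 2^n\<close> bounds their number independently of
  \<open>N\<close>.\<close>

lemma dyadic_sum_bound:
  fixes F :: "nat \<Rightarrow> real" and G :: "nat \<Rightarrow> real \<Rightarrow> real"
  assumes st: "s \<le> t" and K: "0 \<le> K"
    and zero: "\<And>j. (real j + 1) / 2^n \<le> s \<or> t \<le> j / 2^n \<Longrightarrow> E j = 0"
    and bd: "\<And>j. s < (real j + 1) / 2^n \<Longrightarrow> j / 2^n < t \<Longrightarrow> \<bar>E j\<bar> \<le> K"
  shows "\<bar>\<Sum>j<N. E j\<bar> \<le> ((t - s) * 2^n + 2) * K"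
proof -
  define J where "J = {j::nat. s * 2^n - 1 < j \<and> j < t * 2^n}"
  have le: "s * 2^n - 1 \<le> t * 2^n" using st by (simp add: mult_right_mono[of s t "2^n"] order_trans[of _ "s * 2^n"])
  have finJ: "finite J" and cJ: "card J \<le> (t - s) * 2^n + 2"
    using card_nat_between[OF le] by (simp_all add: J_def algebra_simps)
  have inJ: "j \<in> J \<longleftrightarrow> s < (real j + 1) / 2^n \<and> j / 2^n < t" for j
    by (simp add: J_def field_simps)
  have "\<bar>\<Sum>j<N. E j\<bar> = \<bar>\<Sum>j\<in>{..<N} \<inter> J. E j\<bar>"
    by (rule arg_cong[of _ _ abs], rule sum.mono_neutral_right) (use zero inJ in \<open>auto, meson not_le_imp_less, meson not_le_imp_less\<close>)
  also have "\<dots> \<le> (\<Sum>j\<in>{..<N} \<inter> J. \<bar>E j\<bar>)" by (rule sum_abs)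
  also have "\<dots> \<le> (\<Sum>j\<in>J. K)"
  proof (rule order_trans)
    show "(\<Sum>j\<in>{..<N} \<inter> J. \<bar>E j\<bar>) \<le> (\<Sum>j\<in>{..<N} \<inter> J. K)" using bd inJ by (intro sum_mono) auto
    show "(\<Sum>j\<in>{..<N} \<inter> J. K) \<le> (\<Sum>j\<in>J. K)" using K finJ by (intro sum_mono2) auto
  qed
  also have "\<dots> \<le> ((t - s) * 2^n + 2) * K" using cJ K by (simp add: mult_right_mono)
  finally show ?thesis .
qed

text \<open>Halving a cell keeps the tag of its left half and moves that of its right half to the
  midpoint, so only right halves survive in the difference.\<close>

lemma dyadic_sum_refine:
  "dyadic_sum f g (Suc n) t - dyadic_sum f g n t =
    (\<Sum>j<2^n. (f ((2 * real j + 1) / 2^Suc n) - f (real j / 2^n)) *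
       (g (min ((real j + 1) / 2^n) t) - g (min ((2 * real j + 1) / 2^Suc n) t)))"
proof -
  have pairs: "(\<Sum>j<2*M. F j) = (\<Sum>j<M. F (2*j) + F (2*j+1))" for F :: "nat \<Rightarrow> real" and M
    by (induction M) auto
  have e: "real (2*j) / 2^Suc n = real j / 2^n" "(2 * real j + 1 + 1) / 2^Suc n = (real j + 1) / 2^n"
    "real (2*j) + 1 = 2 * real j + 1" "real (2*j+1) = 2 * real j + 1" for j
    by (simp_all add: field_simps)
  have "(2::nat)^Suc n = 2 * 2^n" by simp
  then show ?thesis
    unfolding dyadic_sum_def by (simp only: pairs e) (simp add: sum_subtractf[symmetric] algebra_simps)
qed

text \<open>Common core of the next two estimates: \<open>m j\<close> is the midpoint of the cell
  for a refinement step and its left endpoint for the comparison with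
  \<open>f s * (g t - g s)\<close>. If the cell ends before s or \<open>m j\<close> lies beyond t,
  the two stopped increments of g cancel, so \<open>F j\<close> has to be controlled only on the
  other cells; there each increment is at most \<open>c * (1 / 2^n) powr \<beta>\<close>, whence the
  factor 2.\<close>

lemma dyadic_increment_sum_bound:
  fixes F m :: "nat \<Rightarrow> real"
  assumes g: "holder_bound \<beta> \<tau> c g" and st: "0 \<le> s" "s \<le> t" "t \<le> \<tau>"
    and pos: "0 \<le> \<beta>" "0 \<le> a" "0 \<le> c"
    and m: "\<And>j. real j / 2^n \<le> m j" "\<And>j. m j \<le> (real j + 1) / 2^n"
    and F: "\<And>j. s < (real j + 1) / 2^n \<Longrightarrow> m j < t \<Longrightarrow> \<bar>F j\<bar> \<le> a * (1 / 2^n) powr \<alpha>"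
  shows "\<bar>\<Sum>j<N. F j * ((g (min ((real j + 1) / 2^n) t) - g (min (m j) t)) -
      (g (min ((real j + 1) / 2^n) s) - g (min (m j) s)))\<bar>
    \<le> ((t - s) * 2^n + 2) * (2 * a * c * (1 / 2^n) powr (\<alpha> + \<beta>))" (is "\<bar>sum ?E _\<bar> \<le> _ * ?K")
proof (rule dyadic_sum_bound[OF st(2)])
  define r where "r j = (real j + 1) / 2^n" for j
  define h :: real where "h = 1 / 2^n"
  have rm: "0 \<le> m j" "m j \<le> r j" "r j \<le> m j + h" for j
    using m(1)[of j] m(2)[of j] order_trans[OF _ m(1)[of j], of 0]
    by (auto simp: r_def h_def add_divide_distrib)
  have E: "?E j = F j * ((g (min (r j) t) - g (min (m j) t)) - (g (min (r j) s) - g (min (m j) s)))" for j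
    by (simp add: r_def)
  show K: "0 \<le> ?K" using pos by simp
  have E0: "?E j = 0" if j: "r j \<le> s \<or> t \<le> m j" for j
    using j
  proof
    assume "r j \<le> s"
    then have "min (r j) t = r j" "min (m j) t = m j" "min (r j) s = r j" "min (m j) s = m j"
      using rm(2)[of j] st by linarith+
    then show ?thesis unfolding E by simp
  next
    assume "t \<le> m j"
    then have "min (r j) t = t" "min (m j) t = t" "min (r j) s = s" "min (m j) s = s"
      using rm(2)[of j] st by linarith+
    then show ?thesis unfolding E by simp
  qed
  show "?E j = 0" if j: "(real j + 1) / 2^n \<le> s \<or> t \<le> real j / 2^n" for j
    by (rule E0) (use j m(1)[of j] in \<open>auto simp: r_def\<close>)
  show "\<bar>?E j\<bar> \<le> ?K" if j: "s < (real j + 1) / 2^n" for j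
  proof (cases "m j < t")
    case False
    then have "?E j = 0" by (intro E0) simp
    then show ?thesis using K by (simp only: abs_zero)
  next
    case True
    have 2: "\<bar>g (min (r j) u) - g (min (m j) u)\<bar> \<le> c * h powr \<beta>" if "0 \<le> u" "u \<le> \<tau>" for u
    proof -
      have "\<bar>g (min (r j) u) - g (min (m j) u)\<bar> \<le> c * \<bar>min (r j) u - min (m j) u\<bar> powr \<beta>"
        using rm[of j] that by (intro holder_boundD[OF g]) auto
      also have "\<dots> \<le> c * h powr \<beta>"
        using rm[of j] pos by (intro mult_left_mono powr_mono2) (auto simp: min_def h_def)
      finally show ?thesis .
    qed
    have "\<bar>(g (min (r j) t) - g (min (m j) t)) - (g (min (r j) s) - g (min (m j) s))\<bar>
        \<le> c * h powr \<beta> + c * h powr \<beta>"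
      by (rule order_trans[OF abs_triangle_ineq4 add_mono[OF 2 2]]) (use st in auto)
    then have "\<bar>?E j\<bar> \<le> (a * h powr \<alpha>) * (2 * (c * h powr \<beta>))"
      unfolding E abs_mult using F[OF j True] pos by (intro mult_mono) (simp_all add: h_def)
    also have "\<dots> = ?K" by (simp add: powr_add h_def)
    finally show ?thesis .
  qed
qed

lemma dyadic_sum_step_bound:
  assumes f: "holder_bound \<alpha> \<tau> a f" and g: "holder_bound \<beta> \<tau> c g"
    and st: "0 \<le> s" "s \<le> t" "t \<le> \<tau>" and pos: "0 \<le> \<alpha>" "0 \<le> \<beta>" "0 \<le> a" "0 \<le> c"
  shows "\<bar>(dyadic_sum f g (Suc n) t - dyadic_sum f g n t) - (dyadic_sum f g (Suc n) s - dyadic_sum f g n s)\<bar>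
     \<le> ((t - s) * 2^n + 2) * (2 * a * c * (1 / 2^n) powr (\<alpha> + \<beta>))"
  unfolding dyadic_sum_refine sum_subtractf[symmetric] right_diff_distrib[symmetric]
proof (rule dyadic_increment_sum_bound[OF g st pos(2-4)])
  fix j :: nat
  show "real j / 2^n \<le> (2 * real j + 1) / 2^Suc n" "(2 * real j + 1) / 2^Suc n \<le> (real j + 1) / 2^n"
    by (simp_all add: field_simps)
  have d: "(2 * real j + 1) / 2^Suc n - real j / 2^n = 1 / 2^n / 2" by (simp add: field_simps)
  assume lt: "(2 * real j + 1) / 2^Suc n < t"
  have "\<bar>f ((2 * real j + 1) / 2^Suc n) - f (real j / 2^n)\<bar> \<le> a * \<bar>(2 * real j + 1) / 2^Suc n - real j / 2^n\<bar> powr \<alpha>"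
  proof (rule holder_boundD[OF f])
    have "real j / 2^n \<le> (2 * real j + 1) / 2^Suc n" by (simp add: field_simps)
    then show "real j / 2^n \<le> \<tau>" using lt st by linarith
  qed (use lt st in auto)
  also have "\<dots> \<le> a * (1 / 2^n) powr \<alpha>"
    unfolding d using pos by (intro mult_left_mono powr_mono2) (auto simp: field_simps)
  finally show "\<bar>f ((2 * real j + 1) / 2^Suc n) - f (real j / 2^n)\<bar> \<le> a * (1 / 2^n) powr \<alpha>" .
qed

text \<open>On a level whose cells are at least as long as t - s, at most three cells contribute,
  each with a tag within one cell length of s; this gives 6 = 3 * 2. The telescoping needs the
  partition of [0, 1] to reach t, which is ensured by \<open>\<tau> \<le> 1\<close>.\<close>

lemma dyadic_sum_base_bound:
  assumes f: "holder_bound \<alpha> \<tau> a f" and g: "holder_bound \<beta> \<tau> c g"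
    and st: "0 \<le> s" "s \<le> t" "t \<le> \<tau>" "\<tau> \<le> 1" "t - s \<le> 1 / 2^n"
    and pos: "0 \<le> \<alpha>" "0 \<le> \<beta>" "0 \<le> a" "0 \<le> c"
  shows "\<bar>dyadic_sum f g n t - dyadic_sum f g n s - f s * (g t - g s)\<bar>
     \<le> 6 * a * c * (1 / 2^n) powr (\<alpha> + \<beta>)"
proof -
  let ?D = "\<lambda>j u. g (min ((real j + 1) / 2^n) u) - g (min (real j / 2^n) u)"
  have tele: "(\<Sum>j<2^n. ?D j u) = g u - g 0" if "0 \<le> u" "u \<le> 1" for u
  proof -
    have "(\<Sum>j<2^n. ?D j u) = (\<Sum>j<2^n. g (min (real (Suc j) / 2^n) u) - g (min (real j / 2^n) u))"
      by (simp add: add.commute)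
    also have "\<dots> = g (min (real (2^n) / 2^n) u) - g (min (real 0 / 2^n) u)" by (rule sum_lessThan_telescope)
    finally show ?thesis using that by simp
  qed
  have "dyadic_sum f g n t - dyadic_sum f g n s - f s * (g t - g s) =
      dyadic_sum f g n t - dyadic_sum f g n s - f s * ((\<Sum>j<2^n. ?D j t) - (\<Sum>j<2^n. ?D j s))"
    using tele[of t] tele[of s] st by simp
  also have "\<dots> = (\<Sum>j<2^n. (f (real j / 2^n) - f s) * (?D j t - ?D j s))"
    unfolding dyadic_sum_def sum_distrib_left sum_subtractf[symmetric]
    by (intro sum.cong refl) (simp add: algebra_simps)
  also have "\<bar>\<dots>\<bar> \<le> ((t - s) * 2^n + 2) * (2 * a * c * (1 / 2^n) powr (\<alpha> + \<beta>))"
  proof (rule dyadic_increment_sum_bound[OF g st(1-3) pos(2-4)])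
    fix j :: nat assume "s < (real j + 1) / 2^n" and jt: "real j / 2^n < t"
    then have js: "s < real j / 2^n + 1 / 2^n" by (simp add: add_divide_distrib)
    have "\<bar>f (real j / 2^n) - f s\<bar> \<le> a * \<bar>real j / 2^n - s\<bar> powr \<alpha>"
      using jt st by (intro holder_boundD[OF f]) auto
    also have "\<dots> \<le> a * (1 / 2^n) powr \<alpha>"
    proof (intro mult_left_mono powr_mono2 pos)
      show "\<bar>real j / 2^n - s\<bar> \<le> 1 / 2^n" using js jt st(5) by linarith
    qed simp
    finally show "\<bar>f (real j / 2^n) - f s\<bar> \<le> a * (1 / 2^n) powr \<alpha>" .
  qed (simp_all add: divide_right_mono)
  also have "\<dots> \<le> 3 * (2 * a * c * (1 / 2^n) powr (\<alpha> + \<beta>))"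
    using st pos by (intro mult_right_mono) (auto simp: field_simps)
  finally show ?thesis by simp
qed

text \<open>First summand: the comparison on a level n with \<open>1 / 2^n < 2 * (t - s)\<close>.
  Second summand: all finer levels, a geometric series of ratio
  \<open>2 powr (1 - \<theta>)\<close>, where 10 = 5 * 2 comes from counting at most
  \<open>5 * (t - s) * 2^m\<close> cells on level m.\<close>

definition young_const :: "real \<Rightarrow> real" where
  "young_const \<theta> = 6 * 2 powr \<theta> + 10 * 2 powr (\<theta> - 1) / (1 - 2 powr (1 - \<theta>))"

lemma young_const_nonneg: "\<theta> > 1 \<Longrightarrow> 0 \<le> young_const \<theta>"
  unfolding young_const_def
  by (intro add_nonneg_nonneg divide_nonneg_nonneg) (simp_all add: less_imp_le[OF powr_less_one])

lemma ex_dyadic_scale: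
  fixes x :: real
  assumes "0 < x" "x \<le> 1"
  obtains n where "x \<le> 1 / 2^n" "1 / 2^n < 2 * x"
proof -
  obtain k where "(1/2::real)^k < x" using real_arch_pow_inv[of x "1/2"] assms by auto
  then have ex: "\<exists>k. 1 / 2^k < x" by (auto simp: power_one_over)
  define k where "k = (LEAST k. 1 / 2^k < x)"
  have k: "1 / 2^k < x" unfolding k_def by (rule LeastI_ex[OF ex])
  then have "k \<noteq> 0" using assms by (intro notI) simp
  then obtain n where n: "k = Suc n" by (meson not0_implies_Suc)
  have "\<not> 1 / 2^n < x" using not_less_Least[of n "\<lambda>k. 1 / 2^k < x"] n k_def by simp
  then show ?thesis using that[of n] k n by (simp add: field_simps)
qed

text \<open>The argument is that of the sewing lemma. The function y is the limit of the dyadic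
  sums, and for given s < t the series of refinements is split at the level whose mesh is comparable
  with t - s: the sum on that level is close to \<open>f s * (g t - g s)\<close>, and the
  refinements after it are summable because \<open>\<alpha> + \<beta> > 1\<close>.\<close>

lemma young_loeve:
  fixes f g :: "real \<Rightarrow> real"
  assumes th: "\<alpha> + \<beta> > 1" and pos: "0 \<le> \<alpha>" "0 \<le> \<beta>" "0 \<le> a" "0 \<le> c" and tau: "\<tau> \<le> 1"
    and f: "holder_bound \<alpha> \<tau> a f" and g: "holder_bound \<beta> \<tau> c g"
  obtains y where "\<And>s t. 0 \<le> s \<Longrightarrow> s \<le> t \<Longrightarrow> t \<le> \<tau> \<Longrightarrow>
      \<bar>y t - y s - f s * (g t - g s)\<bar> \<le> young_const (\<alpha> + \<beta>) * a * c * (t - s) powr (\<alpha> + \<beta>)"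
    and "y 0 = 0"
proof -
  define \<theta> where "\<theta> = \<alpha> + \<beta>"
  have th1: "\<theta> > 1" using th by (simp add: \<theta>_def)
  \<comment> \<open>Of the order of \<open>2^n\<close> cells, each with an error of order
    \<open>(1 / 2^n) powr \<theta>\<close>: refining level n costs \<open>q^n\<close> up to a
    constant.\<close>
  define q where "q = 2 powr (1 - \<theta>)"
  have q: "0 < q" "q < 1" using th1 by (simp_all add: q_def powr_less_one)
  have qn: "2^n * (1 / 2^n) powr \<theta> = q^n" for n
  proof -
    have "2^n * (1 / 2^n) powr \<theta> = (2 powr real n) * (2 powr (- real n)) powr \<theta>"
      by (simp add: powr_minus_divide powr_realpow)
    also have "\<dots> = 2 powr (real n * (1 - \<theta>))" by (simp add: powr_powr powr_add[symmetric] algebra_simps)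
    also have "\<dots> = q^n" by (simp add: q_def powr_powr powr_realpow[symmetric] mult.commute)
    finally show ?thesis .
  qed
  define D where "D n t = dyadic_sum f g (Suc n) t - dyadic_sum f g n t" for n t
  have D: "\<bar>D n t - D n s\<bar> \<le> ((t - s) * 2^n + 2) * (2 * a * c * (1 / 2^n) powr \<theta>)"
    if "0 \<le> s" "s \<le> t" "t \<le> \<tau>" for s t n
    unfolding D_def \<theta>_def by (rule dyadic_sum_step_bound[OF f g that pos])
  have ds0: "dyadic_sum f g n 0 = 0" for n
    unfolding dyadic_sum_def by (rule sum.neutral) (simp add: min_absorb2)
  have D0: "D n 0 = 0" for n by (simp add: D_def ds0)
  have sumD: "summable (\<lambda>n. D n t)" if "0 \<le> t" "t \<le> \<tau>" for t
  proof (rule summable_comparison_test')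
    show "summable (\<lambda>n. 6 * a * c * q^n)" using q by (intro summable_mult summable_geometric) simp
    show "norm (D n t) \<le> 6 * a * c * q^n" for n
    proof -
      have "norm (D n t) \<le> (t * 2^n + 2) * (2 * a * c * (1 / 2^n) powr \<theta>)"
        using D[of 0 t n] that by (simp add: D0)
      also have "\<dots> \<le> (3 * 2^n) * (2 * a * c * (1 / 2^n) powr \<theta>)"
      proof (rule mult_right_mono)
        have "t * 2^n \<le> 1 * 2^n" using that tau by (intro mult_right_mono) auto
        moreover have "(1::real) \<le> 2^n" by simp
        ultimately show "t * 2^n + 2 \<le> 3 * 2^n" by linarith
      qed (use pos in simp)
      also have "\<dots> = 6 * a * c * q^n" using qn[of n] by (simp add: algebra_simps)
      finally show ?thesis .
    qed
  qed
  define y where "y t = dyadic_sum f g 0 t + (\<Sum>n. D n t)" for t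
  have ysplit: "y t = dyadic_sum f g n t + (\<Sum>m. D (m + n) t)" if "0 \<le> t" "t \<le> \<tau>" for t n
  proof -
    have "(\<Sum>i<n. D i t) = dyadic_sum f g n t - dyadic_sum f g 0 t"
      unfolding D_def by (rule sum_lessThan_telescope)
    then show ?thesis using suminf_split_initial_segment[OF sumD[OF that], of n] by (simp add: y_def)
  qed
  show ?thesis
  proof
    show "y 0 = 0" by (simp add: y_def ds0 D0)
    fix s t :: real assume st: "0 \<le> s" "s \<le> t" "t \<le> \<tau>"
    show "\<bar>y t - y s - f s * (g t - g s)\<bar> \<le> young_const (\<alpha> + \<beta>) * a * c * (t - s) powr (\<alpha> + \<beta>)"
    proof (cases "s = t")
      case True
      then show ?thesis by simp
    next
      case False
      then have ts: "0 < t - s" "t - s \<le> 1" using st tau by auto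
      obtain n where n: "t - s \<le> 1 / 2^n" "1 / 2^n < 2 * (t - s)" using ex_dyadic_scale[OF ts] .
      have "\<bar>dyadic_sum f g n t - dyadic_sum f g n s - f s * (g t - g s)\<bar> \<le> 6 * a * c * (1 / 2^n) powr \<theta>"
        unfolding \<theta>_def by (rule dyadic_sum_base_bound[OF f g st tau n(1) pos])
      also have "\<dots> \<le> 6 * a * c * (2 * (t - s)) powr \<theta>"
        using n th1 pos by (intro mult_left_mono powr_mono2) auto
      also have "(2 * (t - s)) powr \<theta> = 2 powr \<theta> * (t - s) powr \<theta>" using ts by (subst powr_mult) auto
      finally have 1: "\<bar>dyadic_sum f g n t - dyadic_sum f g n s - f s * (g t - g s)\<bar>
          \<le> 6 * 2 powr \<theta> * a * c * (t - s) powr \<theta>" by (simp add: mult_ac)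
      have bd: "norm (D (m + n) t - D (m + n) s) \<le> 10 * a * c * (t - s) * q^n * q^m" for m
      proof -
        have "norm (D (m + n) t - D (m + n) s) \<le> ((t - s) * 2^(m+n) + 2) * (2 * a * c * (1 / 2^(m+n)) powr \<theta>)"
          using D[OF st] by simp
        also have "\<dots> \<le> (5 * (t - s) * 2^(m+n)) * (2 * a * c * (1 / 2^(m+n)) powr \<theta>)"
        proof (rule mult_right_mono)
          \<comment> \<open>The mesh of level n is below \<open>2 * (t - s)\<close>, so the two
            boundary cells count for at most \<open>4 * (t - s) * 2^(m+n)\<close>, and 1 + 4 =
            5.\<close>
          have "1 \<le> 2 * (t - s) * 2^n" using n(2) by (simp add: field_simps)
          also have "\<dots> \<le> 2 * (t - s) * 2^(m+n)" using ts by (intro mult_left_mono power_increasing) auto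
          finally show "(t - s) * 2^(m+n) + 2 \<le> 5 * (t - s) * 2^(m+n)" unfolding mult.assoc by linarith
        qed (use pos in simp)
        also have "\<dots> = 10 * a * c * (t - s) * (2^(m+n) * (1 / 2^(m+n)) powr \<theta>)" by (simp only: mult_ac)
        also have "\<dots> = 10 * a * c * (t - s) * q^n * q^m" by (simp only: qn) (simp add: power_add)
        finally show ?thesis .
      qed
      have sq: "summable (\<lambda>m. 10 * a * c * (t - s) * q^n * q^m)"
        using q by (intro summable_mult summable_geometric) simp
      have "(\<Sum>m. D (m + n) t) - (\<Sum>m. D (m + n) s) = (\<Sum>m. D (m + n) t - D (m + n) s)"
        using st by (intro suminf_diff summable_ignore_initial_segment sumD) auto
      also have "norm \<dots> \<le> (\<Sum>m. 10 * a * c * (t - s) * q^n * q^m)"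
        by (rule norm_suminf_le[OF bd sq])
      also have "\<dots> = 10 * a * c * (t - s) * q^n / (1 - q)"
        using q by (subst suminf_mult) (auto simp: suminf_geometric)
      also have "\<dots> \<le> 10 * a * c * (t - s) * (2 * (t - s)) powr (\<theta> - 1) / (1 - q)"
      proof (intro divide_right_mono mult_left_mono)
        have "q^n = (1 / 2^n) powr (\<theta> - 1)"
          using qn[of n] by (simp add: powr_diff mult.commute)
        also have "\<dots> \<le> (2 * (t - s)) powr (\<theta> - 1)" using n th1 by (intro powr_mono2) auto
        finally show "q^n \<le> (2 * (t - s)) powr (\<theta> - 1)" .
      qed (use pos ts q in auto)
      also have "\<dots> = 10 * 2 powr (\<theta> - 1) / (1 - q) * a * c * ((t - s) powr (\<theta> - 1) * (t - s) powr 1)"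
        using ts using powr_mult[of 2 "t - s" "\<theta> - 1"] by simp
      also have "(t - s) powr (\<theta> - 1) * (t - s) powr 1 = (t - s) powr \<theta>"
        using powr_add[of "t - s" "\<theta> - 1" 1] by simp
      finally have 2: "\<bar>(\<Sum>m. D (m + n) t) - (\<Sum>m. D (m + n) s)\<bar> \<le> 10 * 2 powr (\<theta> - 1) / (1 - q) * a * c * (t - s) powr \<theta>"
        by simp
      have "y t - y s - f s * (g t - g s) = (dyadic_sum f g n t - dyadic_sum f g n s - f s * (g t - g s))
          + ((\<Sum>m. D (m + n) t) - (\<Sum>m. D (m + n) s))"
        using ysplit[of t n] ysplit[of s n] st by simp
      then have "\<bar>y t - y s - f s * (g t - g s)\<bar> \<le> 6 * 2 powr \<theta> * a * c * (t - s) powr \<theta>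
          + 10 * 2 powr (\<theta> - 1) / (1 - q) * a * c * (t - s) powr \<theta>"
        using 1 2 by linarith
      also have "\<dots> = young_const \<theta> * a * c * (t - s) powr \<theta>"
        unfolding young_const_def q_def by (simp only: distrib_right)
      finally show ?thesis by (simp add: \<theta>_def)
    qed
  qed
qed

section \<open>Integration in the algebra of Hoelder functions\<close>

text \<open>The norm \<open>sup \<bar>f\<bar> + [f]\<^sub>\<beta>\<close> on \<open>[0, \<tau>]\<close> is at most \<open>K\<close>. The quotient is 0 for \<open>s = t\<close>, so
  this includes \<open>\<bar>f u\<bar> \<le> K\<close> even if \<open>\<tau> = 0\<close>.\<close>

definition hnorm_le :: "real \<Rightarrow> real \<Rightarrow> real \<Rightarrow> (real \<Rightarrow> real) \<Rightarrow> bool" where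
  "hnorm_le \<beta> \<tau> K f \<longleftrightarrow>
     (\<forall>u\<in>{0..\<tau>}. \<forall>s\<in>{0..\<tau>}. \<forall>t\<in>{0..\<tau>}. \<bar>f u\<bar> + \<bar>f t - f s\<bar> / \<bar>t - s\<bar> powr \<beta> \<le> K)"

lemma hnorm_leD:
  "hnorm_le \<beta> \<tau> K f \<Longrightarrow> u \<in> {0..\<tau>} \<Longrightarrow> s \<in> {0..\<tau>} \<Longrightarrow> t \<in> {0..\<tau>} \<Longrightarrow>
    \<bar>f u\<bar> + \<bar>f t - f s\<bar> / \<bar>t - s\<bar> powr \<beta> \<le> K"
  by (simp add: hnorm_le_def)

lemma hnorm_le_abs: "hnorm_le \<beta> \<tau> K f \<Longrightarrow> u \<in> {0..\<tau>} \<Longrightarrow> \<bar>f u\<bar> \<le> K"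
  using hnorm_leD[of \<beta> \<tau> K f u u u] by simp

lemma hnorm_le_nonneg: "hnorm_le \<beta> \<tau> K f \<Longrightarrow> 0 \<le> \<tau> \<Longrightarrow> 0 \<le> K"
  using hnorm_le_abs[of \<beta> \<tau> K f 0] by simp

lemma hnorm_le_holder:
  assumes "hnorm_le \<beta> \<tau> K f"
  shows "holder_bound \<beta> \<tau> K f"
  unfolding holder_bound_def
proof (intro ballI)
  fix s t assume st: "s \<in> {0..\<tau>}" "t \<in> {0..\<tau>}"
  show "\<bar>f t - f s\<bar> \<le> K * \<bar>t - s\<bar> powr \<beta>"
  proof (cases "s = t")
    case False
    have "\<bar>f t - f s\<bar> / \<bar>t - s\<bar> powr \<beta> \<le> K" using hnorm_leD[OF assms st(1) st] by simp
    then show ?thesis using False by (simp add: divide_le_eq)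
  qed simp
qed

lemma hnorm_leI:
  assumes "\<And>u. 0 \<le> u \<Longrightarrow> u \<le> \<tau> \<Longrightarrow> \<bar>f u\<bar> \<le> a"
    and "\<And>s t. 0 \<le> s \<Longrightarrow> s < t \<Longrightarrow> t \<le> \<tau> \<Longrightarrow> \<bar>f t - f s\<bar> \<le> c * (t - s) powr \<beta>" and "0 \<le> c" and "a + c \<le> K"
  shows "hnorm_le \<beta> \<tau> K f"
  unfolding hnorm_le_def
proof (intro ballI)
  fix u s t assume u: "u \<in> {0..\<tau>}" and st: "s \<in> {0..\<tau>}" "t \<in> {0..\<tau>}"
  have q: "\<bar>f t - f s\<bar> / \<bar>t - s\<bar> powr \<beta> \<le> c" if "s < t" "s \<in> {0..\<tau>}" "t \<in> {0..\<tau>}" for s t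
    using assms(2)[of s t] that by (simp add: divide_le_eq)
  have "\<bar>f t - f s\<bar> / \<bar>t - s\<bar> powr \<beta> \<le> c"
    using q[of s t] q[of t s] st \<open>0 \<le> c\<close> by (cases s t rule: linorder_cases) (auto simp: abs_minus_commute)
  then show "\<bar>f u\<bar> + \<bar>f t - f s\<bar> / \<bar>t - s\<bar> powr \<beta> \<le> K"
    using assms(1)[of u] u assms(4) by auto
qed

lemma hnorm_le_cong:
  "hnorm_le \<beta> \<tau> K f \<Longrightarrow> (\<And>t. 0 \<le> t \<Longrightarrow> t \<le> \<tau> \<Longrightarrow> f t = g t) \<Longrightarrow> hnorm_le \<beta> \<tau> K g"
  by (auto simp: hnorm_le_def)

lemma hnorm_le_mono: "hnorm_le \<beta> \<tau> K f \<Longrightarrow> K \<le> L \<Longrightarrow> hnorm_le \<beta> \<tau> L f"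
  by (force simp: hnorm_le_def)

lemma hnorm_le_const: "hnorm_le \<beta> \<tau> \<bar>c\<bar> (\<lambda>t. c)"
  by (simp add: hnorm_le_def)

lemma hnorm_le_add:
  assumes f: "hnorm_le \<beta> \<tau> K f" and g: "hnorm_le \<beta> \<tau> L g"
  shows "hnorm_le \<beta> \<tau> (K + L) (\<lambda>t. f t + g t)"
  unfolding hnorm_le_def
proof (intro ballI)
  fix u s t assume *: "u \<in> {0..\<tau>}" "s \<in> {0..\<tau>}" "t \<in> {0..\<tau>}"
  have "\<bar>(f t + g t) - (f s + g s)\<bar> / \<bar>t - s\<bar> powr \<beta>
      \<le> (\<bar>f t - f s\<bar> + \<bar>g t - g s\<bar>) / \<bar>t - s\<bar> powr \<beta>" by (intro divide_right_mono) auto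
  then show "\<bar>f u + g u\<bar> + \<bar>(f t + g t) - (f s + g s)\<bar> / \<bar>t - s\<bar> powr \<beta> \<le> K + L"
    using hnorm_leD[OF f *] hnorm_leD[OF g *] abs_triangle_ineq[of "f u" "g u"]
    unfolding add_divide_distrib by argo
qed

lemma hnorm_le_scale:
  assumes f: "hnorm_le \<beta> \<tau> K f"
  shows "hnorm_le \<beta> \<tau> (\<bar>c\<bar> * K) (\<lambda>t. c * f t)"
  unfolding hnorm_le_def
proof (intro ballI)
  fix u s t assume *: "u \<in> {0..\<tau>}" "s \<in> {0..\<tau>}" "t \<in> {0..\<tau>}"
  have "\<bar>c * f u\<bar> + \<bar>c * f t - c * f s\<bar> / \<bar>t - s\<bar> powr \<beta> = \<bar>c\<bar> * (\<bar>f u\<bar> + \<bar>f t - f s\<bar> / \<bar>t - s\<bar> powr \<beta>)"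
    by (simp add: abs_mult distrib_left flip: right_diff_distrib)
  then show "\<bar>c * f u\<bar> + \<bar>c * f t - c * f s\<bar> / \<bar>t - s\<bar> powr \<beta> \<le> \<bar>c\<bar> * K"
    using hnorm_leD[OF f *] by (simp add: mult_left_mono)
qed

lemma hnorm_le_diff:
  assumes "hnorm_le \<beta> \<tau> K f" "hnorm_le \<beta> \<tau> L g"
  shows "hnorm_le \<beta> \<tau> (K + L) (\<lambda>t. f t - g t)"
  using hnorm_le_add[OF assms(1) hnorm_le_scale[OF assms(2), of "-1"]] by simp

lemma hnorm_le_sum:
  assumes "\<And>i. i \<in> A \<Longrightarrow> hnorm_le \<beta> \<tau> (K i) (f i)"
  shows "hnorm_le \<beta> \<tau> (\<Sum>i\<in>A. K i) (\<lambda>t. \<Sum>i\<in>A. f i t)"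
  using assms
proof (induction A rule: infinite_finite_induct)
  case (insert x F)
  then show ?case using hnorm_le_add[of \<beta> \<tau> "K x" "f x" "\<Sum>i\<in>F. K i" "\<lambda>t. \<Sum>i\<in>F. f i t"] by simp
qed (auto simp: hnorm_le_def)

text \<open>The norm is a sum and not a maximum, so that \<open>(a + F) * (c + G)\<close> contains
  all of \<open>a * c + a * G + c * F\<close>. The constant of the algebra is therefore 1, and a
  monomial of degree k in functions of norm \<rho> costs exactly \<open>\<rho> ^ k\<close>.\<close>

lemma hnorm_le_mult:
  assumes f: "hnorm_le \<beta> \<tau> K f" and g: "hnorm_le \<beta> \<tau> L g"
  shows "hnorm_le \<beta> \<tau> (K * L) (\<lambda>t. f t * g t)"
  unfolding hnorm_le_def
proof (intro ballI)
  fix u s t assume u: "u \<in> {0..\<tau>}" and s: "s \<in> {0..\<tau>}" and t: "t \<in> {0..\<tau>}"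
  \<comment> \<open>Stand-ins for the suprema: each maximum is attained at one of the two points,
    and there the bound applies jointly with the difference quotient.\<close>
  define a c where "a = max \<bar>f u\<bar> \<bar>f t\<bar>" and "c = max \<bar>g u\<bar> \<bar>g s\<bar>"
  define F G where "F = \<bar>f t - f s\<bar> / \<bar>t - s\<bar> powr \<beta>" and "G = \<bar>g t - g s\<bar> / \<bar>t - s\<bar> powr \<beta>"
  have pos: "0 \<le> a" "0 \<le> c" "0 \<le> F" "0 \<le> G" by (auto simp: a_def c_def F_def G_def)
  have 1: "a + F \<le> K" using hnorm_leD[OF f u s t] hnorm_leD[OF f t s t] by (simp add: a_def F_def max_def)
  have 2: "c + G \<le> L" using hnorm_leD[OF g u s t] hnorm_leD[OF g s s t] by (simp add: c_def G_def max_def)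
  have "f t * g t - f s * g s = f t * (g t - g s) + g s * (f t - f s)" by (simp add: algebra_simps)
  then have "\<bar>f t * g t - f s * g s\<bar> \<le> \<bar>f t\<bar> * \<bar>g t - g s\<bar> + \<bar>g s\<bar> * \<bar>f t - f s\<bar>"
    by (metis abs_triangle_ineq abs_mult)
  also have "\<dots> \<le> a * \<bar>g t - g s\<bar> + c * \<bar>f t - f s\<bar>"
    by (intro add_mono mult_right_mono) (auto simp: a_def c_def)
  finally have "\<bar>f t * g t - f s * g s\<bar> / \<bar>t - s\<bar> powr \<beta> \<le> (a * \<bar>g t - g s\<bar> + c * \<bar>f t - f s\<bar>) / \<bar>t - s\<bar> powr \<beta>"
    by (intro divide_right_mono) auto
  also have "\<dots> = a * G + c * F" by (simp add: G_def F_def add_divide_distrib)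
  finally have 3: "\<bar>f t * g t - f s * g s\<bar> / \<bar>t - s\<bar> powr \<beta> \<le> a * G + c * F" .
  have 4: "\<bar>f u * g u\<bar> \<le> a * c" unfolding abs_mult by (intro mult_mono) (auto simp: a_def c_def)
  have "a * c + (a * G + c * F) \<le> (a + F) * (c + G)" using pos by (simp add: algebra_simps)
  also have "\<dots> \<le> K * L" using 1 2 pos by (intro mult_mono) auto
  finally show "\<bar>f u * g u\<bar> + \<bar>f t * g t - f s * g s\<bar> / \<bar>t - s\<bar> powr \<beta> \<le> K * L"
    using 3 4 by linarith
qed

lemma hnorm_le_power:
  assumes "hnorm_le \<beta> \<tau> K f"
  shows "hnorm_le \<beta> \<tau> (K ^ n) (\<lambda>t. f t ^ n)"
proof (induction n)
  case 0
  show ?case using hnorm_le_const[of \<beta> \<tau> 1] by simp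
next
  case (Suc n)
  then show ?case using hnorm_le_mult[OF assms Suc] by simp
qed

lemma hnorm_le_prod:
  assumes "\<And>i. i \<in> A \<Longrightarrow> hnorm_le \<beta> \<tau> (K i) (f i)"
  shows "hnorm_le \<beta> \<tau> (\<Prod>i\<in>A. K i) (\<lambda>t. \<Prod>i\<in>A. f i t)"
  using assms
proof (induction A rule: infinite_finite_induct)
  case (insert x F)
  then show ?case using hnorm_le_mult[of \<beta> \<tau> "K x" "f x" "\<Prod>i\<in>F. K i" "\<lambda>t. \<Prod>i\<in>F. f i t"] by simp
qed (use hnorm_le_const[of \<beta> \<tau> 1] in auto)

text \<open>Telescoping over the factors. With the error of a factor written relative to its size,
  as \<open>K i * m i * e\<close>, the weights \<open>m i\<close> add up. Weights 1 give the powers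
  of one coordinate, and exponents as weights then give a monomial, with its degree in
  front.\<close>

lemma hnorm_le_prod_diff:
  assumes "finite A" "0 \<le> \<tau>" "0 \<le> e" 
    and "\<And>i. i \<in> A \<Longrightarrow> hnorm_le \<beta> \<tau> (K i) (f i)" "\<And>i. i \<in> A \<Longrightarrow> hnorm_le \<beta> \<tau> (K i) (g i)"
    and "\<And>i. i \<in> A \<Longrightarrow> hnorm_le \<beta> \<tau> (K i * m i * e) (\<lambda>t. f i t - g i t)"
    and "\<And>i. i \<in> A \<Longrightarrow> 0 \<le> m i"
  shows "hnorm_le \<beta> \<tau> ((\<Prod>i\<in>A. K i) * (\<Sum>i\<in>A. m i) * e) (\<lambda>t. (\<Prod>i\<in>A. f i t) - (\<Prod>i\<in>A. g i t))"
  using assms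
proof (induction A rule: finite_induct)
  case empty
  then show ?case using hnorm_le_const[of \<beta> \<tau> 0] by simp
next
  case (insert x F)
  let ?P = "\<Prod>i\<in>F. K i" and ?f = "\<lambda>t. \<Prod>i\<in>F. f i t" and ?g = "\<lambda>t. \<Prod>i\<in>F. g i t"
  have ih: "hnorm_le \<beta> \<tau> (?P * (\<Sum>i\<in>F. m i) * e) (\<lambda>t. ?f t - ?g t)" using insert by auto
  have "hnorm_le \<beta> \<tau> (K x * m x * e * ?P + K x * (?P * (\<Sum>i\<in>F. m i) * e))
      (\<lambda>t. (f x t - g x t) * ?f t + g x t * (?f t - ?g t))"
    by (intro hnorm_le_add hnorm_le_mult hnorm_le_prod ih insert.prems) auto
  moreover have "K x * m x * e * ?P + K x * (?P * (\<Sum>i\<in>F. m i) * e) = (\<Prod>i\<in>insert x F. K i) * (\<Sum>i\<in>insert x F. m i) * e"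
    using insert.hyps by (simp add: algebra_simps)
  moreover have "(f x t - g x t) * ?f t + g x t * (?f t - ?g t) = (\<Prod>i\<in>insert x F. f i t) - (\<Prod>i\<in>insert x F. g i t)" for t
    using insert.hyps by (simp add: algebra_simps)
  ultimately show ?case by simp
qed

text \<open>Lower semicontinuity of the norm. Uniform bounds together with pointwise limits take the
  place of completeness of the Hoelder space.\<close>

lemma hnorm_le_limit:
  assumes "F \<noteq> bot" "\<forall>\<^sub>F n in F. hnorm_le \<beta> \<tau> K (h n)"
    and "\<And>t. 0 \<le> t \<Longrightarrow> t \<le> \<tau> \<Longrightarrow> ((\<lambda>n. h n t) \<longlongrightarrow> f t) F"
  shows "hnorm_le \<beta> \<tau> K f"
  unfolding hnorm_le_def
proof (intro ballI)
  fix u s t assume *: "u \<in> {0..\<tau>}" "s \<in> {0..\<tau>}" "t \<in> {0..\<tau>}"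
  show "\<bar>f u\<bar> + \<bar>f t - f s\<bar> / \<bar>t - s\<bar> powr \<beta> \<le> K"
  proof (rule tendsto_upperbound[OF _ _ assms(1)])
    show "((\<lambda>n. \<bar>h n u\<bar> + \<bar>h n t - h n s\<bar> / \<bar>t - s\<bar> powr \<beta>) \<longlongrightarrow> \<bar>f u\<bar> + \<bar>f t - f s\<bar> / \<bar>t - s\<bar> powr \<beta>) F"
      using * assms(3) unfolding divide_inverse by (intro tendsto_intros) auto
    show "\<forall>\<^sub>F n in F. \<bar>h n u\<bar> + \<bar>h n t - h n s\<bar> / \<bar>t - s\<bar> powr \<beta> \<le> K"
      using assms(2) by eventually_elim (use * in \<open>simp add: hnorm_leD\<close>)
  qed
qed

text \<open>A single path is fixed. One exponent \<open>\<beta> > 1/2\<close> serves integrands and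
  integrators, as \<open>2 * \<beta> > 1\<close> is then Young's condition;
  \<open>\<tau> \<le> 1\<close> fits the dyadic partition of [0, 1] and bounds
  \<open>(t - s) powr (2 * \<beta>)\<close> by \<open>(t - s) powr \<beta>\<close>.\<close>

locale holder_driver =
  fixes \<beta> \<tau> \<kappa> :: real and d :: nat and b :: "nat \<Rightarrow> real \<Rightarrow> real"
  assumes beta: "1/2 < \<beta>" "\<beta> \<le> 1" and tau: "0 \<le> \<tau>" "\<tau> \<le> 1" and kappa: "0 \<le> \<kappa>"
    and driver: "i \<le> d \<Longrightarrow> holder_bound \<beta> \<tau> \<kappa> (b i)"
begin

abbreviation hn :: "real \<Rightarrow> (real \<Rightarrow> real) \<Rightarrow> bool" where "hn \<equiv> hnorm_le \<beta> \<tau>"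

abbreviation defect :: "(real \<Rightarrow> real) \<Rightarrow> (nat \<Rightarrow> real \<Rightarrow> real) \<Rightarrow> real \<Rightarrow> real \<Rightarrow> real" where
  "defect y p s t \<equiv> \<bar>y t - y s - (\<Sum>i\<le>d. p i s * (b i t - b i s))\<bar>"

text \<open>\<open>germ y p\<close> expresses \<open>dy = \<Sum>\<^sub>i p\<^sub>i db\<^sup>i\<close>.\<close>

definition germ :: "(real \<Rightarrow> real) \<Rightarrow> (nat \<Rightarrow> real \<Rightarrow> real) \<Rightarrow> bool" where
  "germ y p \<longleftrightarrow> (\<exists>C\<ge>0. \<forall>s t. 0 \<le> s \<longrightarrow> s \<le> t \<longrightarrow> t \<le> \<tau> \<longrightarrow>
     defect y p s t \<le> C * (t - s) powr (2 * \<beta>))"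

lemma germI:
  assumes "\<And>s t. 0 \<le> s \<Longrightarrow> s \<le> t \<Longrightarrow> t \<le> \<tau> \<Longrightarrow>
     defect y p s t \<le> C * (t - s) powr (2 * \<beta>)"
  shows "germ y p"
  unfolding germ_def
proof (intro exI[of _ "\<bar>C\<bar>"] conjI allI impI)
  fix s t assume "0 \<le> s" "s \<le> t" "t \<le> \<tau>"
  then have "defect y p s t \<le> C * (t - s) powr (2 * \<beta>)" by (rule assms)
  also have "\<dots> \<le> \<bar>C\<bar> * (t - s) powr (2 * \<beta>)" by (intro mult_right_mono) auto
  finally show "defect y p s t \<le> \<bar>C\<bar> * (t - s) powr (2 * \<beta>)" .
qed simp

lemma germE:
  assumes "germ y p"
  obtains C where "0 \<le> C" "\<And>s t. 0 \<le> s \<Longrightarrow> s \<le> t \<Longrightarrow> t \<le> \<tau> \<Longrightarrow>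
     defect y p s t \<le> C * (t - s) powr (2 * \<beta>)"
  using assms unfolding germ_def by blast

lemma germ_add:
  assumes "germ y p" "germ z q"
  shows "germ (\<lambda>t. y t + z t) (\<lambda>i t. p i t + q i t)"
proof -
  obtain C where "0 \<le> C" and C: "\<And>s t. 0 \<le> s \<Longrightarrow> s \<le> t \<Longrightarrow> t \<le> \<tau> \<Longrightarrow>
     defect y p s t \<le> C * (t - s) powr (2 * \<beta>)" by (rule germE[OF assms(1)]) (rule that)
  obtain D where "0 \<le> D" and D: "\<And>s t. 0 \<le> s \<Longrightarrow> s \<le> t \<Longrightarrow> t \<le> \<tau> \<Longrightarrow>
     defect z q s t \<le> D * (t - s) powr (2 * \<beta>)" by (rule germE[OF assms(2)]) (rule that)
  show ?thesis
  proof (rule germI[of _ _ "C + D"])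
    fix s t assume st: "0 \<le> s" "s \<le> t" "t \<le> \<tau>"
    have "(y t + z t) - (y s + z s) - (\<Sum>i\<le>d. (p i s + q i s) * (b i t - b i s)) =
       (y t - y s - (\<Sum>i\<le>d. p i s * (b i t - b i s))) + (z t - z s - (\<Sum>i\<le>d. q i s * (b i t - b i s)))"
      by (simp add: distrib_right sum.distrib)
    then show "\<bar>(y t + z t) - (y s + z s) - (\<Sum>i\<le>d. (p i s + q i s) * (b i t - b i s))\<bar> \<le> (C + D) * (t - s) powr (2 * \<beta>)"
      unfolding distrib_right[of C D] by (simp only: order_trans[OF abs_triangle_ineq add_mono[OF C[OF st] D[OF st]]])
  qed
qed

lemma germ_scale:
  assumes "germ y p"
  shows "germ (\<lambda>t. c * y t) (\<lambda>i t. c * p i t)"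
proof -
  obtain C where "0 \<le> C" and C: "\<And>s t. 0 \<le> s \<Longrightarrow> s \<le> t \<Longrightarrow> t \<le> \<tau> \<Longrightarrow>
     defect y p s t \<le> C * (t - s) powr (2 * \<beta>)" by (rule germE[OF assms(1)]) (rule that)
  show ?thesis
  proof (rule germI[of _ _ "\<bar>c\<bar> * C"])
    fix s t assume st: "0 \<le> s" "s \<le> t" "t \<le> \<tau>"
    have "c * y t - c * y s - (\<Sum>i\<le>d. c * p i s * (b i t - b i s)) =
       c * (y t - y s - (\<Sum>i\<le>d. p i s * (b i t - b i s)))"
      by (simp add: right_diff_distrib sum_distrib_left mult.assoc)
    then show "\<bar>c * y t - c * y s - (\<Sum>i\<le>d. c * p i s * (b i t - b i s))\<bar> \<le> \<bar>c\<bar> * C * (t - s) powr (2 * \<beta>)"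
      using C[OF st] by (simp add: abs_mult mult_left_mono mult.assoc)
  qed
qed

lemma germ_const: "germ (\<lambda>t. c) (\<lambda>i t. 0)"
  by (rule germI[of _ _ 0]) simp

lemma germ_sum:
  assumes "\<And>k. k \<in> A \<Longrightarrow> germ (y k) (p k)"
  shows "germ (\<lambda>t. \<Sum>k\<in>A. y k t) (\<lambda>i t. \<Sum>k\<in>A. p k i t)"
  using assms
proof (induction A rule: infinite_finite_induct)
  case (insert x F)
  then show ?case using germ_add[of "y x" "p x" "\<lambda>t. \<Sum>k\<in>F. y k t" "\<lambda>i t. \<Sum>k\<in>F. p k i t"] by simp
qed (simp_all add: germ_const)

lemma germ_cong:
  assumes "germ y p" "\<And>t. 0 \<le> t \<Longrightarrow> t \<le> \<tau> \<Longrightarrow> y t = z t"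
    "\<And>i t. i \<le> d \<Longrightarrow> 0 \<le> t \<Longrightarrow> t \<le> \<tau> \<Longrightarrow> p i t = q i t"
  shows "germ z q"
proof -
  obtain C where "0 \<le> C" and C: "\<And>s t. 0 \<le> s \<Longrightarrow> s \<le> t \<Longrightarrow> t \<le> \<tau> \<Longrightarrow>
     defect y p s t \<le> C * (t - s) powr (2 * \<beta>)" by (rule germE[OF assms(1)]) (rule that)
  show ?thesis
  proof (rule germI[of _ _ C])
    fix s t assume st: "0 \<le> s" "s \<le> t" "t \<le> \<tau>"
    have "(\<Sum>i\<le>d. q i s * (b i t - b i s)) = (\<Sum>i\<le>d. p i s * (b i t - b i s))"
      using st assms(3) by (intro sum.cong) auto
    then show "defect z q s t \<le> C * (t - s) powr (2 * \<beta>)"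
      using C[OF st] assms(2)[of s] assms(2)[of t] st by simp
  qed
qed

text \<open>Apart from the two given errors only \<open>(y t - y s) * (z t - z s)\<close> is left
  over, and for \<beta>-Hoelder functions this is of order \<open>2 * \<beta>\<close> as well: there
  is no Ito correction.\<close>

lemma germ_mult:
  assumes y: "germ y p" and z: "germ z q" and hy: "hn K y" and hz: "hn L z"
  shows "germ (\<lambda>t. y t * z t) (\<lambda>i t. y t * q i t + z t * p i t)"
proof -
  obtain C where "0 \<le> C" and C: "\<And>s t. 0 \<le> s \<Longrightarrow> s \<le> t \<Longrightarrow> t \<le> \<tau> \<Longrightarrow>
     defect y p s t \<le> C * (t - s) powr (2 * \<beta>)" by (rule germE[OF y]) (rule that)
  obtain D where "0 \<le> D" and D: "\<And>s t. 0 \<le> s \<Longrightarrow> s \<le> t \<Longrightarrow> t \<le> \<tau> \<Longrightarrow>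
     defect z q s t \<le> D * (t - s) powr (2 * \<beta>)" by (rule germE[OF z]) (rule that)
  have KL: "0 \<le> K" "0 \<le> L" using hnorm_le_nonneg[OF hy tau(1)] hnorm_le_nonneg[OF hz tau(1)] .
  show ?thesis
  proof (rule germI[of _ _ "K * D + L * C + K * L"])
    fix s t assume st: "0 \<le> s" "s \<le> t" "t \<le> \<tau>"
    let ?w = "(t - s) powr (2 * \<beta>)"
    have ys: "\<bar>y s\<bar> \<le> K" and zs: "\<bar>z s\<bar> \<le> L"
      using hnorm_le_abs[OF hy, of s] hnorm_le_abs[OF hz, of s] st by auto
    have dy: "\<bar>y t - y s\<bar> \<le> K * (t - s) powr \<beta>" and dz: "\<bar>z t - z s\<bar> \<le> L * (t - s) powr \<beta>"
      using holder_boundD[OF hnorm_le_holder[OF hy], of s t] holder_boundD[OF hnorm_le_holder[OF hz], of s t] st by auto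
    define P Q where "P = (\<Sum>i\<le>d. p i s * (b i t - b i s))" and "Q = (\<Sum>i\<le>d. q i s * (b i t - b i s))"
    have "(\<Sum>i\<le>d. (y s * q i s + z s * p i s) * (b i t - b i s)) = y s * Q + z s * P"
      by (simp only: P_def Q_def sum_distrib_left sum.distrib[symmetric] distrib_right mult.assoc)
    then have "y t * z t - y s * z s - (\<Sum>i\<le>d. (y s * q i s + z s * p i s) * (b i t - b i s)) =
       (y s * (z t - z s - Q) + z s * (y t - y s - P)) + (y t - y s) * (z t - z s)"
      by (simp add: algebra_simps)
    moreover have "\<bar>y s * (z t - z s - Q)\<bar> \<le> K * (D * ?w)"
      unfolding abs_mult by (rule mult_mono[OF ys D[OF st, folded Q_def] KL(1) abs_ge_zero])
    moreover have "\<bar>z s * (y t - y s - P)\<bar> \<le> L * (C * ?w)"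
      unfolding abs_mult by (rule mult_mono[OF zs C[OF st, folded P_def] KL(2) abs_ge_zero])
    moreover have "\<bar>(y t - y s) * (z t - z s)\<bar> \<le> (K * (t - s) powr \<beta>) * (L * (t - s) powr \<beta>)"
      unfolding abs_mult by (rule mult_mono[OF dy dz]) (use KL in simp_all)
    moreover have "(K * (t - s) powr \<beta>) * (L * (t - s) powr \<beta>) = K * L * ?w"
      unfolding mult_2 powr_add by (simp only: mult_ac)
    ultimately show "\<bar>y t * z t - y s * z s - (\<Sum>i\<le>d. (y s * q i s + z s * p i s) * (b i t - b i s))\<bar> \<le> (K * D + L * C + K * L) * ?w"
      unfolding distrib_right mult.assoc by linarith
  qed
qed

text \<open>The difference has increments of order \<open>2 * \<beta> > 1\<close>, so it is
  constant. This is read off from \<open>has_young_integral_germ\<close> with zero integrand and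
  zero integrator, where the integral is also 0.\<close>

lemma germ_unique:
  assumes "germ y p" "germ z p" "y 0 = z 0" "0 \<le> t" "t \<le> \<tau>"
  shows "y t = z t"
proof -
  have "germ (\<lambda>t. y t + (-1) * z t) (\<lambda>i t. p i t + (-1) * p i t)"
    by (intro germ_add germ_scale assms)
  then obtain C where C: "0 \<le> C" "\<And>s t. 0 \<le> s \<Longrightarrow> s \<le> t \<Longrightarrow> t \<le> \<tau> \<Longrightarrow>
     \<bar>(y t - z t) - (y s - z s)\<bar> \<le> C * (t - s) powr (2 * \<beta>)" by (elim germE) auto
  have h0: "holder_bound \<beta> t 0 (\<lambda>t. 0)" by (simp add: holder_bound_def)
  have "has_young_integral (\<lambda>t. 0) (\<lambda>t. 0) 0 t ((y t - z t) - (y 0 - z 0))"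
    by (rule has_young_integral_germ[OF _ _ _ _ _ C(1) h0 h0]) (use beta assms C(2) in auto)
  moreover have "has_young_integral (\<lambda>t. 0::real) (\<lambda>t. 0) 0 t 0"
    by (auto simp: has_young_integral_def case_prod_unfold intro: exI[of _ 1])
  ultimately show ?thesis using has_young_integral_unique assms(3) by fastforce
qed

definition integ :: "nat \<Rightarrow> (real \<Rightarrow> real) \<Rightarrow> real \<Rightarrow> real" where
  "integ i f t = young_integral f (b i) 0 t"

text \<open>\<open>young_loeve\<close> supplies one function with the right increments on all of
  [0, \<tau>]. Its values are limits of Riemann sums, and uniqueness of these limits evaluates the
  definite description for all upper bounds at once.\<close>

lemma
  assumes "i \<le> d" "hn K f" "0 \<le> t" "t \<le> \<tau>"
  shows integ_germ_bound: "0 \<le> s \<Longrightarrow> s \<le> t \<Longrightarrow>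
      \<bar>integ i f t - integ i f s - f s * (b i t - b i s)\<bar> \<le> young_const (2 * \<beta>) * K * \<kappa> * (t - s) powr (2 * \<beta>)"
    and integ_0: "integ i f 0 = 0"
proof -
  have K: "0 \<le> K" using hnorm_le_nonneg[OF assms(2)] tau by simp
  have f: "holder_bound \<beta> \<tau> K f" by (rule hnorm_le_holder[OF assms(2)])
  obtain y where y: "\<And>s t. 0 \<le> s \<Longrightarrow> s \<le> t \<Longrightarrow> t \<le> \<tau> \<Longrightarrow>
      \<bar>y t - y s - f s * (b i t - b i s)\<bar> \<le> young_const (\<beta> + \<beta>) * K * \<kappa> * (t - s) powr (\<beta> + \<beta>)" "y 0 = 0"
    by (rule young_loeve[OF _ _ _ K kappa tau(2) f driver[OF assms(1)]]) (use beta in auto)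
  have hy: "has_young_integral f (b i) 0 t (y t)" if "0 \<le> t" "t \<le> \<tau>" for t
  proof -
    have "0 \<le> young_const (\<beta> + \<beta>) * K * \<kappa>" using young_const_nonneg[of "\<beta> + \<beta>"] beta K kappa by simp
    from has_young_integral_germ[OF _ _ that(1) K kappa this holder_bound_mono_interval[OF f that(2)]
        holder_bound_mono_interval[OF driver[OF assms(1)] that(2)], of y]
    show ?thesis using y beta that by simp
  qed
  have eq: "integ i f t = y t" if "0 \<le> t" "t \<le> \<tau>" for t
    unfolding integ_def by (rule young_integral_eq[OF hy[OF that]])
  show "integ i f 0 = 0" using eq[of 0] y(2) tau by simp
  show "\<bar>integ i f t - integ i f s - f s * (b i t - b i s)\<bar> \<le> young_const (2 * \<beta>) * K * \<kappa> * (t - s) powr (2 * \<beta>)"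
    if st: "0 \<le> s" "s \<le> t"
  proof -
    have "integ i f s = y s" "integ i f t = y t" using st assms(3,4) by (intro eq; linarith)+
    then show ?thesis using y(1)[OF st assms(4)] by (simp only: mult_2)
  qed
qed

text \<open>A bound for the norm of integration against one driver:
  \<open>\<kappa> * (1 + young_const (2 * \<beta>))\<close> controls the Hoelder seminorm and, as
  the integral starts at 0 and \<open>\<tau> \<le> 1\<close>, also the supremum; hence the
  2.\<close>

definition eta :: real where "eta = 2 * \<kappa> * (1 + young_const (2 * \<beta>))"

lemma eta_nonneg: "0 \<le> eta"
  using kappa young_const_nonneg[of "2 * \<beta>"] beta by (simp add: eta_def)

lemma hn_integ:
  assumes "i \<le> d" "hn K f"
  shows "hn (eta * K) (integ i f)"
proof -
  have K: "0 \<le> K" using hnorm_le_nonneg[OF assms(2)] tau by simp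
  let ?c = "\<kappa> * (1 + young_const (2 * \<beta>)) * K"
  have yc: "0 \<le> young_const (2 * \<beta>)" using young_const_nonneg[of "2 * \<beta>"] beta by simp
  have c: "0 \<le> ?c" using K kappa yc by simp
  have inc: "\<bar>integ i f t - integ i f s\<bar> \<le> ?c * (t - s) powr \<beta>" if "0 \<le> s" "s \<le> t" "t \<le> \<tau>" for s t
  proof -
    have 1: "\<bar>integ i f t - integ i f s - f s * (b i t - b i s)\<bar> \<le> young_const (2 * \<beta>) * K * \<kappa> * (t - s) powr (2 * \<beta>)"
      by (rule integ_germ_bound[OF assms]) (use that in auto)
    have "(t - s) powr (2 * \<beta>) \<le> (t - s) powr \<beta>"
      using that beta tau by (cases "s = t") (auto intro!: powr_mono')
    then have 2: "young_const (2 * \<beta>) * K * \<kappa> * (t - s) powr (2 * \<beta>) \<le> young_const (2 * \<beta>) * K * \<kappa> * (t - s) powr \<beta>"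
      using K kappa yc by (intro mult_left_mono) auto
    have "\<bar>b i t - b i s\<bar> \<le> \<kappa> * (t - s) powr \<beta>" using holder_boundD[OF driver[OF assms(1)], of s t] that by auto
    then have 3: "\<bar>f s * (b i t - b i s)\<bar> \<le> K * (\<kappa> * (t - s) powr \<beta>)"
      unfolding abs_mult using hnorm_le_abs[OF assms(2), of s] that K by (intro mult_mono) auto
    have "?c * (t - s) powr \<beta> = young_const (2 * \<beta>) * K * \<kappa> * (t - s) powr \<beta> + K * (\<kappa> * (t - s) powr \<beta>)"
      by (simp add: algebra_simps)
    then show ?thesis using 1 2 3 by linarith
  qed
  show ?thesis
  proof (rule hnorm_leI[of \<tau> _ ?c ?c])
    fix u assume u: "0 \<le> u" "u \<le> \<tau>"
    have "\<bar>integ i f u\<bar> \<le> ?c * u powr \<beta>" using inc[of 0 u] u integ_0[OF assms, of u] by simp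
    also have "\<dots> \<le> ?c * 1" using u tau beta by (intro mult_left_mono c powr_le1) auto
    finally show "\<bar>integ i f u\<bar> \<le> ?c" by simp
  qed (use inc c in \<open>auto simp: eta_def algebra_simps\<close>)
qed

definition integs :: "(nat \<Rightarrow> real \<Rightarrow> real) \<Rightarrow> real \<Rightarrow> real" where
  "integs p t = (\<Sum>i\<le>d. integ i (p i) t)"

lemma integs_germ_bound:
  assumes "\<And>i. i \<le> d \<Longrightarrow> hn K (p i)" "0 \<le> s" "s \<le> t" "t \<le> \<tau>"
  shows "defect (integs p) p s t
     \<le> (d + 1) * (young_const (2 * \<beta>) * K * \<kappa>) * (t - s) powr (2 * \<beta>)"
proof -
  have "defect (integs p) p s t =
    \<bar>\<Sum>i\<le>d. integ i (p i) t - integ i (p i) s - p i s * (b i t - b i s)\<bar>"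
    by (simp add: integs_def sum_subtractf)
  also have "\<dots> \<le> (\<Sum>i\<le>d. \<bar>integ i (p i) t - integ i (p i) s - p i s * (b i t - b i s)\<bar>)" by (rule sum_abs)
  also have "\<dots> \<le> (\<Sum>i\<le>d. young_const (2 * \<beta>) * K * \<kappa> * (t - s) powr (2 * \<beta>))"
    using assms by (intro sum_mono integ_germ_bound) auto
  finally show ?thesis by (simp add: algebra_simps)
qed

lemma germ_integs:
  assumes "\<And>i. i \<le> d \<Longrightarrow> hn (K i) (p i)"
  shows "germ (integs p) p"
proof -
  have "hn (Max (K ` {..d})) (p i)" if "i \<le> d" for i
    by (rule hnorm_le_mono[OF assms[OF that]]) (use that in auto)
  then show ?thesis by (rule germI[OF integs_germ_bound])
qed

lemma integs_0:
  assumes "\<And>i. i \<le> d \<Longrightarrow> hn (K i) (p i)"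
  shows "integs p 0 = 0"
  unfolding integs_def using tau by (intro sum.neutral ballI integ_0[OF _ assms]) auto

lemma hn_integs:
  assumes "\<And>i. i \<le> d \<Longrightarrow> hn K (p i)"
  shows "hn ((d + 1) * eta * K) (integs p)"
proof -
  have "hn (\<Sum>i\<le>d. eta * K) (integs p)"
    unfolding integs_def[abs_def] by (rule hnorm_le_sum) (use assms in \<open>simp add: hn_integ\<close>)
  then show ?thesis by (simp add: mult.assoc)
qed

lemma germ_eq_integs:
  assumes "germ y p" "y 0 = 0" "\<And>i. i \<le> d \<Longrightarrow> hn (K i) (p i)" "0 \<le> t" "t \<le> \<tau>"
  shows "y t = integs p t"
proof (rule germ_unique[OF assms(1) germ_integs[OF assms(3)] _ assms(4,5)])
  show "y 0 = integs p 0" unfolding assms(2) by (rule integs_0[OF assms(3), symmetric])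
qed

end

section \<open>Smooth functions and order of vanishing\<close>

lemma Ck_imp_continuous: "Ck k f \<Longrightarrow> continuous_on UNIV f"
  by (cases k) (auto intro: differentiable_imp_continuous_on)

lemma Ck_Suc_imp_Ck: "Ck (Suc k) f \<Longrightarrow> Ck k f"
proof (induction k arbitrary: f)
  case 0
  then show ?case using Ck_imp_continuous[of "Suc 0" f] by simp
next
  case (Suc k)
  then have "f differentiable_on UNIV" "\<And>v. Ck (Suc k) (\<lambda>x. frechet_derivative f (at x) v)"
    by simp_all
  then show ?case using Suc.IH by auto
qed

lemma Ck_add: "Ck k f \<Longrightarrow> Ck k g \<Longrightarrow> Ck k (\<lambda>x. f x + g x)"
proof (induction k arbitrary: f g)
  case 0
  then show ?case by (auto intro: continuous_intros)
next
  case (Suc k)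
  then have d: "f differentiable at x" "g differentiable at x" for x
    by (auto simp: differentiable_on_def)
  have "frechet_derivative (\<lambda>x. f x + g x) (at x) = (\<lambda>v. frechet_derivative f (at x) v + frechet_derivative g (at x) v)" for x
    using d[of x, unfolded frechet_derivative_works] by (intro frechet_derivative_at[symmetric] has_derivative_add)
  then show ?case using Suc by (auto simp: differentiable_on_def)
qed

lemma Ck_mult:
  fixes f g :: "'a::euclidean_space \<Rightarrow> real"
  shows "Ck k f \<Longrightarrow> Ck k g \<Longrightarrow> Ck k (\<lambda>x. f x * g x)"
proof (induction k arbitrary: f g)
  case 0
  then show ?case by (auto intro: continuous_intros)
next
  case (Suc k)
  have d: "f differentiable at x" "g differentiable at x" for x
    using Suc.prems by (auto simp: differentiable_on_def)
  have eq: "frechet_derivative (\<lambda>x. f x * g x) (at x) =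
      (\<lambda>v. f x * frechet_derivative g (at x) v + frechet_derivative f (at x) v * g x)" for x
    using d[of x, unfolded frechet_derivative_works]
    by (intro frechet_derivative_at[symmetric] has_derivative_mult)
  have "Ck k f" "Ck k g" using Suc.prems Ck_Suc_imp_Ck by blast+
  then have "Ck k (\<lambda>x. f x * frechet_derivative g (at x) v + frechet_derivative f (at x) v * g x)" for v
    using Suc.prems by (intro Ck_add Suc.IH) auto
  then show ?case using d by (auto simp: eq differentiable_on_def)
qed

lemma Ck_bounded_linear:
  assumes h: "bounded_linear h"
  shows "Ck k f \<Longrightarrow> Ck k (\<lambda>x. h (f x))"
proof (induction k arbitrary: f)
  case 0
  then show ?case by (simp add: bounded_linear.continuous_on[OF h])
next
  case (Suc k)
  have d: "f differentiable at x" for x using Suc.prems by (auto simp: differentiable_on_def)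
  have hd: "((\<lambda>x. h (f x)) has_derivative (\<lambda>v. h (frechet_derivative f (at x) v))) (at x)" for x
    using d[of x, unfolded frechet_derivative_works] by (rule bounded_linear.has_derivative[OF h])
  then have "frechet_derivative (\<lambda>x. h (f x)) (at x) = (\<lambda>v. h (frechet_derivative f (at x) v))" for x
    by (rule frechet_derivative_at[symmetric])
  moreover have "(\<lambda>x. h (f x)) differentiable at x" for x using hd unfolding differentiable_def by blast
  ultimately show ?case using Suc by (auto simp: differentiable_on_def)
qed

lemma Ck_const: "Ck k (\<lambda>x. c)"
  by (induction k arbitrary: c) auto

lemma Ck_ident: "Ck k (\<lambda>x. x)"
proof (cases k)
  case (Suc m)
  have "frechet_derivative (\<lambda>x::'a. x) (at x) = (\<lambda>v. v)" for x :: 'a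
    by (rule frechet_derivative_at[symmetric]) (rule has_derivative_ident)
  then show ?thesis using Suc by (simp add: Ck_const)
qed simp

lemma smooth_const [simp]: "smooth (\<lambda>x. c)"
  by (simp add: smooth_def Ck_const)

lemma smooth_add: "smooth f \<Longrightarrow> smooth g \<Longrightarrow> smooth (\<lambda>x. f x + g x)"
  by (simp add: smooth_def Ck_add)

lemma smooth_mult: "smooth f \<Longrightarrow> smooth g \<Longrightarrow> smooth (\<lambda>x. f x * g x)" for f g :: "'a::euclidean_space \<Rightarrow> real"
  by (simp add: smooth_def Ck_mult)

lemma smooth_sum: "(\<And>k. k \<in> A \<Longrightarrow> smooth (f k)) \<Longrightarrow> smooth (\<lambda>x. \<Sum>k\<in>A. f k x)"
  by (induction A rule: infinite_finite_induct) (auto intro: smooth_add)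

lemma smooth_prod: "(\<And>k. k \<in> A \<Longrightarrow> smooth (f k)) \<Longrightarrow> smooth (\<lambda>x. \<Prod>k\<in>A. f k x :: real)"
  by (induction A rule: infinite_finite_induct) (auto intro: smooth_mult)

lemma smooth_power: "smooth f \<Longrightarrow> smooth (\<lambda>x. f x ^ n :: real)"
  by (induction n) (auto intro: smooth_mult)

lemma smooth_vec_nth: "smooth f \<Longrightarrow> smooth (\<lambda>x. f x $ j)" for f :: "'a::euclidean_space \<Rightarrow> real ^ 'n"
  by (simp add: smooth_def Ck_bounded_linear[OF bounded_linear_vec_nth])

lemma smooth_coordinate: "smooth (\<lambda>x::real^'n. x $ j - c)"
proof -
  have "smooth (\<lambda>x::real^'n. x)" by (simp add: smooth_def Ck_ident)
  from smooth_add[OF smooth_vec_nth[OF this] smooth_const[of "- c"]] show ?thesis by simp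
qed

lemma smooth_frechet_derivative: "smooth f \<Longrightarrow> smooth (\<lambda>x. frechet_derivative f (at x) v)"
  unfolding smooth_def by (metis Ck.simps(2))

lemma smooth_has_derivative: "smooth f \<Longrightarrow> (f has_derivative frechet_derivative f (at x)) (at x)"
  unfolding smooth_def frechet_derivative_works[symmetric] 
  by (metis Ck.simps(2) differentiable_on_def UNIV_I)

lemma smooth_continuous: "smooth f \<Longrightarrow> continuous_on UNIV f"
  unfolding smooth_def by (metis Ck.simps(1))

section \<open>Vector fields as derivations, and how they lower the order of vanishing\<close>

lemma vf_apply_expand:
  fixes f :: "real ^ 'n \<Rightarrow> real"
  assumes "smooth f"
  shows "vf_apply v f x = (\<Sum>l\<in>UNIV. v x $ l * frechet_derivative f (at x) (axis l 1))"
proof -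
  have lin: "linear (frechet_derivative f (at x))"
    using has_derivative_linear[OF smooth_has_derivative[OF assms]] .
  have "vf_apply v f x = frechet_derivative f (at x) (\<Sum>l\<in>UNIV. v x $ l *\<^sub>R axis l 1)"
    using basis_expansion[of "v x"] by (simp add: vf_apply_def scalar_mult_eq_scaleR)
  also have "\<dots> = (\<Sum>l\<in>UNIV. v x $ l * frechet_derivative f (at x) (axis l 1))"
    by (simp add: linear_sum[OF lin] linear_cmul[OF lin])
  finally show ?thesis .
qed

lemma smooth_vf_apply:
  fixes f :: "real ^ 'n \<Rightarrow> real"
  assumes "smooth v" "smooth f"
  shows "smooth (vf_apply v f)"
proof -
  have "vf_apply v f = (\<lambda>x. \<Sum>l\<in>UNIV. v x $ l * frechet_derivative f (at x) (axis l 1))"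
    using vf_apply_expand[OF assms(2)] by blast
  then show ?thesis using assms by (simp add: smooth_sum smooth_mult smooth_vec_nth smooth_frechet_derivative)
qed

lemma vf_apply_add:
  assumes "smooth f" "smooth g"
  shows "vf_apply v (\<lambda>x. f x + g x) = (\<lambda>x. vf_apply v f x + vf_apply v g x)"
proof
  fix x
  have "frechet_derivative (\<lambda>x. f x + g x) (at x) = (\<lambda>v. frechet_derivative f (at x) v + frechet_derivative g (at x) v)"
    using assms by (intro frechet_derivative_at[symmetric] has_derivative_add smooth_has_derivative)
  then show "vf_apply v (\<lambda>x. f x + g x) x = vf_apply v f x + vf_apply v g x" by (simp add: vf_apply_def)
qed

lemma vf_apply_mult:
  assumes "smooth f" "smooth g"
  shows "vf_apply v (\<lambda>x. f x * g x) = (\<lambda>x. f x * vf_apply v g x + vf_apply v f x * g x)"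
proof
  fix x
  have "frechet_derivative (\<lambda>x. f x * g x) (at x) = (\<lambda>v. f x * frechet_derivative g (at x) v + frechet_derivative f (at x) v * g x)"
    using assms by (intro frechet_derivative_at[symmetric] has_derivative_mult smooth_has_derivative)
  then show "vf_apply v (\<lambda>x. f x * g x) x = f x * vf_apply v g x + vf_apply v f x * g x" by (simp add: vf_apply_def)
qed

lemma vf_apply_const: "vf_apply v (\<lambda>x. c) = (\<lambda>x. 0)"
  by (simp add: vf_apply_def)

lemma vf_apply_coordinate:
  fixes v :: "real ^ 'n \<Rightarrow> real ^ 'n"
  shows "vf_apply v (\<lambda>x. x $ j - c) = (\<lambda>x. v x $ j)"
proof
  fix x :: "real ^ 'n"
  have "frechet_derivative (\<lambda>x::real^'n. x $ j - c) (at x) = (\<lambda>v. v $ j - 0)"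
    by (intro frechet_derivative_at[symmetric] has_derivative_diff has_derivative_const
        bounded_linear.has_derivative[OF bounded_linear_vec_nth] has_derivative_ident)
  then show "vf_apply v (\<lambda>x. x $ j - c) x = v x $ j" by (simp add: vf_apply_def)
qed

text \<open>In the induction step the two outer thirds of the interval contain points where the k-th
  derivative is small; they are at least a third of the length apart, so the mean value theorem
  yields a small next derivative between them. It matters that c depends on k alone.\<close>

lemma ex_small_higher_derivative:
  "\<exists>c\<ge>0. \<forall>\<phi> A a b. (\<forall>j<k. \<forall>s. (\<phi> j has_real_derivative \<phi> (Suc j) s) (at s)) \<longrightarrow> a < b \<longrightarrow>
     (\<forall>s\<in>{a..b}. \<bar>\<phi> 0 s\<bar> \<le> A) \<longrightarrow> (\<exists>\<xi>\<in>{a..b}. \<bar>\<phi> k \<xi>\<bar> \<le> c * A / (b - a) ^ k)"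
proof (induction k)
  case 0
  show ?case by (intro exI[of _ 1]) fastforce
next
  case (Suc k)
  from Suc.IH obtain c where c: "0 \<le> c" and IH0: "\<forall>\<phi> A a b. (\<forall>j<k. \<forall>s. (\<phi> j has_real_derivative \<phi> (Suc j) s) (at s)) \<longrightarrow> a < b \<longrightarrow>
     (\<forall>s\<in>{a..b}. \<bar>\<phi> 0 s\<bar> \<le> A) \<longrightarrow> (\<exists>\<xi>\<in>{a..b}. \<bar>\<phi> k \<xi>\<bar> \<le> c * A / (b - a) ^ k)"
    by (elim exE conjE) (rule that)
  note IH = IH0[THEN spec, THEN spec, THEN spec, THEN spec, THEN mp, THEN mp, THEN mp]
  show ?case
  \<comment> \<open>The 2 stems from a difference of two values, \<open>3 ^ k\<close> from applying
    the induction hypothesis on thirds, and one more 3 from the mean value theorem.\<close>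
  proof (intro exI[of _ "2 * c * 3 ^ Suc k"] conjI allI impI)
    show "0 \<le> 2 * c * 3 ^ Suc k" using c by simp
    fix \<phi> :: "nat \<Rightarrow> real \<Rightarrow> real" and A a b :: real
    assume D: "\<forall>j<Suc k. \<forall>s. (\<phi> j has_real_derivative \<phi> (Suc j) s) (at s)" and ab: "a < b"
      and A: "\<forall>s\<in>{a..b}. \<bar>\<phi> 0 s\<bar> \<le> A"
    define h where "h = (b - a) / 3"
    have h: "h > 0" using ab by (simp add: h_def)
    have D': "\<forall>j<k. \<forall>s. (\<phi> j has_real_derivative \<phi> (Suc j) s) (at s)" using D by simp
    have bh: "b = a + 3 * h" by (simp add: h_def field_simps)
    obtain \<xi>1 where 1: "\<xi>1 \<in> {a..a+h}" "\<bar>\<phi> k \<xi>1\<bar> \<le> c * A / h ^ k"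
    proof -
      have "\<exists>\<xi>\<in>{a..a+h}. \<bar>\<phi> k \<xi>\<bar> \<le> c * A / (a + h - a) ^ k" by (rule IH[OF D']) (use h A bh in auto)
      then show ?thesis using that by auto
    qed
    obtain \<xi>2 where 2: "\<xi>2 \<in> {b-h..b}" "\<bar>\<phi> k \<xi>2\<bar> \<le> c * A / h ^ k"
    proof -
      have "\<exists>\<xi>\<in>{b-h..b}. \<bar>\<phi> k \<xi>\<bar> \<le> c * A / (b - (b - h)) ^ k" by (rule IH[OF D']) (use h A bh in auto)
      then show ?thesis using that by auto
    qed
    have lt: "\<xi>1 < \<xi>2" and ge: "h \<le> \<xi>2 - \<xi>1" using 1 2 h bh by auto
    obtain z where z: "\<xi>1 < z" "z < \<xi>2" "\<phi> k \<xi>2 - \<phi> k \<xi>1 = (\<xi>2 - \<xi>1) * \<phi> (Suc k) z"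
      using MVT2[OF lt, of "\<phi> k" "\<phi> (Suc k)"] D by auto
    have "h * \<bar>\<phi> (Suc k) z\<bar> \<le> \<bar>(\<xi>2 - \<xi>1) * \<phi> (Suc k) z\<bar>"
      unfolding abs_mult using ge h by (intro mult_right_mono) auto
    also have "\<dots> \<le> 2 * (c * A / h ^ k)" using 1(2) 2(2) unfolding z(3)[symmetric] by linarith
    finally have "\<bar>\<phi> (Suc k) z\<bar> \<le> 2 * (c * A / h ^ k) / h" using h by (simp add: field_simps)
    also have "\<dots> = 2 * c * 3 ^ Suc k * A / (b - a) ^ Suc k"
      using ab by (simp add: h_def power_divide mult_ac)
    finally show "\<exists>\<xi>\<in>{a..b}. \<bar>\<phi> (Suc k) \<xi>\<bar> \<le> 2 * c * 3 ^ Suc k * A / (b - a) ^ Suc k"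
      using z 1 2 h bh by (intro bexI[of _ z]) auto
  qed
qed

text \<open>An inequality of Landau-Kolmogorov type, proved downwards from order m: the derivative
  of order \<open>m - Suc i\<close> is small at some point by the previous lemma, and the bound on
  the next order carries this over to [0, 1]. The constant is independent of \<phi>, which will be
  rescaled anew at every point.\<close>

lemma intermediate_derivative_bound:
  assumes "i \<le> m"
  shows "\<exists>e\<ge>0. \<forall>\<phi> A. (\<forall>j<m. \<forall>s. (\<phi> j has_real_derivative \<phi> (Suc j) s) (at s)) \<longrightarrow>
     (\<forall>s\<in>{0..1}. \<bar>\<phi> 0 s\<bar> \<le> A \<and> \<bar>\<phi> m s\<bar> \<le> A) \<longrightarrow> (\<forall>s\<in>{0..1}. \<bar>\<phi> (m - i) s\<bar> \<le> e * A)"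
  using assms
proof (induction i)
  case 0
  show ?case by (intro exI[of _ 1]) simp
next
  case (Suc i)
  from Suc.IH[OF Suc_leD[OF Suc.prems]]
  obtain e where e: "e \<ge> 0" and IH0: "\<forall>\<phi> A. (\<forall>j<m. \<forall>s. (\<phi> j has_real_derivative \<phi> (Suc j) s) (at s)) \<longrightarrow>
     (\<forall>s\<in>{0..1}. \<bar>\<phi> 0 s\<bar> \<le> A \<and> \<bar>\<phi> m s\<bar> \<le> A) \<longrightarrow> (\<forall>s\<in>{0..1}. \<bar>\<phi> (m - i) s\<bar> \<le> e * A)"
    by (elim exE conjE) (rule that)
  note IH = IH0[THEN spec, THEN spec, THEN mp, THEN mp]
  let ?k = "m - Suc i"
  have sk: "Suc ?k = m - i" using Suc.prems by simp
  from ex_small_higher_derivative[of ?k]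
  obtain c where c: "c \<ge> 0" and C0: "\<forall>\<phi> A a b. (\<forall>j<?k. \<forall>s. (\<phi> j has_real_derivative \<phi> (Suc j) s) (at s)) \<longrightarrow> a < b \<longrightarrow>
     (\<forall>s\<in>{a..b}. \<bar>\<phi> 0 s\<bar> \<le> A) \<longrightarrow> (\<exists>\<xi>\<in>{a..b}. \<bar>\<phi> ?k \<xi>\<bar> \<le> c * A / (b - a) ^ ?k)"
    by (elim exE conjE) (rule that)
  note C = C0[THEN spec, THEN spec, THEN spec, THEN spec, THEN mp, THEN mp, THEN mp]
  show ?case
  proof (intro exI[of _ "c + e"] conjI allI impI ballI)
    fix \<phi> :: "nat \<Rightarrow> real \<Rightarrow> real" and A s :: real
    assume D: "\<forall>j<m. \<forall>s. (\<phi> j has_real_derivative \<phi> (Suc j) s) (at s)"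
      and A: "\<forall>s\<in>{0..1}. \<bar>\<phi> 0 s\<bar> \<le> A \<and> \<bar>\<phi> m s\<bar> \<le> A" and s: "s \<in> {0..1}"
    obtain \<xi> where x: "\<xi> \<in> {0..1}" "\<bar>\<phi> ?k \<xi>\<bar> \<le> c * A"
    proof -
      have "\<exists>\<xi>\<in>{0..1}. \<bar>\<phi> ?k \<xi>\<bar> \<le> c * A / (1 - 0) ^ ?k" by (rule C) (use D A in auto)
      then show ?thesis using that by auto
    qed
    have "norm (\<phi> ?k s - \<phi> ?k \<xi>) \<le> e * A * norm (s - \<xi>)"
    proof (rule field_differentiable_bound[of "{0..1}" "\<phi> ?k" "\<phi> (Suc ?k)"])
      show "convex {0..1::real}" by simp
      show "(\<phi> ?k has_field_derivative \<phi> (Suc ?k) z) (at z within {0..1})" if "z \<in> {0..1}" for z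
      proof -
        have "(\<phi> ?k has_field_derivative \<phi> (Suc ?k) z) (at z)" using D Suc.prems by auto
        then show ?thesis by (rule has_field_derivative_at_within)
      qed
      show "norm (\<phi> (Suc ?k) z) \<le> e * A" if "z \<in> {0..1}" for z
        using IH[OF D A] that unfolding sk by simp
    qed (use x s in auto)
    also have "\<dots> \<le> e * A * 1"
    proof (rule mult_left_mono)
      have "0 \<le> A" using A s by force
      then show "0 \<le> e * A" using e by simp
    qed (use x s in auto)
    finally show "\<bar>\<phi> ?k s\<bar> \<le> (c + e) * A" using x(2) by (simp add: distrib_right)
  qed (use c e in simp)
qed

text \<open>The filter \<open>at x0\<close> omits the point x0, so the value there has to be reached
  by continuity.\<close>

lemma bigo_power_imp_zero:
  fixes f :: "'a::{real_normed_vector, perfect_space} \<Rightarrow> real"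
  assumes "isCont f x0" "f \<in> O[at x0](\<lambda>x. norm (x - x0) ^ Suc k)"
  shows "f x0 = 0"
proof -
  obtain c where c: "eventually (\<lambda>x. norm (f x) \<le> c * norm (norm (x - x0) ^ Suc k)) (at x0)"
    using landau_o.bigE[OF assms(2)] by blast
  have "isCont (\<lambda>x. c * norm (norm (x - x0) ^ Suc k)) x0" by (intro continuous_intros)
  then have "((\<lambda>x. c * norm (norm (x - x0) ^ Suc k)) \<longlongrightarrow> 0) (at x0)" by (simp add: isCont_def)
  with c have "(f \<longlongrightarrow> 0) (at x0)" by (rule Lim_null_comparison)
  moreover have "(f \<longlongrightarrow> f x0) (at x0)" using assms(1) by (simp add: isCont_def)
  ultimately show ?thesis by (rule tendsto_unique[OF at_neq_bot, symmetric])
qed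

text \<open>Smallness of a function does not by itself pass to its derivative. Smoothness bounds the
  derivative of order k + 1 near x0, and interpolating between orders 0 and k + 1 along a segment of
  length proportional to \<open>norm (x - x0)\<close> gives the first derivative.\<close>

lemma frechet_derivative_bigo:
  fixes f :: "'a::euclidean_space \<Rightarrow> real"
  assumes f: "smooth f" and O: "f \<in> O[at x0](\<lambda>x. norm (x - x0) ^ Suc k)"
  shows "(\<lambda>x. frechet_derivative f (at x) v) \<in> O[at x0](\<lambda>x. norm (x - x0) ^ k)"
proof -
  have f0: "f x0 = 0"
    using smooth_continuous[OF f] O by (intro bigo_power_imp_zero[where f = f and ?x0.0 = x0 and k = k]) (auto simp: continuous_on_eq_continuous_at)
  obtain C where C: "C > 0" "eventually (\<lambda>x. norm (f x) \<le> C * norm (norm (x - x0) ^ Suc k)) (at x0)"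
    using landau_o.bigE[OF O] by blast
  then obtain r where r: "r > 0" "\<And>x. x \<noteq> x0 \<Longrightarrow> dist x x0 < r \<Longrightarrow> \<bar>f x\<bar> \<le> C * norm (x - x0) ^ Suc k"
    by (auto simp: eventually_at)
  have fb: "\<bar>f x\<bar> \<le> C * norm (x - x0) ^ Suc k" if "dist x x0 < r" for x
    using r(2)[OF _ that] f0 C(1) by (cases "x = x0") auto
  define D where "D j = ((\<lambda>g x. frechet_derivative g (at x) v) ^^ j) f" for j
  have D: "D 0 = f" "D (Suc j) = (\<lambda>x. frechet_derivative (D j) (at x) v)" for j by (simp_all add: D_def)
  have Ds: "smooth (D j)" for j by (induction j) (auto simp: D f intro: smooth_frechet_derivative)
  have "compact (D (Suc k) ` cball x0 r)"
    using smooth_continuous[OF Ds] by (intro compact_continuous_image) (auto intro: continuous_on_subset)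
  then obtain B where B: "B > 0" "\<And>x. dist x0 x \<le> r \<Longrightarrow> \<bar>D (Suc k) x\<bar> \<le> B"
    using bounded_pos[of "D (Suc k) ` cball x0 r"] compact_imp_bounded by auto
  have k1: "Suc k - k = 1" by simp
  from intermediate_derivative_bound[of k "Suc k", OF le_SucI[OF order_refl], unfolded k1]
  obtain e where e: "e \<ge> 0" and E0: "\<forall>\<phi> A. (\<forall>j<Suc k. \<forall>s. (\<phi> j has_real_derivative \<phi> (Suc j) s) (at s)) \<longrightarrow>
     (\<forall>s\<in>{0..1}. \<bar>\<phi> 0 s\<bar> \<le> A \<and> \<bar>\<phi> (Suc k) s\<bar> \<le> A) \<longrightarrow> (\<forall>s\<in>{0..1}. \<bar>\<phi> 1 s\<bar> \<le> e * A)"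
    by (elim exE conjE) (rule that)
  define E where "E = C * (1 + norm v) ^ Suc k + B"
  have "\<bar>frechet_derivative f (at x) v\<bar> \<le> e * E * norm (x - x0) ^ k"
    if x: "x \<noteq> x0" "dist x x0 < r / (1 + norm v)" for x
  proof -
    define \<rho> where "\<rho> = norm (x - x0)"
    have rho: "\<rho> > 0" "\<rho> * (1 + norm v) < r"
      using x by (simp_all add: \<rho>_def dist_norm field_simps add_pos_nonneg)
    \<comment> \<open>The segment from x in direction v, rescaled to [0, 1]; the radius for x keeps
      it within r of x0. Here \<open>\<phi> 0\<close> is of order \<open>\<rho> ^ Suc k\<close> by
      the order of vanishing and \<open>\<phi> (Suc k)\<close> by its prefactor, while
      \<open>\<phi> 1 0\<close> is \<rho> times the derivative sought, so that division by \<rho>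
      leaves \<open>\<rho> ^ k\<close>.\<close>
    define \<phi> where "\<phi> j s = \<rho> ^ j * D j (x + (s * \<rho>) *\<^sub>R v)" for j s
    have der: "(\<phi> j has_real_derivative \<phi> (Suc j) s) (at s)" for j s
    proof -
      have "((\<lambda>s. x + (s * \<rho>) *\<^sub>R v) has_derivative (\<lambda>h. (h * \<rho>) *\<^sub>R v)) (at s)"
        by (auto intro!: derivative_eq_intros)
      from has_derivative_compose[OF this smooth_has_derivative[OF Ds]]
      have "((\<lambda>s. D j (x + (s * \<rho>) *\<^sub>R v)) has_derivative
          (\<lambda>h. frechet_derivative (D j) (at (x + (s * \<rho>) *\<^sub>R v)) ((h * \<rho>) *\<^sub>R v))) (at s)" .
      moreover have "frechet_derivative (D j) (at (x + (s * \<rho>) *\<^sub>R v)) ((h * \<rho>) *\<^sub>R v) = \<rho> * D (Suc j) (x + (s * \<rho>) *\<^sub>R v) * h" for h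
        using linear_cmul[OF has_derivative_linear[OF smooth_has_derivative[OF Ds]]] by (simp add: D)
      ultimately have "((\<lambda>s. D j (x + (s * \<rho>) *\<^sub>R v)) has_real_derivative \<rho> * D (Suc j) (x + (s * \<rho>) *\<^sub>R v)) (at s)"
        by (simp add: has_field_derivative_def)
      from DERIV_cmult[OF this, of "\<rho> ^ j"] show ?thesis by (simp add: \<phi>_def[abs_def] mult_ac)
    qed
    have dx: "norm (x + (s * \<rho>) *\<^sub>R v - x0) \<le> \<rho> * (1 + norm v)" if "s \<in> {0..1}" for s
    proof -
      have "norm (x + (s * \<rho>) *\<^sub>R v - x0) \<le> norm (x - x0) + norm ((s * \<rho>) *\<^sub>R v)"
        by (metis add_diff_eq add.commute diff_add_eq norm_triangle_ineq)
      also have "norm ((s * \<rho>) *\<^sub>R v) \<le> 1 * \<rho> * norm v"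
        using that rho by (simp add: abs_mult mult_right_mono mult_left_le_one_le)
      finally show ?thesis by (simp add: \<rho>_def algebra_simps)
    qed
    have "\<bar>\<phi> 0 s\<bar> \<le> E * \<rho> ^ Suc k \<and> \<bar>\<phi> (Suc k) s\<bar> \<le> E * \<rho> ^ Suc k" if s: "s \<in> {0..1}" for s
    proof
      let ?x = "x + (s * \<rho>) *\<^sub>R v"
      have near: "dist ?x x0 < r" using dx[OF s] rho by (simp add: dist_norm)
      have "\<bar>\<phi> 0 s\<bar> \<le> C * norm (?x - x0) ^ Suc k" using fb[OF near] by (simp add: \<phi>_def D)
      also have "\<dots> \<le> C * (\<rho> * (1 + norm v)) ^ Suc k"
        using C(1) dx[OF s] by (intro mult_left_mono power_mono) auto
      also have "\<dots> = C * (1 + norm v) ^ Suc k * \<rho> ^ Suc k" by (simp only: power_mult_distrib mult_ac)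
      also have "\<dots> \<le> E * \<rho> ^ Suc k" using B(1) rho unfolding E_def by (intro mult_right_mono) auto
      finally show "\<bar>\<phi> 0 s\<bar> \<le> E * \<rho> ^ Suc k" .
      have "\<bar>\<phi> (Suc k) s\<bar> = \<rho> ^ Suc k * \<bar>D (Suc k) ?x\<bar>" using rho by (simp add: \<phi>_def abs_mult)
      also have "\<dots> \<le> \<rho> ^ Suc k * B"
        using B(2)[of ?x] near rho by (intro mult_left_mono) (auto simp: dist_commute)
      also have "\<dots> \<le> E * \<rho> ^ Suc k" using C(1) rho unfolding E_def mult.commute[of _ B]
        by (intro mult_right_mono) auto
      finally show "\<bar>\<phi> (Suc k) s\<bar> \<le> E * \<rho> ^ Suc k" .
    qed
    then have "\<forall>s\<in>{0..1}. \<bar>\<phi> 1 s\<bar> \<le> e * (E * \<rho> ^ Suc k)"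
      using der by (intro E0[THEN spec, THEN spec, THEN mp, THEN mp]) blast+
    from bspec[OF this, of 0] have "\<bar>\<phi> 1 0\<bar> \<le> e * (E * \<rho> ^ Suc k)" by simp
    moreover have "\<phi> 1 0 = \<rho> * frechet_derivative f (at x) v"
      unfolding \<phi>_def One_nat_def D(2) D(1) by simp
    ultimately have "\<rho> * \<bar>frechet_derivative f (at x) v\<bar> \<le> \<rho> * (e * E * \<rho> ^ k)"
      using rho by (simp add: abs_mult mult_ac)
    then show ?thesis using rho by (simp add: \<rho>_def)
  qed
  then have "eventually (\<lambda>x. norm (frechet_derivative f (at x) v) \<le> (e * E) * norm (norm (x - x0) ^ k)) (at x0)"
    unfolding eventually_at using r by (intro exI[of _ "r / (1 + norm v)"]) (auto simp: add_pos_nonneg)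
  then show ?thesis by (rule bigoI)
qed

lemma vf_apply_bigo:
  fixes f :: "real ^ 'n \<Rightarrow> real"
  assumes v: "smooth v" and f: "smooth f" and O: "f \<in> O[at x0](\<lambda>x. norm (x - x0) ^ Suc k)"
  shows "vf_apply v f \<in> O[at x0](\<lambda>x. norm (x - x0) ^ k)"
proof -
  have "(\<lambda>x. v x $ l * frechet_derivative f (at x) (axis l 1)) \<in> O[at x0](\<lambda>x. 1 * norm (x - x0) ^ k)" for l
  proof (rule landau_o.big.mult[OF _ frechet_derivative_bigo[OF f O]])
    have "isCont (\<lambda>x. v x $ l) x0"
      using smooth_continuous[OF smooth_vec_nth[OF v]] by (simp add: continuous_on_eq_continuous_at)
    then show "(\<lambda>x. v x $ l) \<in> O[at x0](\<lambda>_. 1)"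
      by (intro bigoI_tendsto[of _ _ "v x0 $ l"]) (auto simp: isCont_def)
  qed
  then have "(\<lambda>x. \<Sum>l\<in>UNIV. v x $ l * frechet_derivative f (at x) (axis l 1)) \<in> O[at x0](\<lambda>x. norm (x - x0) ^ k)"
    by (intro big_sum_in_bigo) auto
  moreover have "vf_apply v f = (\<lambda>x. \<Sum>l\<in>UNIV. v x $ l * frechet_derivative f (at x) (axis l 1))"
    using vf_apply_expand[OF f] by blast
  ultimately show ?thesis by simp
qed

section \<open>The formal Taylor expansion\<close>

definition monomial_deg :: "('n::finite \<Rightarrow> nat) \<Rightarrow> nat" where
  "monomial_deg \<alpha> = (\<Sum>i\<in>UNIV. \<alpha> i)"

definition monomial :: "('n::finite \<Rightarrow> nat) \<Rightarrow> real ^ 'n \<Rightarrow> real" where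
  "monomial \<alpha> y = (\<Prod>i\<in>UNIV. (y $ i) ^ \<alpha> i)"

lemma finite_monomial_deg_le: "finite {\<alpha> :: 'n::finite \<Rightarrow> nat. monomial_deg \<alpha> \<le> k}"
proof (rule finite_subset)
  show "{\<alpha> :: 'n \<Rightarrow> nat. monomial_deg \<alpha> \<le> k} \<subseteq> Pi\<^sub>E UNIV (\<lambda>_. {..k})"
  proof
    fix \<alpha> :: "'n \<Rightarrow> nat" assume "\<alpha> \<in> {\<alpha>. monomial_deg \<alpha> \<le> k}"
    then have "\<alpha> i \<le> k" for i
      using member_le_sum[of i UNIV \<alpha>] by (auto simp: monomial_deg_def intro: order_trans)
    then show "\<alpha> \<in> Pi\<^sub>E UNIV (\<lambda>_. {..k})" by auto
  qed
  show "finite (Pi\<^sub>E (UNIV :: 'n set) (\<lambda>_. {..k}))" by (intro finite_PiE) auto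
qed

lemma prod_power_monomial_deg: "(\<Prod>i\<in>UNIV. (x::real) ^ \<alpha> i) = x ^ monomial_deg \<alpha>"
  by (simp add: monomial_deg_def power_sum)

lemma abs_monomial_le:
  assumes "\<And>i. \<bar>y $ i\<bar> \<le> r"
  shows "\<bar>monomial \<alpha> y\<bar> \<le> r ^ monomial_deg \<alpha>"
proof -
  have "\<bar>monomial \<alpha> y\<bar> = (\<Prod>i\<in>UNIV. \<bar>y $ i\<bar> ^ \<alpha> i)" by (simp add: monomial_def abs_prod power_abs)
  also have "\<dots> \<le> (\<Prod>i\<in>UNIV. r ^ \<alpha> i)" by (intro prod_mono conjI power_mono assms) auto
  finally show ?thesis by (simp add: prod_power_monomial_deg)
qed

lemma smooth_monomial: "smooth (\<lambda>x. monomial \<alpha> (x - x0))"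
  unfolding monomial_def vector_minus_component by (intro smooth_prod smooth_power smooth_coordinate)

lemma monomial_bigo:
  assumes "k \<le> monomial_deg \<alpha>"
  shows "(\<lambda>x. monomial \<alpha> (x - x0)) \<in> O[at x0](\<lambda>x. norm (x - x0) ^ k)"
proof (rule bigoI[of _ 1])
  show "\<forall>\<^sub>F x in at x0. norm (monomial \<alpha> (x - x0)) \<le> 1 * norm (norm (x - x0) ^ k)"
    unfolding eventually_at
  proof (intro exI[of _ 1] conjI ballI impI)
    fix x :: "real ^ 'a" assume x: "x \<noteq> x0 \<and> dist x x0 < 1"
    have "\<bar>monomial \<alpha> (x - x0)\<bar> \<le> norm (x - x0) ^ monomial_deg \<alpha>"
      by (intro abs_monomial_le component_le_norm_cart)
    also have "\<dots> \<le> norm (x - x0) ^ k" using x assms by (intro power_decreasing) (auto simp: dist_norm)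
    finally show "norm (monomial \<alpha> (x - x0)) \<le> 1 * norm (norm (x - x0) ^ k)" by simp
  qed simp
qed

text \<open>\<open>M\<close> bounds the norm of the series in the Wiener algebra of radius \<rho>. A
  box is used instead of a ball because each coordinate will be replaced by a path of norm at most
  \<rho> of its own; the bound is put on finite sums so that it applies directly to
  truncations.\<close>

definition expansion ::
    "(real ^ 'n \<Rightarrow> real) \<Rightarrow> real ^ 'n \<Rightarrow> (('n \<Rightarrow> nat) \<Rightarrow> real) \<Rightarrow> real \<Rightarrow> real \<Rightarrow> bool" where
  "expansion f x0 c \<rho> M \<longleftrightarrow> 0 < \<rho> \<and>
     (\<forall>F. finite F \<longrightarrow> (\<Sum>\<alpha>\<in>F. \<bar>c \<alpha>\<bar> * \<rho> ^ monomial_deg \<alpha>) \<le> M) \<and>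
     (\<forall>y. (\<forall>i. \<bar>y $ i\<bar> \<le> \<rho>) \<longrightarrow> ((\<lambda>\<alpha>. c \<alpha> * monomial \<alpha> y) has_sum f (x0 + y)) UNIV)"

lemma expansion_mono:
  assumes "expansion f x0 c \<rho> M" "0 < r" "r \<le> \<rho>" "M \<le> L"
  shows "expansion f x0 c r L"
proof -
  have "(\<Sum>\<alpha>\<in>F. \<bar>c \<alpha>\<bar> * r ^ monomial_deg \<alpha>) \<le> L" if "finite F" for F
  proof -
    have "(\<Sum>\<alpha>\<in>F. \<bar>c \<alpha>\<bar> * r ^ monomial_deg \<alpha>) \<le> (\<Sum>\<alpha>\<in>F. \<bar>c \<alpha>\<bar> * \<rho> ^ monomial_deg \<alpha>)"
      using assms by (intro sum_mono mult_left_mono power_mono) auto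
    also have "\<dots> \<le> M" using assms(1) that by (simp add: expansion_def)
    finally show ?thesis using assms(4) by simp
  qed
  moreover have "((\<lambda>\<alpha>. c \<alpha> * monomial \<alpha> y) has_sum f (x0 + y)) UNIV" if "\<forall>i. \<bar>y $ i\<bar> \<le> r" for y
  proof -
    have "\<forall>i. \<bar>y $ i\<bar> \<le> \<rho>" using that assms(3) by (meson order_trans)
    then show ?thesis using assms(1) by (simp add: expansion_def)
  qed
  ultimately show ?thesis using assms(2) by (simp add: expansion_def)
qed

text \<open>Each monomial of degree above k gains the factor
  \<open>(norm y / \<rho>) ^ Suc k\<close> over its size at radius \<rho>, and \<open>M\<close>
  bounds the sum of these sizes.\<close>

lemma expansion_remainder_bigo:
  assumes f: "expansion f x0 c \<rho> M"
  shows "(\<lambda>x. f x - (\<Sum>\<alpha>\<in>{\<alpha>. monomial_deg \<alpha> \<le> k}. c \<alpha> * monomial \<alpha> (x - x0)))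
     \<in> O[at x0](\<lambda>x. norm (x - x0) ^ Suc k)"
proof (rule bigoI[of _ "M / \<rho> ^ Suc k"])
  let ?A = "{\<alpha> :: 'a \<Rightarrow> nat. monomial_deg \<alpha> \<le> k}"
  have rho: "0 < \<rho>" using f by (simp add: expansion_def)
  show "\<forall>\<^sub>F x in at x0. norm (f x - (\<Sum>\<alpha>\<in>?A. c \<alpha> * monomial \<alpha> (x - x0)))
      \<le> M / \<rho> ^ Suc k * norm (norm (x - x0) ^ Suc k)"
    unfolding eventually_at
  proof (intro exI[of _ \<rho>] conjI ballI impI rho)
    fix x :: "real ^ 'a" assume x: "x \<noteq> x0 \<and> dist x x0 < \<rho>"
    define y where "y = x - x0"
    have y: "norm y \<le> \<rho>" "0 \<le> norm y" using x by (simp_all add: y_def dist_norm)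
    have yi: "\<bar>y $ i\<bar> \<le> norm y" for i by (rule component_le_norm_cart)
    have hs: "((\<lambda>\<alpha>. c \<alpha> * monomial \<alpha> y) has_sum f x) UNIV"
    proof -
      have "\<forall>i. \<bar>y $ i\<bar> \<le> \<rho>" using yi y order_trans by blast
      then have "((\<lambda>\<alpha>. c \<alpha> * monomial \<alpha> y) has_sum f (x0 + y)) UNIV" using f by (simp add: expansion_def)
      then show ?thesis by (simp add: y_def)
    qed
    let ?T = "\<lambda>F. \<Sum>\<alpha>\<in>F. c \<alpha> * monomial \<alpha> y"
    have lim: "((\<lambda>F. norm (?T F - ?T ?A)) \<longlongrightarrow> norm (f x - ?T ?A)) (finite_subsets_at_top UNIV)"
      using hs unfolding has_sum_def by (intro tendsto_intros)
    have bd: "norm (?T F - ?T ?A) \<le> M / \<rho> ^ Suc k * norm y ^ Suc k" if F: "finite F" "?A \<subseteq> F" for F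
    proof -
      have pt: "\<bar>c \<alpha> * monomial \<alpha> y\<bar> \<le> (\<bar>c \<alpha>\<bar> * \<rho> ^ monomial_deg \<alpha>) * (norm y / \<rho>) ^ Suc k" if "\<alpha> \<in> F - ?A" for \<alpha>
      proof -
        have deg: "Suc k \<le> monomial_deg \<alpha>" using that by auto
        have "\<bar>monomial \<alpha> y\<bar> \<le> norm y ^ monomial_deg \<alpha>" by (rule abs_monomial_le[OF yi])
        also have "\<dots> = \<rho> ^ monomial_deg \<alpha> * (norm y / \<rho>) ^ monomial_deg \<alpha>"
          using rho by (simp add: power_divide)
        also have "\<dots> \<le> \<rho> ^ monomial_deg \<alpha> * (norm y / \<rho>) ^ Suc k"
          using rho y by (intro mult_left_mono power_decreasing deg) auto
        finally show ?thesis unfolding abs_mult mult.assoc by (rule mult_left_mono) simp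
      qed
      have "?T F - ?T ?A = ?T (F - ?A)" using F by (simp add: sum_diff finite_monomial_deg_le)
      also have "norm \<dots> \<le> (\<Sum>\<alpha>\<in>F - ?A. (\<bar>c \<alpha>\<bar> * \<rho> ^ monomial_deg \<alpha>) * (norm y / \<rho>) ^ Suc k)"
        unfolding real_norm_def by (rule order_trans[OF sum_abs sum_mono[OF pt]])
      also have "\<dots> = (\<Sum>\<alpha>\<in>F - ?A. \<bar>c \<alpha>\<bar> * \<rho> ^ monomial_deg \<alpha>) * (norm y / \<rho>) ^ Suc k"
        by (simp only: sum_distrib_right)
      also have "\<dots> \<le> M * (norm y / \<rho>) ^ Suc k"
        using f F rho by (intro mult_right_mono) (auto simp: expansion_def)
      finally show ?thesis by (simp only: power_divide times_divide_eq_right times_divide_eq_left)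
    qed
    have "norm (f x - ?T ?A) \<le> M / \<rho> ^ Suc k * norm y ^ Suc k"
    proof (rule tendsto_upperbound[OF lim])
      show "\<forall>\<^sub>F F in finite_subsets_at_top UNIV. norm (?T F - ?T ?A) \<le> M / \<rho> ^ Suc k * norm y ^ Suc k"
        unfolding eventually_finite_subsets_at_top
        by (intro exI[of _ ?A]) (use bd finite_monomial_deg_le in auto)
    qed simp
    then show "norm (f x - (\<Sum>\<alpha>\<in>?A. c \<alpha> * monomial \<alpha> (x - x0))) \<le> M / \<rho> ^ Suc k * norm (norm (x - x0) ^ Suc k)"
      by (simp only: y_def real_norm_def abs_of_nonneg zero_le_power norm_ge_zero)
  qed
qed

context holder_driver
begin

lemma hn_monomial: "(\<And>i. hn \<rho> (\<lambda>t. Z t $ i)) \<Longrightarrow> hn (\<rho> ^ monomial_deg \<alpha>) (\<lambda>t. monomial \<alpha> (Z t))"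
  unfolding monomial_def prod_power_monomial_deg[symmetric] by (intro hnorm_le_prod hnorm_le_power)

lemma hn_monomial_diff:
  assumes "\<And>i. hn \<rho> (\<lambda>t. Z t $ i)" "\<And>i. hn \<rho> (\<lambda>t. S t $ i)" "\<And>i. hn \<delta> (\<lambda>t. Z t $ i - S t $ i)"
    and "0 < \<rho>"
  shows "hn (\<rho> ^ monomial_deg \<alpha> * monomial_deg \<alpha> * (\<delta> / \<rho>)) (\<lambda>t. monomial \<alpha> (Z t) - monomial \<alpha> (S t))"
proof -
  have d: "0 \<le> \<delta> / \<rho>" using hnorm_le_nonneg[OF assms(3) tau(1)] assms(4) by simp
  have pw: "hn (\<rho> ^ n * real n * (\<delta> / \<rho>)) (\<lambda>t. (Z t $ i) ^ n - (S t $ i) ^ n)" for i n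
  proof -
    have "hn ((\<Prod>k\<in>{..<n}. \<rho>) * (\<Sum>k\<in>{..<n}. 1) * (\<delta> / \<rho>)) (\<lambda>t. (\<Prod>k\<in>{..<n}. Z t $ i) - (\<Prod>k\<in>{..<n}. S t $ i))"
      using assms by (intro hnorm_le_prod_diff tau d) auto
    then show ?thesis by simp
  qed
  have "hn ((\<Prod>i\<in>UNIV. \<rho> ^ \<alpha> i) * (\<Sum>i\<in>UNIV. real (\<alpha> i)) * (\<delta> / \<rho>))
      (\<lambda>t. (\<Prod>i\<in>UNIV. (Z t $ i) ^ \<alpha> i) - (\<Prod>i\<in>UNIV. (S t $ i) ^ \<alpha> i))"
    using assms by (intro hnorm_le_prod_diff tau d pw hnorm_le_power) auto
  then show ?thesis by (simp add: monomial_def prod_power_monomial_deg) (simp add: monomial_deg_def)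
qed

text \<open>In the algebra the finite partial sums have norm at most \<open>M\<close>. They converge
  to the composition only pointwise, which suffices for \<open>hnorm_le_limit\<close>.\<close>

lemma hn_expansion:
  assumes f: "expansion f x0 c \<rho> M" and Z: "\<And>i. hn \<rho> (\<lambda>t. Z t $ i)"
  shows "hn M (\<lambda>t. f (x0 + Z t))"
proof (rule hnorm_le_limit[of "finite_subsets_at_top UNIV"])
  show "\<forall>\<^sub>F F in finite_subsets_at_top UNIV. hn M (\<lambda>t. \<Sum>\<alpha>\<in>F. c \<alpha> * monomial \<alpha> (Z t))"
  proof (rule eventually_finite_subsets_at_top_weakI)
    fix F :: "('a \<Rightarrow> nat) set" assume F: "finite F"
    have "hn (\<Sum>\<alpha>\<in>F. \<bar>c \<alpha>\<bar> * \<rho> ^ monomial_deg \<alpha>) (\<lambda>t. \<Sum>\<alpha>\<in>F. c \<alpha> * monomial \<alpha> (Z t))"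
      by (intro hnorm_le_sum hnorm_le_scale hn_monomial Z)
    then show "hn M (\<lambda>t. \<Sum>\<alpha>\<in>F. c \<alpha> * monomial \<alpha> (Z t))"
      by (rule hnorm_le_mono) (use f F in \<open>simp add: expansion_def\<close>)
  qed
  fix t assume t: "0 \<le> t" "t \<le> \<tau>"
  have "\<forall>i. \<bar>Z t $ i\<bar> \<le> \<rho>" using hnorm_le_abs[OF Z] t by simp
  then have "((\<lambda>\<alpha>. c \<alpha> * monomial \<alpha> (Z t)) has_sum f (x0 + Z t)) UNIV" using f by (simp add: expansion_def)
  then show "((\<lambda>F. \<Sum>\<alpha>\<in>F. c \<alpha> * monomial \<alpha> (Z t)) \<longlongrightarrow> f (x0 + Z t)) (finite_subsets_at_top UNIV)"
    by (simp add: has_sum_def)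
qed simp

text \<open>Differences of monomials bring in the degree as a factor. It is absorbed by
  \<open>n \<le> 2 ^ n\<close>, that is by doubling the radius, in the spirit of a Cauchy estimate
  for the derivative.\<close>

lemma hn_expansion_diff:
  assumes f: "expansion f x0 c (2 * \<rho>) M" and Z: "\<And>i. hn \<rho> (\<lambda>t. Z t $ i)" and S: "\<And>i. hn \<rho> (\<lambda>t. S t $ i)"
    and d: "\<And>i. hn \<delta> (\<lambda>t. Z t $ i - S t $ i)"
  shows "hn (M / \<rho> * \<delta>) (\<lambda>t. f (x0 + Z t) - f (x0 + S t))"
proof (rule hnorm_le_limit[of "finite_subsets_at_top UNIV"])
  have rho: "0 < \<rho>" using f by (simp add: expansion_def)
  have d0: "0 \<le> \<delta>" using hnorm_le_nonneg[OF d tau(1)] .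
  show "\<forall>\<^sub>F F in finite_subsets_at_top UNIV. hn (M / \<rho> * \<delta>) (\<lambda>t. \<Sum>\<alpha>\<in>F. c \<alpha> * (monomial \<alpha> (Z t) - monomial \<alpha> (S t)))"
  proof (rule eventually_finite_subsets_at_top_weakI)
    fix F :: "('a \<Rightarrow> nat) set" assume F: "finite F"
    have "hn (\<Sum>\<alpha>\<in>F. \<bar>c \<alpha>\<bar> * (\<rho> ^ monomial_deg \<alpha> * monomial_deg \<alpha> * (\<delta> / \<rho>)))
        (\<lambda>t. \<Sum>\<alpha>\<in>F. c \<alpha> * (monomial \<alpha> (Z t) - monomial \<alpha> (S t)))"
      by (intro hnorm_le_sum hnorm_le_scale hn_monomial_diff Z S d rho)
    moreover have "(\<Sum>\<alpha>\<in>F. \<bar>c \<alpha>\<bar> * (\<rho> ^ monomial_deg \<alpha> * monomial_deg \<alpha> * (\<delta> / \<rho>)))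
        \<le> (\<Sum>\<alpha>\<in>F. \<bar>c \<alpha>\<bar> * (2 * \<rho>) ^ monomial_deg \<alpha> * (\<delta> / \<rho>))"
    proof (rule sum_mono)
      fix \<alpha> :: "'a \<Rightarrow> nat"
      have "real (monomial_deg \<alpha>) \<le> 2 ^ monomial_deg \<alpha>" by (simp add: of_nat_less_two_power less_imp_le)
      then have "\<rho> ^ monomial_deg \<alpha> * monomial_deg \<alpha> \<le> \<rho> ^ monomial_deg \<alpha> * 2 ^ monomial_deg \<alpha>"
        using rho by (intro mult_left_mono) auto
      also have "\<dots> = (2 * \<rho>) ^ monomial_deg \<alpha>" by (simp only: power_mult_distrib mult.commute)
      finally have "\<bar>c \<alpha>\<bar> * (\<rho> ^ monomial_deg \<alpha> * monomial_deg \<alpha>) * (\<delta> / \<rho>) \<le> \<bar>c \<alpha>\<bar> * (2 * \<rho>) ^ monomial_deg \<alpha> * (\<delta> / \<rho>)"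
        using rho d0 by (intro mult_right_mono mult_left_mono) auto
      then show "\<bar>c \<alpha>\<bar> * (\<rho> ^ monomial_deg \<alpha> * monomial_deg \<alpha> * (\<delta> / \<rho>)) \<le> \<bar>c \<alpha>\<bar> * (2 * \<rho>) ^ monomial_deg \<alpha> * (\<delta> / \<rho>)"
        by (simp only: mult.assoc)
    qed
    moreover have "(\<Sum>\<alpha>\<in>F. \<bar>c \<alpha>\<bar> * (2 * \<rho>) ^ monomial_deg \<alpha> * (\<delta> / \<rho>)) \<le> M * (\<delta> / \<rho>)"
      unfolding sum_distrib_right[symmetric] using f F rho d0 by (intro mult_right_mono) (auto simp: expansion_def)
    ultimately show "hn (M / \<rho> * \<delta>) (\<lambda>t. \<Sum>\<alpha>\<in>F. c \<alpha> * (monomial \<alpha> (Z t) - monomial \<alpha> (S t)))"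
      by (elim hnorm_le_mono) simp
  qed
  fix t assume t: "0 \<le> t" "t \<le> \<tau>"
  have "\<bar>Z t $ i\<bar> \<le> 2 * \<rho>" "\<bar>S t $ i\<bar> \<le> 2 * \<rho>" for i
    using hnorm_le_abs[OF Z[of i], of t] hnorm_le_abs[OF S[of i], of t] t rho by auto
  then have "((\<lambda>\<alpha>. c \<alpha> * monomial \<alpha> (Z t)) has_sum f (x0 + Z t)) UNIV" "((\<lambda>\<alpha>. c \<alpha> * monomial \<alpha> (S t)) has_sum f (x0 + S t)) UNIV"
    using f by (simp_all add: expansion_def)
  then show "((\<lambda>F. \<Sum>\<alpha>\<in>F. c \<alpha> * (monomial \<alpha> (Z t) - monomial \<alpha> (S t))) \<longlongrightarrow> f (x0 + Z t) - f (x0 + S t)) (finite_subsets_at_top UNIV)"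
    unfolding has_sum_def right_diff_distrib sum_subtractf by (intro tendsto_diff)
qed simp

end

section \<open>Words, iterated integrals and the terms of the expansion\<close>

locale taylor_setting = holder_driver \<beta> \<tau> \<kappa> d b
  for \<beta> \<tau> \<kappa> :: real and d :: nat and b :: "nat \<Rightarrow> real \<Rightarrow> real" +
  fixes V :: "nat \<Rightarrow> real ^ 'n \<Rightarrow> real ^ 'n" and x0 :: "real ^ 'n"
  assumes smoothV: "i \<le> d \<Longrightarrow> smooth (V i)"
begin

definition words :: "nat \<Rightarrow> nat list set" where
  "words k = {I. set I \<subseteq> {0..d} \<and> length I = k}"

text \<open>\<open>P_coeff\<close> with any function in place of a coordinate and before evaluation
  at x0, so that further fields can act on it and products can be expanded.\<close>

definition word_apply :: "nat list \<Rightarrow> (real ^ 'n \<Rightarrow> real) \<Rightarrow> real ^ 'n \<Rightarrow> real" where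
  "word_apply I f = foldr (\<lambda>i. vf_apply (V i)) I f"

text \<open>\<open>taylor f k\<close> is the term of degree \<open>k\<close> in the formal expansion of \<open>f (X\<^sub>t)\<close>.\<close>

definition taylor :: "(real ^ 'n \<Rightarrow> real) \<Rightarrow> nat \<Rightarrow> real \<Rightarrow> real" where
  "taylor f k t = (\<Sum>I\<in>words k. word_apply I f x0 * iterated_integral b I t)"

lemma words_0: "words 0 = {[]}"
  by (auto simp: words_def)

text \<open>The last letter is split off because it has two roles: it is the outermost integrator
  and the field that acts first on the function.\<close>

lemma sum_words_Suc: "(\<Sum>I\<in>words (Suc k). h I) = (\<Sum>i\<le>d. \<Sum>J\<in>words k. h (J @ [i]))"
proof -
  have "(\<Sum>I\<in>words (Suc k). h I) = (\<Sum>(i, J)\<in>{..d} \<times> words k. h (J @ [i]))"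
  proof (rule sum.reindex_bij_witness[of _ "\<lambda>(i, J). J @ [i]" "\<lambda>I. (last I, butlast I)"])
    fix I assume "I \<in> words (Suc k)"
    then have I: "I \<noteq> []" "set I \<subseteq> {0..d}" "length I = Suc k" by (auto simp: words_def)
    then show "(case (last I, butlast I) of (i, J) \<Rightarrow> J @ [i]) = I" by simp
    show "(last I, butlast I) \<in> {..d} \<times> words k"
      using I subsetD[OF I(2) last_in_set[OF I(1)]] by (auto simp: words_def dest: in_set_butlastD)
    show "(case (last I, butlast I) of (i, J) \<Rightarrow> h (J @ [i])) = h I" using I by simp
  qed (auto simp: words_def)
  then show ?thesis by (simp add: sum.cartesian_product)
qed

lemma word_apply_Nil: "word_apply [] f = f"
  by (simp add: word_apply_def)

lemma word_apply_Cons: "word_apply (i # I) f = vf_apply (V i) (word_apply I f)"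
  by (simp add: word_apply_def)

lemma word_apply_snoc: "word_apply (I @ [i]) f = word_apply I (vf_apply (V i) f)"
  by (simp add: word_apply_def)

lemma smooth_vf: "i \<le> d \<Longrightarrow> smooth f \<Longrightarrow> smooth (vf_apply (V i) f)"
  by (intro smooth_vf_apply smoothV)

lemma smooth_word_apply: "set I \<subseteq> {0..d} \<Longrightarrow> smooth f \<Longrightarrow> smooth (word_apply I f)"
  by (induction I) (auto simp: word_apply_Nil word_apply_Cons intro: smooth_vf)

lemma word_apply_add:
  "set I \<subseteq> {0..d} \<Longrightarrow> smooth f \<Longrightarrow> smooth g \<Longrightarrow>
    word_apply I (\<lambda>x. f x + g x) = (\<lambda>x. word_apply I f x + word_apply I g x)"
  by (induction I) (auto simp: word_apply_Nil word_apply_Cons vf_apply_add smooth_word_apply)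

lemma word_apply_scale:
  "set I \<subseteq> {0..d} \<Longrightarrow> smooth f \<Longrightarrow> word_apply I (\<lambda>x. c * f x) = (\<lambda>x. c * word_apply I f x)"
  by (induction I) (auto simp: word_apply_Nil word_apply_Cons vf_apply_mult vf_apply_const smooth_word_apply)

lemma word_apply_const: "word_apply I (\<lambda>x. c) = (\<lambda>x. if I = [] then c else 0)"
  by (induction I) (auto simp: word_apply_Nil word_apply_Cons vf_apply_const)

lemma word_apply_bigo:
  "set I \<subseteq> {0..d} \<Longrightarrow> smooth f \<Longrightarrow> f \<in> O[at x0](\<lambda>x. norm (x - x0) ^ (m + length I)) \<Longrightarrow>
    word_apply I f \<in> O[at x0](\<lambda>x. norm (x - x0) ^ m)"
proof (induction I arbitrary: m)
  case (Cons i I)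
  have "word_apply I f \<in> O[at x0](\<lambda>x. norm (x - x0) ^ Suc m)"
    using Cons.IH[of "Suc m"] Cons.prems by (simp del: power_Suc)
  then have "vf_apply (V i) (word_apply I f) \<in> O[at x0](\<lambda>x. norm (x - x0) ^ m)"
    using Cons.prems by (intro vf_apply_bigo smoothV smooth_word_apply) auto
  then show ?case by (simp only: word_apply_Cons)
qed (simp add: word_apply_Nil)

lemma iterated_integral_Nil: "iterated_integral b [] = (\<lambda>t. 1)"
  by (simp add: iterated_integral_def)

lemma iterated_integral_snoc: "iterated_integral b (I @ [i]) = integ i (iterated_integral b I)"
  by (rule ext) (simp add: iterated_integral_def integ_def)

lemma hn_iterated_integral: "set I \<subseteq> {0..d} \<Longrightarrow> \<exists>K. hn K (iterated_integral b I)"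
proof (induction I rule: rev_induct)
  case Nil
  show ?case using hnorm_le_const[of \<beta> \<tau> 1] by (auto simp: iterated_integral_Nil)
next
  case (snoc i I)
  then obtain K where "hn K (iterated_integral b I)" by auto
  then show ?case using hn_integ[of i K] snoc.prems by (auto simp: iterated_integral_snoc)
qed

lemma hn_taylor: "\<exists>K. hn K (taylor f k)"
proof -
  have "\<forall>I\<in>words k. \<exists>K. hn K (\<lambda>t. word_apply I f x0 * iterated_integral b I t)"
  proof
    fix I assume "I \<in> words k"
    then obtain K where "hn K (iterated_integral b I)" using hn_iterated_integral[of I] by (auto simp: words_def)
    from hnorm_le_scale[OF this] show "\<exists>K. hn K (\<lambda>t. word_apply I f x0 * iterated_integral b I t)" ..
  qed
  from bchoice[OF this] obtain K where
    K: "\<forall>I\<in>words k. hn (K I) (\<lambda>t. word_apply I f x0 * iterated_integral b I t)" ..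
  have "hn (\<Sum>I\<in>words k. K I) (taylor f k)"
    unfolding taylor_def[abs_def] by (rule hnorm_le_sum) (use K in blast)
  then show ?thesis ..
qed

lemma taylor_0: "taylor f 0 t = f x0"
  by (simp add: taylor_def words_0 word_apply_Nil iterated_integral_Nil)

lemma taylor_Suc_eq:
  "taylor f (Suc k) t = (\<Sum>i\<le>d. \<Sum>J\<in>words k. word_apply J (vf_apply (V i) f) x0 * integ i (iterated_integral b J) t)"
  by (simp add: taylor_def sum_words_Suc word_apply_snoc iterated_integral_snoc)

lemma germ_integ:
  assumes "i \<le> d" "hn K f"
  shows "germ (integ i f) (\<lambda>j t. if j = i then f t else 0)"
proof (rule germI[of _ _ "young_const (2 * \<beta>) * K * \<kappa>"])
  fix s t assume st: "0 \<le> s" "s \<le> t" "t \<le> \<tau>"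
  have "(\<Sum>j\<le>d. (if j = i then f s else 0) * (b j t - b j s)) = f s * (b i t - b i s)"
    using assms(1) by (simp add: if_distrib[of "\<lambda>x. x * _"] cong: if_cong)
  then show "\<bar>integ i f t - integ i f s - (\<Sum>j\<le>d. (if j = i then f s else 0) * (b j t - b j s))\<bar>
     \<le> young_const (2 * \<beta>) * K * \<kappa> * (t - s) powr (2 * \<beta>)"
    using integ_germ_bound[OF assms _ st(3) st(1,2)] st by simp
qed

lemma taylor_Suc_at_0: "taylor f (Suc k) 0 = 0"
proof -
  have "integ i (iterated_integral b J) 0 = 0" if "i \<le> d" "J \<in> words k" for i J
    using hn_iterated_integral[of J] that integ_0[of i _ _ 0] tau by (auto simp: words_def)
  then show ?thesis by (simp add: taylor_Suc_eq)
qed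

text \<open>The chain rule \<open>d f(X) = sum (V_i f)(X) dB_i\<close>, read degree by degree. The
  multiplicativity and the norm bounds below rest on this relation.\<close>

lemma germ_taylor: "germ (taylor f (Suc k)) (\<lambda>i. taylor (vf_apply (V i) f) k)"
proof -
  let ?c = "\<lambda>i J. word_apply J (vf_apply (V i) f) x0"
  have "germ (\<lambda>t. \<Sum>i\<le>d. \<Sum>J\<in>words k. ?c i J * integ i (iterated_integral b J) t)
     (\<lambda>j t. \<Sum>i\<le>d. \<Sum>J\<in>words k. ?c i J * (if j = i then iterated_integral b J t else 0))"
  proof (intro germ_sum germ_scale)
    fix i J assume "i \<in> {..d}" "J \<in> words k"
    then show "germ (integ i (iterated_integral b J)) (\<lambda>j t. if j = i then iterated_integral b J t else 0)"
      using hn_iterated_integral[of J] germ_integ[of i] by (auto simp: words_def)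
  qed
  then show ?thesis
  proof (rule germ_cong)
    fix j :: nat and t assume j: "j \<le> d"
    have "(\<Sum>i\<le>d. \<Sum>J\<in>words k. ?c i J * (if j = i then iterated_integral b J t else 0)) =
        (\<Sum>i\<le>d. if i = j then \<Sum>J\<in>words k. ?c i J * iterated_integral b J t else 0)"
      by (intro sum.cong refl) auto
    then show "(\<Sum>i\<le>d. \<Sum>J\<in>words k. ?c i J * (if j = i then iterated_integral b J t else 0)) = taylor (vf_apply (V j) f) k t"
      using j by (simp add: taylor_def)
  qed (simp add: taylor_Suc_eq)
qed

lemma taylor_Suc:
  assumes "0 \<le> t" "t \<le> \<tau>"
  shows "taylor f (Suc k) t = integs (\<lambda>i. taylor (vf_apply (V i) f) k) t"
proof -
  have "\<forall>i. \<exists>K. hn K (taylor (vf_apply (V i) f) k)" by (intro allI hn_taylor)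
  from choice[OF this] obtain K where "\<forall>i. hn (K i) (taylor (vf_apply (V i) f) k)" ..
  then have K: "hn (K i) (taylor (vf_apply (V i) f) k)" for i by blast
  show ?thesis by (rule germ_eq_integs[OF germ_taylor taylor_Suc_at_0 K assms])
qed

lemma taylor_add: "smooth f \<Longrightarrow> smooth g \<Longrightarrow> taylor (\<lambda>x. f x + g x) k t = taylor f k t + taylor g k t"
proof -
  assume fg: "smooth f" "smooth g"
  have "taylor (\<lambda>x. f x + g x) k t = (\<Sum>I\<in>words k. word_apply I f x0 * iterated_integral b I t + word_apply I g x0 * iterated_integral b I t)"
    unfolding taylor_def using fg by (intro sum.cong refl) (simp add: words_def word_apply_add distrib_right)
  then show ?thesis by (simp add: taylor_def sum.distrib)
qed

lemma taylor_scale: "smooth f \<Longrightarrow> taylor (\<lambda>x. c * f x) k t = c * taylor f k t"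
  unfolding taylor_def sum_distrib_left
  by (intro sum.cong refl) (simp add: words_def word_apply_scale)

lemma taylor_const: "taylor (\<lambda>x. c) k t = (if k = 0 then c else 0)"
proof (cases k)
  case 0
  then show ?thesis by (simp add: taylor_0)
next
  case (Suc m)
  then have "I \<noteq> []" if "I \<in> words k" for I using that by (auto simp: words_def)
  then show ?thesis using Suc by (simp add: taylor_def word_apply_const)
qed

lemma taylor_sum:
  assumes "\<And>a. a \<in> A \<Longrightarrow> smooth (f a)"
  shows "taylor (\<lambda>x. \<Sum>a\<in>A. c a * f a x) k t = (\<Sum>a\<in>A. c a * taylor (f a) k t)"
  using assms
proof (induction A rule: infinite_finite_induct)
  case (insert a A)
  have "smooth (\<lambda>x. c a * f a x)" "smooth (\<lambda>x. \<Sum>a\<in>A. c a * f a x)"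
    using insert.prems by (auto intro!: smooth_mult smooth_sum)
  then show ?case using insert by (simp add: taylor_add taylor_scale)
qed (auto simp: taylor_const)

text \<open>A word of length k < m leaves a function that still vanishes at x0 to order at least
  one. Hence an analytic function may be replaced by its polynomial part as long as only low degrees
  are considered.\<close>

lemma taylor_vanish:
  assumes "smooth f" "f \<in> O[at x0](\<lambda>x. norm (x - x0) ^ m)" "k < m"
  shows "taylor f k t = 0"
  unfolding taylor_def
proof (intro sum.neutral ballI)
  fix I assume "I \<in> words k"
  then have I: "set I \<subseteq> {0..d}" "length I = k" by (auto simp: words_def)
  have "(m - k - 1) + 1 + k = m" using assms(3) by simp
  then have "word_apply I f \<in> O[at x0](\<lambda>x. norm (x - x0) ^ Suc (m - k - 1))"
    using assms I by (intro word_apply_bigo) auto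
  moreover have "isCont (word_apply I f) x0"
    using smooth_continuous[OF smooth_word_apply[OF I(1) assms(1)]] by (simp add: continuous_on_eq_continuous_at)
  ultimately have "word_apply I f x0 = 0" using bigo_power_imp_zero by blast
  then show "word_apply I f x0 * iterated_integral b I t = 0" by simp
qed

text \<open>Young integrals obey the product rule, so \<open>f \<mapsto> \<Sum>\<^sub>k \<epsilon>\<^sup>k taylor f k\<close> is multiplicative.\<close>

lemma taylor_mult:
  assumes "smooth f" "smooth g" "0 \<le> t" "t \<le> \<tau>"
  shows "taylor (\<lambda>x. f x * g x) k t = (\<Sum>l\<le>k. taylor f l t * taylor g (k - l) t)"
  using assms
proof (induction k arbitrary: f g t)
  case 0
  then show ?case by (simp add: taylor_0)
next
  case (Suc k)
  \<comment> \<open>The integrand against driver i of the term of degree l; a term of degree 0 is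
    constant, so its integrand is 0.\<close>
  define D where "D h l i = (case l of 0 \<Rightarrow> \<lambda>t. 0 | Suc m \<Rightarrow> taylor (vf_apply (V i) h) m)" for h l i
  have gD: "germ (taylor h l) (D h l)" for h l
  proof (cases l)
    case 0
    have "taylor h 0 = (\<lambda>t. h x0)" by (rule ext) (rule taylor_0)
    then show ?thesis using germ_const[of "h x0"] 0 by (simp add: D_def[abs_def])
  next
    case (Suc m)
    then show ?thesis using germ_taylor[of h m] by (simp add: D_def[abs_def])
  qed
  let ?r = "\<lambda>t. \<Sum>l\<le>Suc k. taylor f l t * taylor g (Suc k - l) t"
  let ?p = "\<lambda>i t. \<Sum>l\<le>Suc k. taylor f l t * D g (Suc k - l) i t + taylor g (Suc k - l) t * D f l i t"
  have "germ ?r ?p"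
  proof (rule germ_sum)
    fix l
    obtain K L where "hn K (taylor f l)" "hn L (taylor g (Suc k - l))" using hn_taylor by blast
    then show "germ (\<lambda>t. taylor f l t * taylor g (Suc k - l) t)
      (\<lambda>i t. taylor f l t * D g (Suc k - l) i t + taylor g (Suc k - l) t * D f l i t)"
      using gD germ_mult by blast
  qed
  then have "germ ?r (\<lambda>i. taylor (vf_apply (V i) (\<lambda>x. f x * g x)) k)"
  proof (rule germ_cong)
    fix i t assume i: "i \<le> d" and t: "0 \<le> t" "t \<le> \<tau>"
    have "(\<Sum>l\<le>Suc k. taylor f l t * D g (Suc k - l) i t) = (\<Sum>l\<le>k. taylor f l t * taylor (vf_apply (V i) g) (k - l) t)"
      by (simp add: D_def Suc_diff_le)
    also have "\<dots> = taylor (\<lambda>x. f x * vf_apply (V i) g x) k t"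
      using Suc.IH[of f "vf_apply (V i) g" t] Suc.prems smooth_vf[OF i] t by simp
    finally have 1: "(\<Sum>l\<le>Suc k. taylor f l t * D g (Suc k - l) i t) = taylor (\<lambda>x. f x * vf_apply (V i) g x) k t" .
    have "(\<Sum>l\<le>Suc k. taylor g (Suc k - l) t * D f l i t) = (\<Sum>l\<le>k. taylor (vf_apply (V i) f) l t * taylor g (k - l) t)"
      by (subst sum.atMost_Suc_shift) (simp add: D_def mult.commute)
    also have "\<dots> = taylor (\<lambda>x. vf_apply (V i) f x * g x) k t"
      using Suc.IH[of "vf_apply (V i) f" g t] Suc.prems smooth_vf[OF i] t by simp
    finally have 2: "(\<Sum>l\<le>Suc k. taylor g (Suc k - l) t * D f l i t) = taylor (\<lambda>x. vf_apply (V i) f x * g x) k t" .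
    have "?p i t = taylor (\<lambda>x. f x * vf_apply (V i) g x + vf_apply (V i) f x * g x) k t"
      unfolding sum.distrib 1 2 using Suc.prems smooth_vf[OF i] by (intro taylor_add[symmetric] smooth_mult) auto
    then show "?p i t = taylor (vf_apply (V i) (\<lambda>x. f x * g x)) k t"
      using Suc.prems by (simp add: vf_apply_mult)
  qed simp
  from germ_unique[OF germ_taylor this _ Suc.prems(3,4)]
  show ?case
  proof (rule trans)
    \<comment> \<open>The two degrees add up to \<open>Suc k\<close>, so at least one factor has
      positive degree and starts at 0.\<close>
    have "taylor f l 0 * taylor g (Suc k - l) 0 = 0" if "l \<le> Suc k" for l
      using that by (cases l) (simp_all add: taylor_Suc_at_0)
    then have "?r 0 = 0" by (intro sum.neutral ballI) simp
    then show "taylor (\<lambda>x. f x * g x) (Suc k) 0 = ?r 0" by (simp only: taylor_Suc_at_0)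
  qed simp
qed

end

section \<open>Convergence of the expansion\<close>

context taylor_setting
begin

text \<open>The norm of the Wiener algebra of power series, truncated at degree \<open>N\<close>.\<close>

definition taylor_le :: "nat \<Rightarrow> real \<Rightarrow> (real ^ 'n \<Rightarrow> real) \<Rightarrow> bool" where
  "taylor_le N K f \<longleftrightarrow> (\<exists>a. (\<forall>k\<le>N. hn (a k) (taylor f k)) \<and> (\<Sum>k\<le>N. a k) \<le> K)"

lemma taylor_leI: "(\<And>k. k \<le> N \<Longrightarrow> hn (a k) (taylor f k)) \<Longrightarrow> (\<Sum>k\<le>N. a k) \<le> K \<Longrightarrow> taylor_le N K f"
  unfolding taylor_le_def by blast

lemma taylor_leE:
  assumes "taylor_le N K f"
  obtains a where "\<forall>k\<le>N. hn (a k) (taylor f k)" "(\<Sum>k\<le>N. a k) \<le> K" "\<forall>k\<le>N. 0 \<le> a k"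
proof -
  obtain a where a: "\<forall>k\<le>N. hn (a k) (taylor f k)" "(\<Sum>k\<le>N. a k) \<le> K"
    using assms unfolding taylor_le_def by blast
  moreover have "\<forall>k\<le>N. 0 \<le> a k" using a(1) hnorm_le_nonneg tau(1) by blast
  ultimately show ?thesis using that by blast
qed

lemma taylor_le_mono: "taylor_le N K f \<Longrightarrow> K \<le> L \<Longrightarrow> taylor_le N L f"
  unfolding taylor_le_def by (meson order_trans)

lemma taylor_le_nonneg:
  assumes "taylor_le N K f"
  shows "0 \<le> K"
proof -
  obtain a where a: "\<forall>k\<le>N. hn (a k) (taylor f k)" "(\<Sum>k\<le>N. a k) \<le> K" "\<forall>k\<le>N. 0 \<le> a k"
    by (rule taylor_leE[OF assms])
  have "0 \<le> (\<Sum>k\<le>N. a k)" using a(3) by (intro sum_nonneg) auto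
  then show ?thesis using a(2) by simp
qed

lemma taylor_le_const: "taylor_le N \<bar>c\<bar> (\<lambda>x. c)"
proof (rule taylor_leI)
  fix k
  have "taylor (\<lambda>x. c) k = (\<lambda>t. if k = 0 then c else 0)" by (rule ext) (rule taylor_const)
  then show "hn (if k = 0 then \<bar>c\<bar> else 0) (taylor (\<lambda>x. c) k)"
    using hnorm_le_const[of \<beta> \<tau> c] hnorm_le_const[of \<beta> \<tau> 0] by simp
qed simp

lemma taylor_le_scale:
  assumes "taylor_le N K f" "smooth f"
  shows "taylor_le N (\<bar>c\<bar> * K) (\<lambda>x. c * f x)"
proof -
  obtain a where a: "\<forall>k\<le>N. hn (a k) (taylor f k)" "(\<Sum>k\<le>N. a k) \<le> K" "\<forall>k\<le>N. 0 \<le> a k"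
    by (rule taylor_leE[OF assms(1)])
  show ?thesis
  proof (rule taylor_leI)
    fix k assume "k \<le> N"
    then have "hn (\<bar>c\<bar> * a k) (\<lambda>t. c * taylor f k t)" using a(1) by (intro hnorm_le_scale) simp
    then show "hn (\<bar>c\<bar> * a k) (taylor (\<lambda>x. c * f x) k)"
      by (rule hnorm_le_cong) (simp add: taylor_scale assms(2))
  next
    show "(\<Sum>k\<le>N. \<bar>c\<bar> * a k) \<le> \<bar>c\<bar> * K"
      unfolding sum_distrib_left[symmetric] using a(2) by (rule mult_left_mono) simp
  qed
qed

lemma taylor_le_add:
  assumes "taylor_le N K f" "taylor_le N L g" "smooth f" "smooth g"
  shows "taylor_le N (K + L) (\<lambda>x. f x + g x)"
proof -
  obtain a where a: "\<forall>k\<le>N. hn (a k) (taylor f k)" "(\<Sum>k\<le>N. a k) \<le> K" "\<forall>k\<le>N. 0 \<le> a k"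
    by (rule taylor_leE[OF assms(1)])
  obtain c where c: "\<forall>k\<le>N. hn (c k) (taylor g k)" "(\<Sum>k\<le>N. c k) \<le> L" "\<forall>k\<le>N. 0 \<le> c k"
    by (rule taylor_leE[OF assms(2)])
  show ?thesis
  proof (rule taylor_leI)
    fix k assume "k \<le> N"
    then have "hn (a k + c k) (\<lambda>t. taylor f k t + taylor g k t)" using a(1) c(1) by (intro hnorm_le_add) simp_all
    then show "hn (a k + c k) (taylor (\<lambda>x. f x + g x) k)"
      by (rule hnorm_le_cong) (simp add: taylor_add assms)
  next
    show "(\<Sum>k\<le>N. a k + c k) \<le> K + L" unfolding sum.distrib using a(2) c(2) by (rule add_mono)
  qed
qed

lemma taylor_le_sum:
  assumes "\<And>\<alpha>. \<alpha> \<in> A \<Longrightarrow> taylor_le N (K \<alpha>) (f \<alpha>)" "\<And>\<alpha>. \<alpha> \<in> A \<Longrightarrow> smooth (f \<alpha>)"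
  shows "taylor_le N (\<Sum>\<alpha>\<in>A. K \<alpha>) (\<lambda>x. \<Sum>\<alpha>\<in>A. f \<alpha> x)"
  using assms
proof (induction A rule: infinite_finite_induct)
  case (insert x F)
  then show ?case
    using taylor_le_add[of N "K x" "f x" "\<Sum>\<alpha>\<in>F. K \<alpha>" "\<lambda>x. \<Sum>\<alpha>\<in>F. f \<alpha> x"] by (simp add: smooth_sum)
qed (use taylor_le_const[of N 0] in simp_all)

text \<open>The truncated Cauchy product runs over a triangle inside the square of side N, and all
  weights are nonnegative.\<close>

lemma taylor_le_mult:
  assumes "taylor_le N K f" "taylor_le N L g" "smooth f" "smooth g"
  shows "taylor_le N (K * L) (\<lambda>x. f x * g x)"
proof -
  obtain a where a: "\<forall>k\<le>N. hn (a k) (taylor f k)" "(\<Sum>k\<le>N. a k) \<le> K" "\<forall>k\<le>N. 0 \<le> a k" by (rule taylor_leE[OF assms(1)])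
  obtain c where c: "\<forall>k\<le>N. hn (c k) (taylor g k)" "(\<Sum>k\<le>N. c k) \<le> L" "\<forall>k\<le>N. 0 \<le> c k" by (rule taylor_leE[OF assms(2)])
  show ?thesis
  proof (rule taylor_leI)
    fix k assume k: "k \<le> N"
    have "hn (\<Sum>l\<le>k. a l * c (k - l)) (\<lambda>t. \<Sum>l\<le>k. taylor f l t * taylor g (k - l) t)"
      by (intro hnorm_le_sum hnorm_le_mult) (use a(1) c(1) k in auto)
    then show "hn (\<Sum>l\<le>k. a l * c (k - l)) (taylor (\<lambda>x. f x * g x) k)"
      by (rule hnorm_le_cong) (simp add: taylor_mult assms)
  next
    have "(\<Sum>k\<le>N. \<Sum>l\<le>k. a l * c (k - l)) = (\<Sum>(i, j)\<in>{(i, j). i + j \<le> N}. a i * c j)"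
      by (rule sum.triangle_reindex_eq[symmetric])
    also have "\<dots> \<le> (\<Sum>(i, j)\<in>{..N} \<times> {..N}. a i * c j)"
      by (rule sum_mono2) (use a(3) c(3) in auto)
    also have "\<dots> = (\<Sum>i\<le>N. a i) * (\<Sum>j\<le>N. c j)" by (simp add: sum_product sum.cartesian_product)
    also have "\<dots> \<le> K * L"
      using a c taylor_le_nonneg[OF assms(1)] by (intro mult_mono sum_nonneg) auto
    finally show "(\<Sum>k\<le>N. \<Sum>l\<le>k. a l * c (k - l)) \<le> K * L" .
  qed
qed

lemma taylor_le_power:
  assumes "taylor_le N K f" "smooth f"
  shows "taylor_le N (K ^ m) (\<lambda>x. f x ^ m)"
proof (induction m)
  case 0
  show ?case using taylor_le_const[of N 1] by simp
next
  case (Suc m)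
  then show ?case using taylor_le_mult[OF assms(1) Suc] assms(2) by (simp add: smooth_power)
qed

lemma taylor_le_prod:
  assumes "\<And>i. i \<in> A \<Longrightarrow> taylor_le N (K i) (f i)" "\<And>i. i \<in> A \<Longrightarrow> smooth (f i)"
  shows "taylor_le N (\<Prod>i\<in>A. K i) (\<lambda>x. \<Prod>i\<in>A. f i x)"
  using assms
proof (induction A rule: infinite_finite_induct)
  case (insert x F)
  then show ?case
    using taylor_le_mult[of N "K x" "f x" "\<Prod>i\<in>F. K i" "\<lambda>x. \<Prod>i\<in>F. f i x"] by (simp add: smooth_prod)
qed (use taylor_le_const[of N 1] in simp_all)

lemma taylor_le_monomial:
  assumes "\<And>j. taylor_le N \<rho> (\<lambda>x. x $ j - x0 $ j)"
  shows "taylor_le N (\<rho> ^ monomial_deg \<alpha>) (\<lambda>x. monomial \<alpha> (x - x0))"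
  unfolding monomial_def prod_power_monomial_deg[symmetric] vector_minus_component
  by (intro taylor_le_prod taylor_le_power assms smooth_power smooth_coordinate)

text \<open>The remainder beyond degree N vanishes to order N + 1 > k at x0 and drops out. In this
  way the power series is substituted without expressing \<open>c\<close> through
  derivatives.\<close>

lemma taylor_expansion:
  assumes f: "expansion f x0 c \<rho> M" "smooth f" and k: "k \<le> N"
  shows "taylor f k t = (\<Sum>\<alpha>\<in>{\<alpha>. monomial_deg \<alpha> \<le> N}. c \<alpha> * taylor (\<lambda>x. monomial \<alpha> (x - x0)) k t)"
proof -
  let ?A = "{\<alpha>. monomial_deg \<alpha> \<le> N}"
  let ?p = "\<lambda>x. \<Sum>\<alpha>\<in>?A. c \<alpha> * monomial \<alpha> (x - x0)"
  have p: "smooth ?p" by (intro smooth_sum smooth_mult smooth_const smooth_monomial)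
  have mp: "smooth (\<lambda>x. (-1) * ?p x)" by (intro smooth_mult smooth_const p)
  have "smooth (\<lambda>x. f x + (-1) * ?p x)" by (intro smooth_add f(2) mp)
  then have r: "smooth (\<lambda>x. f x - ?p x)" by simp
  have "taylor f k t = taylor (\<lambda>x. (f x - ?p x) + ?p x) k t" by simp
  also have "\<dots> = taylor (\<lambda>x. f x - ?p x) k t + taylor ?p k t" by (rule taylor_add[OF r p])
  also have "taylor (\<lambda>x. f x - ?p x) k t = 0"
    using k by (intro taylor_vanish[OF r expansion_remainder_bigo[OF f(1), of N]]) simp
  also have "taylor ?p k t = (\<Sum>\<alpha>\<in>?A. c \<alpha> * taylor (\<lambda>x. monomial \<alpha> (x - x0)) k t)"
    by (rule taylor_sum) (rule smooth_monomial)
  finally show ?thesis by simp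
qed

text \<open>Up to degree N only finitely many monomials matter, so this substitution involves no
  limit, and the resulting bound is free of N.\<close>

lemma taylor_le_expansion:
  assumes f: "expansion f x0 c \<rho> M" "smooth f" and N: "\<And>j. taylor_le N \<rho> (\<lambda>x. x $ j - x0 $ j)"
  shows "taylor_le N M f"
proof -
  let ?A = "{\<alpha>. monomial_deg \<alpha> \<le> N}"
  let ?p = "\<lambda>x. \<Sum>\<alpha>\<in>?A. c \<alpha> * monomial \<alpha> (x - x0)"
  have "taylor_le N (\<Sum>\<alpha>\<in>?A. \<bar>c \<alpha>\<bar> * \<rho> ^ monomial_deg \<alpha>) ?p"
    by (intro taylor_le_sum taylor_le_scale taylor_le_monomial N smooth_mult smooth_const smooth_monomial)
  then have "taylor_le N M ?p"
    by (rule taylor_le_mono) (use f(1) in \<open>simp add: expansion_def finite_monomial_deg_le\<close>)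
  then obtain a where a: "\<forall>k\<le>N. hn (a k) (taylor ?p k)" "(\<Sum>k\<le>N. a k) \<le> M" "\<forall>k\<le>N. 0 \<le> a k"
    by (rule taylor_leE)
  have "taylor ?p k = taylor f k" if "k \<le> N" for k
    by (rule ext) (simp add: taylor_expansion[OF f that] taylor_sum smooth_monomial)
  then show ?thesis using a by (intro taylor_leI[of N a]) auto
qed

text \<open>Integration raises the degree by one: the terms of the \<open>vf_apply (V i) f\<close>
  up to degree N determine those of f in degrees 1 to N + 1, at the cost of \<open>eta\<close> for
  each of the d + 1 drivers. The remaining term of degree 0 is \<open>f x0\<close>.\<close>

lemma taylor_le_Suc:
  assumes "\<And>i. i \<le> d \<Longrightarrow> taylor_le N M (vf_apply (V i) f)" "f x0 = 0"
  shows "taylor_le (Suc N) ((d + 1) * eta * M) f"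
proof -
  have "\<forall>i\<in>{..d}. \<exists>a. (\<forall>k\<le>N. hn (a k) (taylor (vf_apply (V i) f) k)) \<and> (\<Sum>k\<le>N. a k) \<le> M"
    using assms(1) by (auto simp: taylor_le_def)
  from bchoice[OF this] obtain a where
    a: "\<forall>i\<in>{..d}. (\<forall>k\<le>N. hn (a i k) (taylor (vf_apply (V i) f) k)) \<and> (\<Sum>k\<le>N. a i k) \<le> M" ..
  define e where "e k = (case k of 0 \<Rightarrow> 0 | Suc m \<Rightarrow> (\<Sum>i\<le>d. eta * a i m))" for k
  show ?thesis
  proof (rule taylor_leI[of _ e])
    fix k assume k: "k \<le> Suc N"
    show "hn (e k) (taylor f k)"
    proof (cases k)
      case 0
      have "taylor f 0 = (\<lambda>t. 0)" using assms(2) by (intro ext) (simp add: taylor_0)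
      then show ?thesis using 0 hnorm_le_const[of \<beta> \<tau> 0] by (simp add: e_def)
    next
      case (Suc m)
      have "hn (\<Sum>i\<le>d. eta * a i m) (\<lambda>t. \<Sum>i\<le>d. integ i (taylor (vf_apply (V i) f) m) t)"
        by (intro hnorm_le_sum hn_integ) (use a Suc k in auto)
      then have "hn (e k) (\<lambda>t. \<Sum>i\<le>d. integ i (taylor (vf_apply (V i) f) m) t)" by (simp add: e_def Suc)
      then show ?thesis unfolding Suc by (rule hnorm_le_cong) (simp add: taylor_Suc integs_def)
    qed
  next
    have "(\<Sum>k\<le>Suc N. e k) = (\<Sum>k\<le>N. \<Sum>i\<le>d. eta * a i k)"
      by (subst sum.atMost_Suc_shift) (simp add: e_def)
    also have "\<dots> = (\<Sum>i\<le>d. eta * (\<Sum>k\<le>N. a i k))"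
      by (subst sum.swap) (simp add: sum_distrib_left)
    also have "\<dots> \<le> (\<Sum>i\<le>d. eta * M)"
      using a eta_nonneg by (intro sum_mono mult_left_mono) auto
    also have "\<dots> = (d + 1) * eta * M" by (simp add: mult.assoc)
    finally show "(\<Sum>k\<le>Suc N. e k) \<le> (d + 1) * eta * M" .
  qed
qed

lemma taylor_le_abs_sum:
  assumes "taylor_le N K f" "0 \<le> t" "t \<le> \<tau>"
  shows "(\<Sum>k\<le>N. \<bar>taylor f k t\<bar>) \<le> K"
proof -
  obtain a where a: "\<forall>k\<le>N. hn (a k) (taylor f k)" "(\<Sum>k\<le>N. a k) \<le> K" "\<forall>k\<le>N. 0 \<le> a k"
    by (rule taylor_leE[OF assms(1)])
  have "(\<Sum>k\<le>N. \<bar>taylor f k t\<bar>) \<le> (\<Sum>k\<le>N. a k)"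
  proof (rule sum_mono)
    fix k assume "k \<in> {..N}"
    then have "hn (a k) (taylor f k)" using a(1) by simp
    then show "\<bar>taylor f k t\<bar> \<le> a k" by (rule hnorm_le_abs) (use assms in simp)
  qed
  then show ?thesis using a(2) by simp
qed

lemma summable_abs_taylor:
  assumes "\<And>N. taylor_le N K f" "0 \<le> t" "t \<le> \<tau>"
  shows "summable (\<lambda>k. \<bar>taylor f k t\<bar>)"
proof (rule summableI_nonneg_bounded)
  fix n
  have "(\<Sum>k<n. \<bar>taylor f k t\<bar>) \<le> (\<Sum>k\<le>n. \<bar>taylor f k t\<bar>)" by (rule sum_mono2) auto
  then show "(\<Sum>k<n. \<bar>taylor f k t\<bar>) \<le> K" using taylor_le_abs_sum[OF assms(1)[of n] assms(2,3)] by simp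
qed simp

text \<open>The bound uniform in N yields the absolute convergence that Cauchy products require;
  carried along with the value, it makes the notion stable under products.\<close>

definition taylor_sums :: "real \<Rightarrow> real \<Rightarrow> (real ^ 'n \<Rightarrow> real) \<Rightarrow> real \<Rightarrow> bool" where
  "taylor_sums t K f F \<longleftrightarrow> smooth f \<and> (\<forall>N. taylor_le N K f) \<and> (\<lambda>k. taylor f k t) sums F"

lemma taylor_sums_mult:
  assumes f: "taylor_sums t K f F" and g: "taylor_sums t L g G" and t: "0 \<le> t" "t \<le> \<tau>"
  shows "taylor_sums t (K * L) (\<lambda>x. f x * g x) (F * G)"
proof -
  have "(\<lambda>k. \<Sum>l\<le>k. taylor f l t * taylor g (k - l) t) sums ((\<Sum>k. taylor f k t) * (\<Sum>k. taylor g k t))"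
    using f g t unfolding taylor_sums_def
    by (intro Cauchy_product_sums) (auto intro!: summable_abs_taylor)
  then have "(\<lambda>k. taylor (\<lambda>x. f x * g x) k t) sums (F * G)"
    using f g t by (simp add: taylor_sums_def taylor_mult sums_iff)
  then show ?thesis using f g by (simp add: taylor_sums_def smooth_mult taylor_le_mult)
qed

lemma taylor_sums_const: "taylor_sums t \<bar>c\<bar> (\<lambda>x. c) c"
  using sums_single[of 0 "\<lambda>_. c"] taylor_le_const[of _ c] by (simp add: taylor_sums_def taylor_const cong: if_cong)

lemma taylor_sums_power:
  assumes f: "taylor_sums t K f F" and t: "0 \<le> t" "t \<le> \<tau>"
  shows "taylor_sums t (K ^ m) (\<lambda>x. f x ^ m) (F ^ m)"
proof (induction m)
  case 0
  show ?case using taylor_sums_const[of t 1] by simp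
next
  case (Suc m)
  then show ?case using taylor_sums_mult[OF f Suc t] by simp
qed

lemma taylor_sums_prod:
  assumes "\<And>i. i \<in> A \<Longrightarrow> taylor_sums t (K i) (f i) (F i)" and t: "0 \<le> t" "t \<le> \<tau>"
  shows "taylor_sums t (\<Prod>i\<in>A. K i) (\<lambda>x. \<Prod>i\<in>A. f i x) (\<Prod>i\<in>A. F i)"
  using assms(1)
proof (induction A rule: infinite_finite_induct)
  case (insert x B)
  then show ?case
    using taylor_sums_mult[of t "K x" "f x" "F x" "\<Prod>i\<in>B. K i" "\<lambda>x. \<Prod>i\<in>B. f i x" "\<Prod>i\<in>B. F i"] t by simp
qed (use taylor_sums_const[of t 1] in simp_all)

lemma taylor_sums_monomial:
  assumes "\<And>j. taylor_sums t \<rho> (\<lambda>x. x $ j - x0 $ j) (S $ j)" and t: "0 \<le> t" "t \<le> \<tau>"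
  shows "taylor_sums t (\<rho> ^ monomial_deg \<alpha>) (\<lambda>x. monomial \<alpha> (x - x0)) (monomial \<alpha> S)"
  unfolding monomial_def prod_power_monomial_deg[symmetric] vector_minus_component
  by (intro taylor_sums_prod taylor_sums_power assms)

text \<open>An exchange of the sums over degrees and over monomials by a Weierstrass test: finite
  sums over monomials converge uniformly in the truncation degree N, because the weights
  \<open>w\<close> dominate the terms for all N at once.\<close>

lemma taylor_sums_expansion:
  assumes f: "expansion f x0 c \<rho> M" "smooth f"
    and S: "\<And>j. taylor_sums t \<rho> (\<lambda>x. x $ j - x0 $ j) (S $ j)" and t: "0 \<le> t" "t \<le> \<tau>"
    and Sb: "\<And>j. \<bar>S $ j\<bar> \<le> \<rho>"
  shows "(\<lambda>k. taylor f k t) sums f (x0 + S)"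
proof -
  have rho: "0 < \<rho>" using f by (simp add: expansion_def)
  define P where "P \<alpha> N = (\<Sum>k\<le>N. taylor (\<lambda>x. monomial \<alpha> (x - x0)) k t)" for \<alpha> :: "'n \<Rightarrow> nat" and N
  define Q where "Q N = (\<Sum>k\<le>N. taylor f k t)" for N
  define w where "w \<alpha> = \<bar>c \<alpha>\<bar> * \<rho> ^ monomial_deg \<alpha>" for \<alpha>
  have w0: "0 \<le> w \<alpha>" for \<alpha> using rho by (simp add: w_def)
  have mono: "taylor_sums t (\<rho> ^ monomial_deg \<alpha>) (\<lambda>x. monomial \<alpha> (x - x0)) (monomial \<alpha> S)" for \<alpha>
    by (rule taylor_sums_monomial[OF S t])
  have Pb: "\<bar>c \<alpha> * P \<alpha> N\<bar> \<le> w \<alpha>" for \<alpha> N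
  proof -
    have "\<bar>P \<alpha> N\<bar> \<le> (\<Sum>k\<le>N. \<bar>taylor (\<lambda>x. monomial \<alpha> (x - x0)) k t\<bar>)" unfolding P_def by (rule sum_abs)
    also have "\<dots> \<le> \<rho> ^ monomial_deg \<alpha>"
      using mono[of \<alpha>] by (intro taylor_le_abs_sum t) (simp add: taylor_sums_def)
    finally show ?thesis by (simp add: w_def abs_mult mult_left_mono)
  qed
  have P0: "P \<alpha> N = 0" if "N < monomial_deg \<alpha>" for \<alpha> N
    unfolding P_def
  proof (intro sum.neutral ballI)
    fix k assume "k \<in> {..N}"
    then show "taylor (\<lambda>x. monomial \<alpha> (x - x0)) k t = 0"
      using that by (intro taylor_vanish[OF smooth_monomial monomial_bigo[OF order_refl]]) simp
  qed
  have QP: "Q N = (\<Sum>\<alpha>\<in>{\<alpha>. monomial_deg \<alpha> \<le> N}. c \<alpha> * P \<alpha> N)" for N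
  proof -
    have "Q N = (\<Sum>k\<le>N. \<Sum>\<alpha>\<in>{\<alpha>. monomial_deg \<alpha> \<le> N}. c \<alpha> * taylor (\<lambda>x. monomial \<alpha> (x - x0)) k t)"
      unfolding Q_def by (intro sum.cong refl taylor_expansion[OF f]) simp
    also have "\<dots> = (\<Sum>\<alpha>\<in>{\<alpha>. monomial_deg \<alpha> \<le> N}. c \<alpha> * P \<alpha> N)"
      by (subst sum.swap) (simp add: P_def sum_distrib_left)
    finally show ?thesis .
  qed
  have wM: "sum w F \<le> M" if "finite F" for F using f(1) that by (simp add: expansion_def w_def)
  have "w summable_on UNIV"
    by (rule nonneg_bdd_above_summable_on) (use w0 wM in \<open>auto intro!: bdd_aboveI[of _ M]\<close>)
  then obtain s where s: "(w has_sum s) UNIV" by (auto simp: summable_on_def)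
  have unif: "uniform_limit UNIV (\<lambda>F N. \<Sum>\<alpha>\<in>F. c \<alpha> * P \<alpha> N) Q (finite_subsets_at_top UNIV)"
  proof (rule uniform_limitI)
    fix e :: real assume e: "e > 0"
    have "\<forall>\<^sub>F F in finite_subsets_at_top UNIV. s - e < sum w F"
      using s e unfolding has_sum_def by (intro order_tendstoD) auto
    moreover have "\<forall>\<^sub>F F in finite_subsets_at_top (UNIV :: ('n \<Rightarrow> nat) set). finite F"
      by (rule eventually_finite_subsets_at_top_weakI)
    ultimately show "\<forall>\<^sub>F F in finite_subsets_at_top UNIV. \<forall>N\<in>UNIV. dist (\<Sum>\<alpha>\<in>F. c \<alpha> * P \<alpha> N) (Q N) < e"
    proof eventually_elim
      case (elim F)
      show ?case
      proof
        fix N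
        let ?A = "{\<alpha> :: 'n \<Rightarrow> nat. monomial_deg \<alpha> \<le> N}"
        have fin: "finite (F \<union> ?A)" using elim finite_monomial_deg_le by blast
        \<comment> \<open>Monomials of degree above N contribute nothing up to degree N, so the
          indices of F may be added freely.\<close>
        have "Q N = (\<Sum>\<alpha>\<in>F \<union> ?A. c \<alpha> * P \<alpha> N)"
          unfolding QP by (rule sum.mono_neutral_left[OF fin]) (auto simp: P0)
        also have "\<dots> = (\<Sum>\<alpha>\<in>F. c \<alpha> * P \<alpha> N) + (\<Sum>\<alpha>\<in>?A - F. c \<alpha> * P \<alpha> N)"
          using sum.union_disjoint[of F "?A - F" "\<lambda>\<alpha>. c \<alpha> * P \<alpha> N"] fin by simp
        finally have "dist (\<Sum>\<alpha>\<in>F. c \<alpha> * P \<alpha> N) (Q N) = \<bar>\<Sum>\<alpha>\<in>?A - F. c \<alpha> * P \<alpha> N\<bar>"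
          by (simp add: dist_real_def)
        also have "\<dots> \<le> (\<Sum>\<alpha>\<in>?A - F. w \<alpha>)" by (rule order_trans[OF sum_abs sum_mono[OF Pb]])
        also have "\<dots> = sum w (F \<union> ?A) - sum w F"
          using sum.union_disjoint[of F "?A - F" w] fin by simp
        also have "\<dots> \<le> s - sum w F" using finite_sum_le_has_sum[OF s fin] w0 by simp
        also have "\<dots> < e" using elim by simp
        finally show "dist (\<Sum>\<alpha>\<in>F. c \<alpha> * P \<alpha> N) (Q N) < e" .
      qed
    qed
  qed
  have "Q \<longlonglongrightarrow> f (x0 + S)"
  proof (rule swap_uniform_limit'[OF _ _ unif])
    show "\<forall>\<^sub>F F in finite_subsets_at_top UNIV. (\<lambda>N. \<Sum>\<alpha>\<in>F. c \<alpha> * P \<alpha> N) \<longlonglongrightarrow> (\<Sum>\<alpha>\<in>F. c \<alpha> * monomial \<alpha> S)"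
    proof (intro always_eventually allI tendsto_sum tendsto_mult tendsto_const)
      fix \<alpha>
      show "P \<alpha> \<longlonglongrightarrow> monomial \<alpha> S" using mono[of \<alpha>] by (simp add: taylor_sums_def sums_def_le P_def[abs_def])
    qed
    show "((\<lambda>F. \<Sum>\<alpha>\<in>F. c \<alpha> * monomial \<alpha> S) \<longlongrightarrow> f (x0 + S)) (finite_subsets_at_top UNIV)"
      using f(1) Sb by (simp add: expansion_def has_sum_def)
  qed auto
  then show ?thesis by (simp add: sums_def_le Q_def[abs_def])
qed

end

section \<open>The expansion as the unique solution under the smallness condition\<close>

locale analytic_setting = taylor_setting \<beta> \<tau> \<kappa> d b V x0
  for \<beta> \<tau> \<kappa> :: real and d :: nat and b :: "nat \<Rightarrow> real \<Rightarrow> real"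
    and V :: "nat \<Rightarrow> real ^ 'n \<Rightarrow> real ^ 'n" and x0 :: "real ^ 'n" +
  fixes c :: "nat \<Rightarrow> 'n \<Rightarrow> ('n \<Rightarrow> nat) \<Rightarrow> real" and \<rho> M :: real
  assumes expV: "i \<le> d \<Longrightarrow> expansion (\<lambda>x. V i x $ j) x0 (c i j) (2 * \<rho>) M"
    and small: "(d + 1) * eta * M \<le> \<rho> / 4"
begin

abbreviation coord :: "'n \<Rightarrow> real ^ 'n \<Rightarrow> real" where "coord j \<equiv> \<lambda>x. x $ j - x0 $ j"

abbreviation VZ :: "(real \<Rightarrow> real ^ 'n) \<Rightarrow> 'n \<Rightarrow> nat \<Rightarrow> real \<Rightarrow> real" where
  "VZ Z j \<equiv> \<lambda>i t. V i (x0 + Z t) $ j"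

lemma rho: "0 < \<rho>"
  using expV[of 0] by (simp add: expansion_def)

lemma expV': "i \<le> d \<Longrightarrow> expansion (\<lambda>x. V i x $ j) x0 (c i j) \<rho> M"
  by (rule expansion_mono[OF expV]) (use rho in auto)

lemma smoothV_nth: "i \<le> d \<Longrightarrow> smooth (\<lambda>x. V i x $ j)"
  by (intro smooth_vec_nth smoothV)

text \<open>\<open>V i\<close> applied to a coordinate is a component of \<open>V i\<close>, which
  closes the circle between \<open>taylor_le_expansion\<close> and \<open>taylor_le_Suc\<close>. The
  same \<rho> comes back at every step, so nothing deteriorates as N grows.\<close>

lemma taylor_le_coordinate: "taylor_le N \<rho> (coord j)"
proof (induction N arbitrary: j)
  case 0
  have "taylor (coord j) 0 = (\<lambda>t. 0)" by (rule ext) (simp add: taylor_0)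
  then show ?case using hnorm_le_const[of \<beta> \<tau> 0] rho by (intro taylor_leI[of _ "\<lambda>_. 0"]) auto
next
  case (Suc N)
  have "taylor_le (Suc N) ((d + 1) * eta * M) (coord j)"
  proof (rule taylor_le_Suc)
    fix i assume "i \<le> d"
    then show "taylor_le N M (vf_apply (V i) (coord j))"
      unfolding vf_apply_coordinate by (intro taylor_le_expansion[OF expV' smoothV_nth Suc])
  qed simp
  then show ?case by (rule taylor_le_mono) (use small rho in linarith)
qed

definition taylor_limit :: "real \<Rightarrow> real ^ 'n" where
  "taylor_limit t = (\<chi> j. \<Sum>k. taylor (coord j) k t)"

lemma taylor_sums_limit:
  assumes "0 \<le> t" "t \<le> \<tau>"
  shows "taylor_sums t \<rho> (coord j) (taylor_limit t $ j)"
proof -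
  have "summable (\<lambda>k. taylor (coord j) k t)"
    using summable_abs_taylor[OF taylor_le_coordinate assms] by (rule summable_rabs_cancel)
  then show ?thesis
    by (simp add: taylor_sums_def taylor_limit_def smooth_coordinate taylor_le_coordinate summable_sums)
qed

lemma hn_partial_sums:
  assumes "taylor_le N K f"
  shows "hn K (\<lambda>t. \<Sum>k\<le>N. taylor f k t)"
proof -
  obtain a where a: "\<forall>k\<le>N. hn (a k) (taylor f k)" "(\<Sum>k\<le>N. a k) \<le> K" "\<forall>k\<le>N. 0 \<le> a k"
    by (rule taylor_leE[OF assms])
  have "hn (\<Sum>k\<le>N. a k) (\<lambda>t. \<Sum>k\<le>N. taylor f k t)" by (rule hnorm_le_sum) (use a(1) in simp)
  then show ?thesis using a(2) by (rule hnorm_le_mono)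
qed

lemma tendsto_taylor_limit:
  assumes "0 \<le> t" "t \<le> \<tau>"
  shows "(\<lambda>N. \<Sum>k\<le>N. taylor (coord j) k t) \<longlonglongrightarrow> taylor_limit t $ j"
  using taylor_sums_limit[OF assms, of j] by (simp add: taylor_sums_def sums_def_le)

lemma hn_taylor_limit: "hn \<rho> (\<lambda>t. taylor_limit t $ j)"
proof (rule hnorm_le_limit[of sequentially])
  show "\<forall>\<^sub>F N in sequentially. hn \<rho> (\<lambda>t. \<Sum>k\<le>N. taylor (coord j) k t)"
    by (intro always_eventually allI hn_partial_sums taylor_le_coordinate)
qed (simp_all add: tendsto_taylor_limit)

lemma taylor_limit_0: "taylor_limit 0 = 0"
proof -
  have "taylor (coord j) k 0 = 0" for j k by (cases k) (simp_all add: taylor_0 taylor_Suc_at_0)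
  then show ?thesis by (simp add: taylor_limit_def vec_eq_iff)
qed

lemma tendsto_VZ_taylor_limit:
  assumes "i \<le> d" "0 \<le> t" "t \<le> \<tau>"
  shows "(\<lambda>N. \<Sum>k\<le>N. taylor (\<lambda>x. V i x $ j) k t) \<longlonglongrightarrow> VZ taylor_limit j i t"
proof -
  have "\<bar>taylor_limit t $ l\<bar> \<le> \<rho>" for l
    using hnorm_le_abs[OF hn_taylor_limit] assms by simp
  then have "(\<lambda>k. taylor (\<lambda>x. V i x $ j) k t) sums VZ taylor_limit j i t"
    by (intro taylor_sums_expansion[OF expV' smoothV_nth taylor_sums_limit] assms)
  then show ?thesis by (simp add: sums_def_le)
qed

text \<open>The truncations satisfy the equation with a shift of one degree: the sum up to N + 1 is
  the integral of the fields truncated at N. These fields have norm at most \<open>M\<close>, so the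
  defects obey one bound for all N, and pointwise convergence is enough to pass to the
  limit.\<close>

lemma germ_taylor_limit: "germ (\<lambda>t. taylor_limit t $ j) (VZ taylor_limit j)"
proof (rule germI)
  fix s t assume st: "0 \<le> s" "s \<le> t" "t \<le> \<tau>"
  let ?Q = "\<lambda>N i t. \<Sum>k\<le>N. taylor (\<lambda>x. V i x $ j) k t"
  let ?P = "\<lambda>N t. \<Sum>k\<le>N. taylor (coord j) k t"
  let ?C = "(d + 1) * (young_const (2 * \<beta>) * M * \<kappa>)"
  have Q: "hn M (?Q N i)" if "i \<le> d" for N i
    using that by (intro hn_partial_sums taylor_le_expansion[OF expV' smoothV_nth taylor_le_coordinate])
  have PQ: "?P (Suc N) u = integs (?Q N) u" if u: "0 \<le> u" "u \<le> \<tau>" for N u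
  proof (rule germ_eq_integs[OF _ _ Q u])
    have "germ (\<lambda>t. \<Sum>k\<le>N. taylor (coord j) (Suc k) t) (\<lambda>i t. \<Sum>k\<le>N. taylor (vf_apply (V i) (coord j)) k t)"
      by (intro germ_sum germ_taylor)
    then show "germ (?P (Suc N)) (?Q N)"
      by (rule germ_cong) (simp_all add: sum.atMost_Suc_shift taylor_0 vf_apply_coordinate del: sum.atMost_Suc)
    show "?P (Suc N) 0 = 0"
      by (simp add: sum.atMost_Suc_shift taylor_0 taylor_Suc_at_0 del: sum.atMost_Suc)
  qed
  have lim: "(\<lambda>N. \<bar>?P (Suc N) t - ?P (Suc N) s - (\<Sum>i\<le>d. ?Q N i s * (b i t - b i s))\<bar>)
     \<longlonglongrightarrow> \<bar>taylor_limit t $ j - taylor_limit s $ j - (\<Sum>i\<le>d. VZ taylor_limit j i s * (b i t - b i s))\<bar>"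
    using st by (intro tendsto_rabs tendsto_diff tendsto_sum tendsto_mult tendsto_const
        tendsto_VZ_taylor_limit LIMSEQ_Suc[OF tendsto_taylor_limit]) auto
  show "\<bar>taylor_limit t $ j - taylor_limit s $ j - (\<Sum>i\<le>d. VZ taylor_limit j i s * (b i t - b i s))\<bar>
      \<le> ?C * (t - s) powr (2 * \<beta>)"
  proof (rule LIMSEQ_le_const2[OF lim], intro exI[of _ 0] allI impI)
    fix N
    show "\<bar>?P (Suc N) t - ?P (Suc N) s - (\<Sum>i\<le>d. ?Q N i s * (b i t - b i s))\<bar> \<le> ?C * (t - s) powr (2 * \<beta>)"
      using integs_germ_bound[OF Q st] PQ[of t] PQ[of s] st by (simp del: sum.atMost_Suc)
  qed
qed

lemma hn_solution_improve:
  assumes "\<And>j. hn \<rho> (\<lambda>t. Z t $ j)" "\<And>j. germ (\<lambda>t. Z t $ j) (VZ Z j)" "Z 0 = 0"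
  shows "hn (\<rho> / 4) (\<lambda>t. Z t $ j)"
proof -
  have V: "hn M (VZ Z j i)" if "i \<le> d" for i by (rule hn_expansion[OF expV'[OF that] assms(1)])
  have "hn (\<rho> / 4) (integs (VZ Z j))" using hn_integs[OF V] small by (rule hnorm_le_mono)
  moreover have "integs (VZ Z j) t = Z t $ j" if "0 \<le> t" "t \<le> \<tau>" for t
    using germ_eq_integs[OF assms(2) _ V that] assms(3) by simp
  ultimately show ?thesis by (rule hnorm_le_cong)
qed

text \<open>Both functions solve the equation. Their difference has norm at most
  \<open>2 * \<rho>\<close>, and each pass through the Lipschitz bound \<open>M / \<rho>\<close>
  followed by integration multiplies this by at most 1/4.\<close>

lemma solution_eq_taylor_limit:
  assumes Z: "\<And>j. hn \<rho> (\<lambda>t. Z t $ j)" and g: "\<And>j. germ (\<lambda>t. Z t $ j) (VZ Z j)" and Z0: "Z 0 = 0"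
    and t: "0 \<le> t" "t \<le> \<tau>"
  shows "Z t = taylor_limit t"
proof -
  let ?S = taylor_limit
  have step: "hn (\<delta> / 4) (\<lambda>t. Z t $ j - ?S t $ j)" if \<delta>: "\<And>j. hn \<delta> (\<lambda>t. Z t $ j - ?S t $ j)" for \<delta> j
  proof -
    let ?p = "\<lambda>i t. VZ Z j i t - VZ ?S j i t"
    have p: "hn (M / \<rho> * \<delta>) (?p i)" if "i \<le> d" for i
      by (rule hn_expansion_diff[OF expV[OF that] Z hn_taylor_limit \<delta>])
    have "germ (\<lambda>t. Z t $ j + (-1) * ?S t $ j) (\<lambda>i t. VZ Z j i t + (-1) * VZ ?S j i t)"
      by (intro germ_add germ_scale g germ_taylor_limit)
    then have gp: "germ (\<lambda>t. Z t $ j - ?S t $ j) ?p" by simp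
    have d0: "0 \<le> \<delta>" using hnorm_le_nonneg[OF \<delta> tau(1)] .
    have "(d + 1) * eta * (M / \<rho> * \<delta>) = ((d + 1) * eta * M) * (\<delta> / \<rho>)" by simp
    also have "\<dots> \<le> \<rho> / 4 * (\<delta> / \<rho>)" using small d0 rho by (intro mult_right_mono) auto
    also have "\<dots> = \<delta> / 4" using rho by simp
    finally have "hn (\<delta> / 4) (integs ?p)" using hn_integs[OF p] by (rule hnorm_le_mono[rotated])
    moreover have "integs ?p u = Z u $ j - ?S u $ j" if "0 \<le> u" "u \<le> \<tau>" for u
      using germ_eq_integs[OF gp _ p that] Z0 taylor_limit_0 by simp
    ultimately show ?thesis by (rule hnorm_le_cong)
  qed
  have all: "hn (2 * \<rho> * (1 / 4) ^ n) (\<lambda>t. Z t $ j - ?S t $ j)" for n j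
  proof (induction n arbitrary: j)
    case 0
    show ?case using hnorm_le_diff[OF Z hn_taylor_limit] by simp
  next
    case (Suc n)
    from step[OF this] show ?case by simp
  qed
  have "\<bar>Z t $ j - ?S t $ j\<bar> \<le> 0" for j
  proof (rule LIMSEQ_le_const)
    show "(\<lambda>n. 2 * \<rho> * (1 / 4) ^ n) \<longlonglongrightarrow> 0"
      using tendsto_mult_right_zero[OF LIMSEQ_power_zero[of "1/4 :: real"], of "2 * \<rho>"] by simp
    show "\<exists>N. \<forall>n\<ge>N. \<bar>Z t $ j - ?S t $ j\<bar> \<le> 2 * \<rho> * (1 / 4) ^ n"
      using hnorm_le_abs[OF all] t by auto
  qed
  then show ?thesis by (simp add: vec_eq_iff)
qed

text \<open>\<open>eta\<close> does not involve \<tau>, so the smallness condition is inherited;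
  this permits bounds to be continued over growing intervals.\<close>

lemma analytic_setting_shorter:
  assumes "0 \<le> \<sigma>" "\<sigma> \<le> \<tau>"
  shows "analytic_setting \<beta> \<sigma> \<kappa> d b V x0 c \<rho> M"
proof
  show "1 / 2 < \<beta>" "\<beta> \<le> 1" "0 \<le> \<sigma>" "\<sigma> \<le> 1" "0 \<le> \<kappa>" using beta tau kappa assms by auto
  show "holder_bound \<beta> \<sigma> \<kappa> (b i)" if "i \<le> d" for i
    by (rule holder_bound_mono_interval[OF driver[OF that] assms(2)])
  show "smooth (V i)" if "i \<le> d" for i by (rule smoothV[OF that])
  show "expansion (\<lambda>x. V i x $ j) x0 (c i j) (2 * \<rho>) M" if "i \<le> d" for i j by (rule expV[OF that])
  show "(d + 1) * eta * M \<le> \<rho> / 4" by (rule small)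
qed

lemma germ_shorter:
  assumes "germ y p" "0 \<le> \<sigma>" "\<sigma> \<le> \<tau>"
  shows "holder_driver.germ \<beta> \<sigma> d b y p"
proof -
  interpret S: analytic_setting \<beta> \<sigma> \<kappa> d b V x0 c \<rho> M by (rule analytic_setting_shorter[OF assms(2,3)])
  obtain C where "0 \<le> C" and C: "\<And>s t. 0 \<le> s \<Longrightarrow> s \<le> t \<Longrightarrow> t \<le> \<tau> \<Longrightarrow>
     defect y p s t \<le> C * (t - s) powr (2 * \<beta>)"
    by (rule germE[OF assms(1)]) (rule that)
  show ?thesis by (rule S.germI[of _ _ C]) (use C assms in auto)
qed

text \<open>Continuation in steps of length \<open>h\<close>: a surplus of Hoelder regularity keeps the norm from
  jumping over the interval \<open>(\<rho>/4, \<rho>]\<close>, which the equation excludes.\<close>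

lemma hn_solution_a_priori:
  assumes Z: "\<And>j. holder_bound \<gamma> \<tau> K (\<lambda>t. Z t $ j)" and gam: "\<beta> < \<gamma>" and K: "0 \<le> K"
    and g: "\<And>j. germ (\<lambda>t. Z t $ j) (VZ Z j)" and Z0: "Z 0 = 0"
  shows "hn \<rho> (\<lambda>t. Z t $ j)"
proof -
  \<comment> \<open>Chosen so that \<open>K * h powr (\<gamma> - \<beta>) \<le> \<rho> / 4\<close>:
    over a stretch of length h the \<beta>-seminorm of Z is at most \<open>\<rho> / 4\<close>.
    Dividing by K + 1 covers K = 0.\<close>
  define h where "h = min 1 ((\<rho> / (4 * (K + 1))) powr (1 / (\<gamma> - \<beta>)))"
  have h: "0 < h" "h \<le> 1" using rho K by (auto simp: h_def)
  have "h powr (\<gamma> - \<beta>) \<le> ((\<rho> / (4 * (K + 1))) powr (1 / (\<gamma> - \<beta>))) powr (\<gamma> - \<beta>)"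
    using gam h by (intro powr_mono2) (auto simp: h_def)
  also have "\<dots> = \<rho> / (4 * (K + 1))" using gam rho K by (simp add: powr_powr)
  finally have "K * h powr (\<gamma> - \<beta>) \<le> K * (\<rho> / (4 * (K + 1)))" using K by (rule mult_left_mono)
  also have "\<dots> = K / (K + 1) * (\<rho> / 4)" using K by simp
  also have "\<dots> \<le> 1 * (\<rho> / 4)" using K rho by (intro mult_right_mono) auto
  finally have Kh: "K * h powr (\<gamma> - \<beta>) \<le> \<rho> / 4" by simp
  have short: "\<bar>Z t $ j - Z s $ j\<bar> \<le> \<rho> / 4 * (t - s) powr \<beta>"
    if "0 \<le> s" "s \<le> t" "t \<le> \<tau>" "t - s \<le> h" for s t j
  proof -
    have "\<bar>Z t $ j - Z s $ j\<bar> \<le> K * (t - s) powr \<gamma>" using holder_boundD[OF Z, of s t j] that by auto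
    also have "(t - s) powr \<gamma> = (t - s) powr (\<gamma> - \<beta>) * (t - s) powr \<beta>" by (simp flip: powr_add)
    also have "K * \<dots> \<le> K * (h powr (\<gamma> - \<beta>) * (t - s) powr \<beta>)"
      using that K gam by (intro mult_left_mono mult_right_mono powr_mono2) auto
    also have "\<dots> \<le> \<rho> / 4 * (t - s) powr \<beta>"
      unfolding mult.assoc[symmetric] by (intro mult_right_mono Kh) simp
    finally show ?thesis .
  qed
  have step: "hnorm_le \<beta> (min \<tau> (real m * h)) (\<rho> / 4) (\<lambda>t. Z t $ j)" for m j
  proof (induction m arbitrary: j)
    case 0
    show ?case using Z0 tau rho by (intro hnorm_leI[of _ _ 0 0]) auto
  next
    case (Suc m)
    define \<sigma> \<sigma>' where "\<sigma> = min \<tau> (real m * h)" and "\<sigma>' = min \<tau> (real (Suc m) * h)"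
    have sig: "0 \<le> \<sigma>" "\<sigma> \<le> \<sigma>'" "\<sigma>' \<le> \<tau>" "\<sigma>' \<le> \<sigma> + h" "0 \<le> \<sigma>'"
      using h tau by (auto simp: \<sigma>_def \<sigma>'_def min_def algebra_simps)
    have IH: "hnorm_le \<beta> \<sigma> (\<rho> / 4) (\<lambda>t. Z t $ j)" for j using Suc by (simp add: \<sigma>_def)
    interpret S: analytic_setting \<beta> \<sigma>' \<kappa> d b V x0 c \<rho> M by (rule analytic_setting_shorter[OF sig(5,3)])
    \<comment> \<open>A further step at most doubles the bounds \<open>\<rho> / 4\<close> on
      supremum and seminorm, old part plus new part. The sum \<open>\<rho> / 2 + \<rho> / 2\<close>
      is just within reach of \<open>hn_solution_improve\<close>, which restores
      \<open>\<rho> / 4\<close>.\<close>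
    have "hnorm_le \<beta> \<sigma>' \<rho> (\<lambda>t. Z t $ j)" for j
    proof (rule hnorm_leI[of _ _ "\<rho> / 2" "\<rho> / 2"])
      fix u assume u: "0 \<le> u" "u \<le> \<sigma>'"
      show "\<bar>Z u $ j\<bar> \<le> \<rho> / 2"
      proof (cases "u \<le> \<sigma>")
        case True
        then show ?thesis using hnorm_le_abs[OF IH, of u j] u rho by simp
      next
        case False
        have "\<bar>Z u $ j - Z \<sigma> $ j\<bar> \<le> \<rho> / 4 * (u - \<sigma>) powr \<beta>" using False u sig by (intro short) auto
        also have "\<dots> \<le> \<rho> / 4 * 1" using False u sig h rho beta by (intro mult_left_mono powr_le1) auto
        finally have "\<bar>Z u $ j - Z \<sigma> $ j\<bar> \<le> \<rho> / 4" by simp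
        moreover have "\<bar>Z \<sigma> $ j\<bar> \<le> \<rho> / 4" using hnorm_le_abs[OF IH, of \<sigma> j] sig by simp
        ultimately show ?thesis by linarith
      qed
    next
      fix s t assume st: "0 \<le> s" "s < t" "t \<le> \<sigma>'"
      have old: "\<bar>Z v $ j - Z s $ j\<bar> \<le> \<rho> / 4 * (v - s) powr \<beta>" if "s \<le> v" "v \<le> \<sigma>" for v
        using holder_boundD[OF hnorm_le_holder[OF IH], of s v j] that st by auto
      have mono: "\<rho> / 4 * (v - w) powr \<beta> \<le> \<rho> / 4 * (t - s) powr \<beta>" if "s \<le> w" "w \<le> v" "v \<le> t" for v w
        using that rho beta by (intro mult_left_mono powr_mono2) auto
      have half: "\<rho> / 4 * (t - s) powr \<beta> + \<rho> / 4 * (t - s) powr \<beta> = \<rho> / 2 * (t - s) powr \<beta>" by simp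
      have nn: "0 \<le> \<rho> / 4 * (t - s) powr \<beta>" using rho by simp
      consider "t \<le> \<sigma>" | "\<sigma> \<le> s" | "s < \<sigma>" "\<sigma> < t" by linarith
      then show "\<bar>Z t $ j - Z s $ j\<bar> \<le> \<rho> / 2 * (t - s) powr \<beta>"
      proof cases
        case 1
        then show ?thesis using old[of t] st half nn by linarith
      next
        case 2
        then have "\<bar>Z t $ j - Z s $ j\<bar> \<le> \<rho> / 4 * (t - s) powr \<beta>" using st sig by (intro short) auto
        then show ?thesis using half nn by linarith
      next
        case 3
        have "\<bar>Z t $ j - Z \<sigma> $ j\<bar> \<le> \<rho> / 4 * (t - \<sigma>) powr \<beta>" using 3 st sig by (intro short) auto
        then show ?thesis using old[of \<sigma>] mono[of \<sigma> t] mono[of s \<sigma>] 3 half by linarith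
      qed
    qed (use rho in auto)
    then show ?case unfolding \<sigma>'_def[symmetric]
      by (rule S.hn_solution_improve) (use germ_shorter[OF g sig(5,3)] Z0 in auto)
  qed
  obtain m :: nat where "\<tau> / h < m" using reals_Archimedean2 by blast
  then have "\<tau> \<le> real m * h" using h by (simp add: field_simps)
  then have "hn (\<rho> / 4) (\<lambda>t. Z t $ j)" using step[of m j] by (simp add: min_def split: if_splits)
  then show ?thesis by (rule hnorm_le_mono) (use rho in simp)
qed

end

section \<open>Hoelder continuity of fractional Brownian motion\<close>

lemma dyadic_floor:
  fixes s :: real
  assumes "0 \<le> s"
  shows "real (nat \<lfloor>s * 2^n\<rfloor>) / 2^n \<le> s" and "s < real (nat \<lfloor>s * 2^n\<rfloor>) / 2^n + 1 / 2^n"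
    and tendsto_dyadic_floor: "(\<lambda>n. real (nat \<lfloor>s * 2^n\<rfloor>) / 2^n) \<longlonglongrightarrow> s"
proof -
  have fl: "real (nat \<lfloor>s * 2^n\<rfloor>) \<le> s * 2^n" "s * 2^n < real (nat \<lfloor>s * 2^n\<rfloor>) + 1" for n
    using assms by (simp_all add: of_nat_nat)
  show le: "real (nat \<lfloor>s * 2^n\<rfloor>) / 2^n \<le> s" for n using fl(1)[of n] by (simp add: divide_le_eq)
  show lt: "s < real (nat \<lfloor>s * 2^n\<rfloor>) / 2^n + 1 / 2^n" for n using fl(2)[of n] by (simp add: field_simps)
  show "(\<lambda>n. real (nat \<lfloor>s * 2^n\<rfloor>) / 2^n) \<longlonglongrightarrow> s"
  proof (rule tendsto_sandwich[of "\<lambda>n. s - (1/2) ^ n" _ _ "\<lambda>n. s"])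
    have "s - (1/2) ^ n \<le> real (nat \<lfloor>s * 2^n\<rfloor>) / 2^n" for n
      using lt[of n] unfolding power_one_over by linarith
    then show "\<forall>\<^sub>F n in sequentially. s - (1/2) ^ n \<le> real (nat \<lfloor>s * 2^n\<rfloor>) / 2^n" by simp
    show "\<forall>\<^sub>F n in sequentially. real (nat \<lfloor>s * 2^n\<rfloor>) / 2^n \<le> s" using le by simp
    have "(\<lambda>n. s - (1/2 :: real) ^ n) \<longlonglongrightarrow> s - 0" by (intro tendsto_diff tendsto_const LIMSEQ_power_zero) simp
    then show "(\<lambda>n. s - (1/2) ^ n) \<longlonglongrightarrow> s" by simp
  qed simp
qed

text \<open>Chaining, the deterministic half of the Kolmogorov-Chentsov theorem: s and t are joined
  to their dyadic approximations on the level comparable with t - s at the cost of geometric series,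
  and these approximations are equal or adjacent.\<close>

lemma holder_bound_dyadic:
  assumes cont: "continuous_on {0..1} f" and beta: "0 < \<beta>" and K: "0 \<le> K"
    and dy: "\<And>n j. j < 2^n \<Longrightarrow> \<bar>f ((real j + 1) / 2^n) - f (real j / 2^n)\<bar> \<le> K * (1 / 2^n) powr \<beta>"
  shows "\<exists>L\<ge>0. holder_bound \<beta> 1 L f"
proof -
  define q :: real where "q = 2 powr (- \<beta>)"
  have q: "0 < q" "q < 1" using beta by (simp_all add: q_def powr_less_one)
  have qn: "(1 / 2^n) powr \<beta> = q ^ n" for n
    by (simp add: q_def powr_minus_divide powr_divide powr_realpow[symmetric] powr_powr power_one_over[symmetric] mult.commute)
  define p where "p n s = real (nat \<lfloor>s * 2^n\<rfloor>) / 2^n" for n and s :: real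
  have fl: "real (nat \<lfloor>s * 2^n\<rfloor>) \<le> s * 2^n" "s * 2^n < real (nat \<lfloor>s * 2^n\<rfloor>) + 1" if "0 \<le> s" for s :: real and n :: nat
    using that by (simp_all add: of_nat_nat)
  have ps: "0 \<le> p n s" "p n s \<le> s" "s < p n s + 1 / 2^n" if "0 \<le> s" for s n
    using fl[OF that, of n] by (simp_all add: p_def field_simps)
  have pstep: "\<bar>f (p (Suc n) s) - f (p n s)\<bar> \<le> K * q ^ Suc n" if s: "0 \<le> s" "s \<le> 1" for s n
  proof -
    define m where "m = nat \<lfloor>s * 2^n\<rfloor>"
    define m' where "m' = nat \<lfloor>s * 2^Suc n\<rfloor>"
    have "real m \<le> s * 2^n" "s * 2^n < real m + 1" "real m' \<le> 2 * (s * 2^n)" "2 * (s * 2^n) < real m' + 1"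
      using fl[OF s(1), of n] fl[OF s(1), of "Suc n"] by (simp_all add: m_def m'_def mult_ac)
    then have "2 * real m < real m' + 1" "real m' < 2 * real m + 2" by linarith+
    then have "m' = 2 * m \<or> m' = 2 * m + 1" by linarith
    then show ?thesis
    proof
      assume "m' = 2 * m"
      then have "p (Suc n) s = p n s" unfolding p_def m_def[symmetric] m'_def[symmetric] by simp
      then show ?thesis using K q by simp
    next
      assume m': "m' = 2 * m + 1"
      have "real m' \<le> s * 2^Suc n" using fl[OF s(1), of "Suc n"] by (simp add: m'_def)
      also have "\<dots> \<le> 1 * 2^Suc n" using s by (intro mult_right_mono) auto
      finally have "real m' \<le> real (2^Suc n)" by simp
      then have "2 * m < 2^Suc n" using m' unfolding of_nat_le_iff by linarith
      from dy[OF this] have "\<bar>f ((real (2 * m) + 1) / 2^Suc n) - f (real (2 * m) / 2^Suc n)\<bar> \<le> K * q ^ Suc n"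
        by (simp only: qn)
      moreover have "p (Suc n) s = (real (2 * m) + 1) / 2^Suc n" unfolding p_def m'_def[symmetric] m' by simp
      moreover have "p n s = real (2 * m) / 2^Suc n" by (simp add: p_def m_def[symmetric])
      ultimately show ?thesis by simp
    qed
  qed
  \<comment> \<open>The sum of the geometric series \<open>K * q ^ k\<close>, so that the increments
    from level m on add up to at most \<open>R * q ^ m\<close>.\<close>
  define R where "R = K / (1 - q)"
  have R: "0 \<le> R" using K q by (simp add: R_def)
  have tail: "\<bar>f (p (m + k) s) - f (p m s)\<bar> \<le> R * (q ^ m - q ^ (m + k))" if s: "0 \<le> s" "s \<le> 1" for s m k
  proof (induction k)
    case (Suc k)
    have "K * q ^ Suc (m + k) \<le> K * q ^ (m + k)" using q K by (intro mult_left_mono) (auto simp: mult_left_le_one_le)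
    also have "K = R * (1 - q)" using q by (simp add: R_def)
    also have "R * (1 - q) * q ^ (m + k) = R * (q ^ (m + k) - q ^ Suc (m + k))" by (simp add: algebra_simps)
    finally have "\<bar>f (p (Suc (m + k)) s) - f (p (m + k) s)\<bar> \<le> R * (q ^ (m + k) - q ^ Suc (m + k))"
      using pstep[OF s, of "m + k"] q by (simp add: R_def)
    then show ?case using Suc by (simp add: right_diff_distrib)
  qed simp
  have plim: "(\<lambda>k. p (m + k) s) \<longlonglongrightarrow> s" if s: "0 \<le> s" for s m
    using LIMSEQ_ignore_initial_segment[OF tendsto_dyadic_floor[OF s], of m] by (simp add: p_def add.commute)
  have near: "\<bar>f s - f (p m s)\<bar> \<le> R * q ^ m" if s: "0 \<le> s" "s \<le> 1" for s m
  proof -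
    have "(\<lambda>k. f (p (m + k) s)) \<longlonglongrightarrow> f s"
      by (rule continuous_on_tendsto_compose[OF cont plim[OF s(1)]])
        (use s ps[OF s(1)] in \<open>auto intro!: always_eventually intro: order_trans\<close>)
    then have "(\<lambda>k. \<bar>f (p (m + k) s) - f (p m s)\<bar>) \<longlonglongrightarrow> \<bar>f s - f (p m s)\<bar>" by (intro tendsto_intros)
    then show ?thesis
    proof (rule LIMSEQ_le_const2, intro exI[of _ 0] allI impI)
      fix k
      have "R * (q ^ m - q ^ (m + k)) \<le> R * q ^ m" using R q by (intro mult_left_mono) auto
      then show "\<bar>f (p (m + k) s) - f (p m s)\<bar> \<le> R * q ^ m" using tail[OF s, of m k] by linarith
    qed
  qed
  have main: "\<bar>f t - f s\<bar> \<le> (K + 2 * R) * 2 powr \<beta> * (t - s) powr \<beta>" if st: "0 \<le> s" "s < t" "t \<le> 1" for s t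
  proof -
    obtain m where m: "t - s \<le> 1 / 2^m" "1 / 2^m < 2 * (t - s)" using ex_dyadic_scale[of "t - s"] st by auto
    define a where "a = nat \<lfloor>s * 2^m\<rfloor>"
    define c where "c = nat \<lfloor>t * 2^m\<rfloor>"
    have ac: "real a \<le> s * 2^m" "s * 2^m < real a + 1" "real c \<le> t * 2^m" "t * 2^m < real c + 1"
      using fl[of s m] fl[of t m] st by (simp_all add: a_def c_def)
    have "t * 2^m \<le> s * 2^m + 1" "s * 2^m < t * 2^m" using m(1) st by (simp_all add: field_simps)
    then have "real a < real c + 1" "real c < real a + 2" using ac by linarith+
    then have "c = a \<or> c = Suc a" by linarith
    then have mid: "\<bar>f (p m t) - f (p m s)\<bar> \<le> K * q ^ m"
    proof
      assume "c = a"
      then show ?thesis using K q by (simp add: p_def a_def c_def)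
    next
      assume c: "c = Suc a"
      have "t * 2^m \<le> 1 * 2^m" using st by (intro mult_right_mono) auto
      then have "real c \<le> 2^m" using ac(3) by linarith
      then have "c \<le> 2^m" by simp
      then have "a < 2^m" using c by simp
      from dy[OF this] show ?thesis unfolding qn p_def a_def[symmetric] c_def[symmetric] c by (simp add: add.commute)
    qed
    have "\<bar>f t - f s\<bar> \<le> (K + 2 * R) * q ^ m"
      using mid near[of t m] near[of s m] st by (simp add: distrib_right)
    also have "\<dots> \<le> (K + 2 * R) * (2 * (t - s)) powr \<beta>"
      unfolding qn[symmetric] using m K R beta by (intro mult_left_mono powr_mono2) auto
    also have "\<dots> = (K + 2 * R) * 2 powr \<beta> * (t - s) powr \<beta>" using powr_mult[of 2 "t - s" \<beta>] st by simp
    finally show ?thesis .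
  qed
  have "holder_bound \<beta> 1 ((K + 2 * R) * 2 powr \<beta>) f" by (rule holder_boundI[OF main])
  then show ?thesis using K R by (intro exI[of _ "(K + 2 * R) * 2 powr \<beta>"]) auto
qed

text \<open>The quotient of factorials is the double factorial of 2m - 1. A constant variable is
  treated separately: having mean 0 it vanishes almost surely, and the formula holds with
  \<open>0 ^ 0 = 1\<close> for m = 0.\<close>

lemma gaussian_rv_moments:
  assumes "prob_space M" and Y: "gaussian_rv M Y" and EY: "(\<integral>\<omega>. Y \<omega> \<partial>M) = 0"
  shows "integrable M (\<lambda>\<omega>. Y \<omega> ^ k)"
    and "(\<integral>\<omega>. Y \<omega> ^ (2 * m) \<partial>M) = fact (2 * m) / (2 ^ m * fact m) * (\<integral>\<omega>. (Y \<omega>)\<^sup>2 \<partial>M) ^ m"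
proof -
  interpret prob_space M by fact
  have meas: "Y \<in> borel_measurable M" using Y by (simp add: gaussian_rv_def)
  have "(\<exists>\<mu>. AE \<omega> in M. Y \<omega> = \<mu>) \<or> (\<exists>\<mu> \<sigma>. \<sigma> > 0 \<and> distributed M lborel Y (\<lambda>x. ennreal (normal_density \<mu> \<sigma> x)))"
    using Y by (simp add: gaussian_rv_def)
  then have "integrable M (\<lambda>\<omega>. Y \<omega> ^ k) \<and> (\<integral>\<omega>. Y \<omega> ^ (2 * m) \<partial>M) = fact (2 * m) / (2 ^ m * fact m) * (\<integral>\<omega>. (Y \<omega>)\<^sup>2 \<partial>M) ^ m"
  proof
    assume "\<exists>\<mu>. AE \<omega> in M. Y \<omega> = \<mu>"
    then obtain \<mu> where mu: "AE \<omega> in M. Y \<omega> = \<mu>" by blast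
    have "(\<integral>\<omega>. Y \<omega> \<partial>M) = (\<integral>\<omega>. \<mu> \<partial>M)" using mu meas by (intro integral_cong_AE) auto
    then have "\<mu> = 0" using EY by (simp add: prob_space)
    then have Y0: "AE \<omega> in M. Y \<omega> = 0" using mu by simp
    have pw: "AE \<omega> in M. Y \<omega> ^ l = 0 ^ l" for l using Y0 by eventually_elim simp
    have int: "(\<integral>\<omega>. Y \<omega> ^ l \<partial>M) = 0 ^ l" for l
    proof -
      have "(\<integral>\<omega>. Y \<omega> ^ l \<partial>M) = (\<integral>\<omega>. 0 ^ l \<partial>M)" using pw meas by (intro integral_cong_AE) auto
      then show ?thesis by (simp add: prob_space)
    qed
    have "integrable M (\<lambda>\<omega>. Y \<omega> ^ k) \<longleftrightarrow> integrable M (\<lambda>\<omega>. 0 ^ k :: real)"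
      using pw meas by (intro integrable_cong_AE) auto
    moreover have "(\<integral>\<omega>. Y \<omega> ^ (2 * m) \<partial>M) = fact (2 * m) / (2 ^ m * fact m) * (\<integral>\<omega>. (Y \<omega>)\<^sup>2 \<partial>M) ^ m"
      unfolding int by (cases m) simp_all
    ultimately show ?thesis by simp
  next
    assume "\<exists>\<mu> \<sigma>. \<sigma> > 0 \<and> distributed M lborel Y (\<lambda>x. ennreal (normal_density \<mu> \<sigma> x))"
    then obtain \<mu> \<sigma> where sig: "\<sigma> > 0" and D: "distributed M lborel Y (\<lambda>x. ennreal (normal_density \<mu> \<sigma> x))" by blast
    have E: "(\<integral>x. normal_density \<mu> \<sigma> x * g x \<partial>lborel) = (\<integral>\<omega>. g (Y \<omega>) \<partial>M)" if "g \<in> borel_measurable lborel" for g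
      by (rule distributed_integral[OF D that]) simp
    have "\<mu> = 0" using E[of "\<lambda>x. x"] EY integral_normal_moment_nz_1[OF sig, of \<mu>] by simp
    have mom: "(\<integral>\<omega>. Y \<omega> ^ (2 * l) \<partial>M) = fact (2 * l) / ((2 / \<sigma>\<^sup>2) ^ l * fact l)" for l
      using E[of "\<lambda>x. x ^ (2 * l)"] integral_normal_moment_even[OF sig, of 0 l] \<open>\<mu> = 0\<close> by simp
    have int: "integrable M (\<lambda>\<omega>. Y \<omega> ^ k)"
      using distributed_integrable[OF D, of "\<lambda>x. x ^ k"] integrable_normal_moment[OF sig, of 0 k] \<open>\<mu> = 0\<close> by simp
    have "(\<integral>\<omega>. (Y \<omega>)\<^sup>2 \<partial>M) = \<sigma>\<^sup>2" using mom[of 1] sig by (simp add: fact_2)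
    then show ?thesis using int mom[of m] by (simp add: power_divide)
  qed
  then show "integrable M (\<lambda>\<omega>. Y \<omega> ^ k)"
    "(\<integral>\<omega>. Y \<omega> ^ (2 * m) \<partial>M) = fact (2 * m) / (2 ^ m * fact m) * (\<integral>\<omega>. (Y \<omega>)\<^sup>2 \<partial>M) ^ m" by auto
qed

text \<open>The increment is a Gaussian linear combination, so its variance, computed from the
  covariances, fixes the even moments. Integrability of the product \<open>Z t * Z s\<close> comes
  first, since the integral of a nonintegrable function is 0 by convention and linearity would
  fail.\<close>

lemma fbm_increment_moments:
  assumes "prob_space M" and G: "gaussian_process M Z" and m0: "\<And>t. 0 \<le> t \<Longrightarrow> (\<integral>\<omega>. Z t \<omega> \<partial>M) = 0"
    and cov: "\<And>s t. 0 \<le> t \<Longrightarrow> 0 \<le> s \<Longrightarrow> (\<integral>\<omega>. Z t \<omega> * Z s \<omega> \<partial>M) = fbm_cov H t s"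
    and st: "0 \<le> s" "s < t"
  shows "integrable M (\<lambda>\<omega>. (Z t \<omega> - Z s \<omega>) ^ k)"
    and "(\<integral>\<omega>. (Z t \<omega> - Z s \<omega>) ^ (2 * m) \<partial>M) = fact (2 * m) / (2 ^ m * fact m) * ((t - s) powr (2 * H)) ^ m"
proof -
  interpret prob_space M by fact
  have g1: "gaussian_rv M (Z u)" if "0 \<le> u" for u
    using G[unfolded gaussian_process_def, rule_format, of "{u}" "\<lambda>_. 1"] that by simp
  have "gaussian_rv M (\<lambda>\<omega>. \<Sum>u\<in>{s, t}. (if u = t then 1 else -1) * Z u \<omega>)"
    using G[unfolded gaussian_process_def, rule_format, of "{s, t}" "\<lambda>u. if u = t then 1 else -1"] st by simp
  then have gd: "gaussian_rv M (\<lambda>\<omega>. Z t \<omega> - Z s \<omega>)" using st by simp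
  have meas: "Z u \<in> borel_measurable M" if "0 \<le> u" for u using g1[OF that] by (simp add: gaussian_rv_def)
  have t0: "0 \<le> t" using st by simp
  have pw: "integrable M (\<lambda>\<omega>. Z u \<omega> ^ l)" if "0 \<le> u" for u l
    by (rule gaussian_rv_moments(1)[OF \<open>prob_space M\<close> g1[OF that] m0[OF that]])
  have int1: "integrable M (Z u)" if "0 \<le> u" for u using pw[OF that, of 1] by simp
  have int2: "integrable M (\<lambda>\<omega>. Z t \<omega> * Z s \<omega>)"
  proof (rule Bochner_Integration.integrable_bound)
    show "integrable M (\<lambda>\<omega>. (Z t \<omega>)\<^sup>2 + (Z s \<omega>)\<^sup>2)" using pw st t0 by (intro Bochner_Integration.integrable_add) auto
    show "(\<lambda>\<omega>. Z t \<omega> * Z s \<omega>) \<in> borel_measurable M" using meas st t0 by (intro borel_measurable_times) auto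
    show "AE \<omega> in M. norm (Z t \<omega> * Z s \<omega>) \<le> norm ((Z t \<omega>)\<^sup>2 + (Z s \<omega>)\<^sup>2)"
    proof (rule AE_I2)
      fix \<omega>
      have "2 * (\<bar>Z t \<omega>\<bar> * \<bar>Z s \<omega>\<bar>) \<le> (Z t \<omega>)\<^sup>2 + (Z s \<omega>)\<^sup>2"
        using sum_squares_bound[of "\<bar>Z t \<omega>\<bar>" "\<bar>Z s \<omega>\<bar>"] by (simp add: mult.assoc)
      moreover have "0 \<le> \<bar>Z t \<omega>\<bar> * \<bar>Z s \<omega>\<bar>" by simp
      ultimately show "norm (Z t \<omega> * Z s \<omega>) \<le> norm ((Z t \<omega>)\<^sup>2 + (Z s \<omega>)\<^sup>2)"
        unfolding real_norm_def abs_mult by linarith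
    qed
  qed
  have EY: "(\<integral>\<omega>. Z t \<omega> - Z s \<omega> \<partial>M) = 0"
    using int1 st t0 m0 by simp
  have "(\<integral>\<omega>. (Z t \<omega> - Z s \<omega>)\<^sup>2 \<partial>M) = (\<integral>\<omega>. Z t \<omega> * Z t \<omega> - 2 * (Z t \<omega> * Z s \<omega>) + Z s \<omega> * Z s \<omega> \<partial>M)"
    by (intro Bochner_Integration.integral_cong) (auto simp: power2_eq_square algebra_simps)
  also have "\<dots> = fbm_cov H t t - 2 * fbm_cov H t s + fbm_cov H s s"
    using pw[of t 2] pw[of s 2] int2 st t0 cov by (simp add: power2_eq_square)
  also have "\<dots> = (t - s) powr (2 * H)" using st by (simp add: fbm_cov_def field_simps)
  finally have var: "(\<integral>\<omega>. (Z t \<omega> - Z s \<omega>)\<^sup>2 \<partial>M) = (t - s) powr (2 * H)" .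
  show "integrable M (\<lambda>\<omega>. (Z t \<omega> - Z s \<omega>) ^ k)"
    by (rule gaussian_rv_moments(1)[OF \<open>prob_space M\<close> gd EY])
  show "(\<integral>\<omega>. (Z t \<omega> - Z s \<omega>) ^ (2 * m) \<partial>M) = fact (2 * m) / (2 ^ m * fact m) * ((t - s) powr (2 * H)) ^ m"
    using gaussian_rv_moments(2)[OF \<open>prob_space M\<close> gd EY] by (simp only: var)
qed

text \<open>Kolmogorov's argument: the sum over all dyadic increments of their \<open>2m\<close>-th powers, scaled by
  \<open>2\<^bsup>2m\<gamma>n\<^esup>\<close> on level \<open>n\<close>, has finite expectation once \<open>2m (H - \<gamma>) > 1\<close>.\<close>

lemma fbm_holder:
  assumes "prob_space M" and G: "gaussian_process M Z" and m0: "\<And>t. 0 \<le> t \<Longrightarrow> (\<integral>\<omega>. Z t \<omega> \<partial>M) = 0"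
    and cov: "\<And>s t. 0 \<le> t \<Longrightarrow> 0 \<le> s \<Longrightarrow> (\<integral>\<omega>. Z t \<omega> * Z s \<omega> \<partial>M) = fbm_cov H t s"
    and cont: "AE \<omega> in M. continuous_on {0..} (\<lambda>t. Z t \<omega>)" and gam: "0 < \<gamma>" "\<gamma> < H"
  shows "AE \<omega> in M. \<exists>K\<ge>0. holder_bound \<gamma> 1 K (\<lambda>t. Z t \<omega>)"
proof -
  interpret prob_space M by fact
  \<comment> \<open>High moments buy exponents close to H: once
    \<open>2 * m * (H - \<gamma>) > 1\<close>, the ratio \<open>q\<close> below is less than
    1.\<close>
  obtain m :: nat where m: "1 / (2 * (H - \<gamma>)) < m" using reals_Archimedean2 by blast
  have m1: "1 < 2 * real m * (H - \<gamma>)" using m gam by (simp add: field_simps)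
  have mpos: "m > 0" using m1 gam by (cases m) auto
  define \<Delta> where "\<Delta> n j \<omega> = Z ((real j + 1) / 2^n) \<omega> - Z (real j / 2^n) \<omega>" for n j \<omega>
  define w where "w n = 2 powr (2 * m * \<gamma> * n)" for n :: nat
  define W where "W n j \<omega> = w n * \<Delta> n j \<omega> ^ (2 * m)" for n j \<omega>
  define C where "C = fact (2 * m) / (2 ^ m * fact m :: real)"
  \<comment> \<open>The number \<open>2^n\<close> of increments, their moments of order
    \<open>2 powr (- 2 * m * H * n)\<close> and the weight \<open>w n\<close> multiply to
    \<open>q ^ n\<close>.\<close>
  define q where "q = 2 powr (1 - 2 * m * (H - \<gamma>))"
  have q: "0 < q" "q < 1" using m1 by (simp_all add: q_def powr_less_one)
  have C: "0 \<le> C" by (simp add: C_def)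
  have w: "0 < w n" for n by (simp add: w_def)
  have W0: "0 \<le> W n j \<omega>" for n j \<omega> using w[of n] by (simp add: W_def power_mult)
  have lt: "real j / 2^n < (real j + 1) / 2^n" for j n by (simp add: divide_strict_right_mono)
  have Wint: "integrable M (W n j)" for n j
    unfolding W_def \<Delta>_def
    by (intro integrable_mult_right fbm_increment_moments(1)[OF \<open>prob_space M\<close> G m0 cov _ lt]) auto
  have EW: "(\<integral>\<omega>. W n j \<omega> \<partial>M) = C * q ^ n / 2 ^ n" for n j
  proof -
    have "(\<integral>\<omega>. W n j \<omega> \<partial>M) = w n * (C * (((real j + 1) / 2^n - real j / 2^n) powr (2 * H)) ^ m)"
      unfolding W_def \<Delta>_def C_def
      using fbm_increment_moments(2)[OF \<open>prob_space M\<close> G m0 cov _ lt, of j n m] by simp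
    also have "(real j + 1) / 2^n - real j / 2^n = 2 powr (- real n)"
      by (simp add: powr_minus_divide powr_realpow diff_divide_distrib[symmetric])
    also have "((2 powr (- real n)) powr (2 * H)) ^ m = 2 powr (- real n * (2 * H) * m)"
      by (simp only: powr_powr powr_realpow[symmetric] powr_gt_zero)
    also have "w n * (C * 2 powr (- real n * (2 * H) * m)) = C * 2 powr (2 * m * \<gamma> * n + (- real n * (2 * H) * m))"
      unfolding w_def powr_add by (simp only: mult_ac)
    also have "2 * m * \<gamma> * n + (- real n * (2 * H) * m) = (1 - 2 * m * (H - \<gamma>)) * n - n" by (simp add: algebra_simps)
    also have "2 powr \<dots> = q ^ n / 2 ^ n" by (simp add: powr_diff q_def powr_powr[symmetric] powr_realpow)
    finally show ?thesis by simp
  qed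
  let ?T = "\<lambda>\<omega>. \<Sum>n. \<Sum>j<2^n. ennreal (W n j \<omega>)"
  have Wm: "(\<lambda>\<omega>. ennreal (W n j \<omega>)) \<in> borel_measurable M" for n j
    using borel_measurable_integrable[OF Wint[of n j]] by simp
  have "(\<integral>\<^sup>+\<omega>. ?T \<omega> \<partial>M) = (\<Sum>n. \<Sum>j<2^n. \<integral>\<^sup>+\<omega>. ennreal (W n j \<omega>) \<partial>M)"
    by (subst nn_integral_suminf) (auto intro!: borel_measurable_sum Wm simp: nn_integral_sum Wm)
  also have "\<dots> = (\<Sum>n. ennreal (C * q ^ n))"
  proof (intro suminf_cong)
    fix n
    have "(\<integral>\<^sup>+\<omega>. ennreal (W n j \<omega>) \<partial>M) = ennreal (C * q ^ n / 2 ^ n)" for j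
      unfolding EW[symmetric, of n j] by (rule nn_integral_eq_integral[OF Wint]) (simp add: W0)
    then have "(\<Sum>j<2^n. \<integral>\<^sup>+\<omega>. ennreal (W n j \<omega>) \<partial>M) = (\<Sum>j<(2::nat)^n. ennreal (C * q ^ n / 2 ^ n))" by simp
    also have "\<dots> = ennreal (\<Sum>j<(2::nat)^n. C * q ^ n / 2 ^ n)" using C q by (intro sum_ennreal) auto
    finally show "(\<Sum>j<2^n. \<integral>\<^sup>+\<omega>. ennreal (W n j \<omega>) \<partial>M) = ennreal (C * q ^ n)" by simp
  qed
  also have "\<dots> = ennreal (\<Sum>n. C * q ^ n)"
    using C q by (intro suminf_ennreal2) (auto intro!: summable_mult summable_geometric)
  finally have "(\<integral>\<^sup>+\<omega>. ?T \<omega> \<partial>M) \<noteq> \<infinity>" by simp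
  then have "AE \<omega> in M. ?T \<omega> \<noteq> \<infinity>"
    by (intro nn_integral_PInf_AE borel_measurable_suminf_order borel_measurable_sum Wm)
  then show ?thesis using cont
  proof eventually_elim
    case (elim \<omega>)
    \<comment> \<open>A finite sum of nonnegative terms dominates each term, so on this path the
      increments of level n are at most \<open>(L / w n) powr (1 / (2 * m))\<close>, as the chaining
      lemma demands.\<close>
    define L where "L = enn2real (?T \<omega>)"
    have L: "0 \<le> L" "ennreal L = ?T \<omega>" using elim(1) by (simp_all add: L_def less_top)
    have WL: "W n j \<omega> \<le> L" if "j < 2^n" for n j
    proof -
      have "ennreal (W n j \<omega>) \<le> (\<Sum>j<2^n. ennreal (W n j \<omega>))"
        using that by (intro member_le_sum) auto
      also have "\<dots> \<le> ?T \<omega>"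
        using sum_le_suminf[of "\<lambda>n. \<Sum>j<2^n. ennreal (W n j \<omega>)" "{n}"] by simp
      finally show ?thesis unfolding L(2)[symmetric] using L(1) by simp
    qed
    show ?case
    proof (rule holder_bound_dyadic[OF _ gam(1)])
      show "continuous_on {0..1} (\<lambda>t. Z t \<omega>)" by (rule continuous_on_subset[OF elim(2)]) auto
      show "0 \<le> L powr (1 / (2 * m))" by simp
      fix n j :: nat assume j: "j < 2^n"
      have wr: "w n powr (1 / (2 * m)) = 2 powr (\<gamma> * n)" using mpos by (simp add: w_def powr_powr)
      have "\<bar>\<Delta> n j \<omega>\<bar> powr (2 * m) = \<Delta> n j \<omega> ^ (2 * m)"
        using mpos by (cases "\<Delta> n j \<omega> = 0") (simp_all add: powr_realpow[symmetric] flip: power_even_abs[of "2 * m" "\<Delta> n j \<omega>"])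
      also have "\<dots> \<le> L / w n" using WL[OF j] w[of n] by (simp add: W_def field_simps)
      finally have "(\<bar>\<Delta> n j \<omega>\<bar> powr (2 * m)) powr (1 / (2 * m)) \<le> (L / w n) powr (1 / (2 * m))"
        by (intro powr_mono2) auto
      then have "\<bar>\<Delta> n j \<omega>\<bar> \<le> (L / w n) powr (1 / (2 * m))" using mpos by (simp add: powr_powr)
      also have "\<dots> = L powr (1 / (2 * m)) * (1 / 2^n) powr \<gamma>"
        using L(1) w[of n] wr by (simp add: powr_divide powr_powr powr_realpow[symmetric] mult.commute)
      finally show "\<bar>Z ((real j + 1) / 2^n) \<omega> - Z (real j / 2^n) \<omega>\<bar> \<le> L powr (1 / (2 * m)) * (1 / 2^n) powr \<gamma>"
        by (simp add: \<Delta>_def)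
    qed
  qed
qed

section \<open>Identification with the solution\<close>

text \<open>The box of half-width r lies in the ball of radius r0. Evaluated at the corner with all
  coordinates equal to r, the unconditionally summable real series becomes absolutely summable at
  radius r. Adding these sums over the components gives one \<open>M\<close> for all of
  them.\<close>

lemma real_analytic_on_expansion:
  fixes f :: "real ^ 'n \<Rightarrow> real ^ 'n"
  assumes "real_analytic_on f S" "x0 \<in> S"
  shows "\<exists>r>0. \<exists>c M. 0 \<le> M \<and> (\<forall>j. expansion (\<lambda>x. f x $ j) x0 (\<lambda>\<alpha>. c \<alpha> $ j) r M)"
proof -
  obtain r0 and c :: "('n \<Rightarrow> nat) \<Rightarrow> real ^ 'n" where r0: "r0 > 0" and hs0: "\<And>x. x \<in> ball x0 r0 \<Longrightarrow>
      ((\<lambda>\<alpha>. (\<Prod>i\<in>UNIV. (x $ i - x0 $ i) ^ \<alpha> i) *\<^sub>R c \<alpha>) has_sum f x) UNIV"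
    using assms unfolding real_analytic_on_def by blast
  define r where "r = r0 / (2 * CARD('n))"
  have r: "r > 0" using r0 by (simp add: r_def)
  have hs: "((\<lambda>\<alpha>. c \<alpha> $ j * monomial \<alpha> y) has_sum f (x0 + y) $ j) UNIV" if y: "\<forall>i. \<bar>y $ i\<bar> \<le> r" for y j
  proof -
    have "norm y \<le> (\<Sum>i\<in>UNIV. \<bar>y $ i\<bar>)" by (rule norm_le_l1_cart)
    also have "\<dots> \<le> (\<Sum>i\<in>(UNIV :: 'n set). r)" using y by (intro sum_mono) auto
    also have "\<dots> < r0" using r0 by (simp add: r_def)
    finally have "x0 + y \<in> ball x0 r0" by (simp add: dist_norm)
    from has_sum_bounded_linear[OF bounded_linear_vec_nth hs0[OF this], of j]
    show ?thesis by (simp add: monomial_def mult.commute)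
  qed
  have sm: "(\<lambda>\<alpha>. \<bar>c \<alpha> $ j\<bar> * r ^ monomial_deg \<alpha>) summable_on UNIV" for j
  proof -
    have "\<forall>i. \<bar>(\<chi> i. r) $ i\<bar> \<le> r" using r by simp
    note h = hs[OF this, of j]
    have "monomial \<alpha> (\<chi> i. r) = r ^ monomial_deg \<alpha>" for \<alpha> :: "'n \<Rightarrow> nat"
      by (simp add: monomial_def prod_power_monomial_deg)
    with h have "((\<lambda>\<alpha>. c \<alpha> $ j * r ^ monomial_deg \<alpha>) has_sum f (x0 + (\<chi> i. r)) $ j) UNIV" by simp
    then have "(\<lambda>\<alpha>. c \<alpha> $ j * r ^ monomial_deg \<alpha>) summable_on UNIV" by (rule has_sum_imp_summable)
    then have "(\<lambda>\<alpha>. norm (c \<alpha> $ j * r ^ monomial_deg \<alpha>)) summable_on UNIV"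
      by (rule summable_on_iff_abs_summable_on_real[THEN iffD1])
    then show ?thesis using r by (simp add: abs_mult)
  qed
  define M where "M = (\<Sum>j\<in>UNIV. infsum (\<lambda>\<alpha>. \<bar>c \<alpha> $ j\<bar> * r ^ monomial_deg \<alpha>) UNIV)"
  have nn: "0 \<le> infsum (\<lambda>\<alpha>. \<bar>c \<alpha> $ j\<bar> * r ^ monomial_deg \<alpha>) UNIV" for j
    using r by (intro infsum_nonneg) simp
  have M: "(\<Sum>\<alpha>\<in>F. \<bar>c \<alpha> $ j\<bar> * r ^ monomial_deg \<alpha>) \<le> M" if "finite F" for F j
  proof -
    have "(\<Sum>\<alpha>\<in>F. \<bar>c \<alpha> $ j\<bar> * r ^ monomial_deg \<alpha>) \<le> infsum (\<lambda>\<alpha>. \<bar>c \<alpha> $ j\<bar> * r ^ monomial_deg \<alpha>) UNIV"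
      using r by (intro finite_sum_le_infsum sm that) auto
    also have "\<dots> \<le> M" unfolding M_def using nn by (intro member_le_sum) auto
    finally show ?thesis .
  qed
  have "0 \<le> M" unfolding M_def using nn by (rule sum_nonneg)
  moreover have "\<forall>j. expansion (\<lambda>x. f x $ j) x0 (\<lambda>\<alpha>. c \<alpha> $ j) r M"
    using r M hs by (simp add: expansion_def)
  ultimately show ?thesis using r by blast
qed

text \<open>If the exponents add up to more than 1, the indefinite integral inherits the exponent of
  the integrator, however small that of the integrand: the leading term
  \<open>f s * (g t - g s)\<close> has it, and the error is of higher order.\<close>

lemma young_integral_holder:
  assumes ab: "\<alpha> + \<gamma> > 1" "0 \<le> \<alpha>" "0 \<le> \<gamma>" and nn: "0 \<le> a" "0 \<le> K" "0 \<le> F" and tau: "0 \<le> \<tau>" "\<tau> \<le> 1"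
    and f: "holder_bound \<alpha> \<tau> a f" and g: "holder_bound \<gamma> \<tau> K g"
    and F: "\<And>s. 0 \<le> s \<Longrightarrow> s \<le> \<tau> \<Longrightarrow> \<bar>f s\<bar> \<le> F"
    and I: "\<And>t. 0 \<le> t \<Longrightarrow> t \<le> \<tau> \<Longrightarrow> has_young_integral f g 0 t (I t)"
  shows "holder_bound \<gamma> \<tau> (F * K + young_const (\<alpha> + \<gamma>) * a * K) I"
proof -
  obtain y where y: "\<And>s t. 0 \<le> s \<Longrightarrow> s \<le> t \<Longrightarrow> t \<le> \<tau> \<Longrightarrow>
      \<bar>y t - y s - f s * (g t - g s)\<bar> \<le> young_const (\<alpha> + \<gamma>) * a * K * (t - s) powr (\<alpha> + \<gamma>)" "y 0 = 0"
    by (rule young_loeve[OF ab nn(1,2) tau(2) f g]) (rule that)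
  have C: "0 \<le> young_const (\<alpha> + \<gamma>) * a * K" using young_const_nonneg[OF ab(1)] nn by simp
  have Iy: "I t = y t" if t: "0 \<le> t" "t \<le> \<tau>" for t
  proof -
    have "has_young_integral f g 0 t (y t - y 0)"
      by (rule has_young_integral_germ[OF ab(1,2) t(1) nn(1,2) C holder_bound_mono_interval[OF f t(2)]
            holder_bound_mono_interval[OF g t(2)]]) (use y t in auto)
    then show ?thesis using has_young_integral_unique[OF I[OF t]] y(2) by simp
  qed
  have main: "\<bar>I t - I s\<bar> \<le> (F * K + young_const (\<alpha> + \<gamma>) * a * K) * (t - s) powr \<gamma>"
    if st: "0 \<le> s" "s < t" "t \<le> \<tau>" for s t
  proof -
    have "\<bar>y t - y s - f s * (g t - g s)\<bar> \<le> young_const (\<alpha> + \<gamma>) * a * K * (t - s) powr (\<alpha> + \<gamma>)"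
      using st by (intro y(1)) auto
    also have "\<dots> \<le> young_const (\<alpha> + \<gamma>) * a * K * (t - s) powr \<gamma>"
      using st tau ab by (intro mult_left_mono C powr_mono') auto
    finally have 1: "\<bar>y t - y s - f s * (g t - g s)\<bar> \<le> young_const (\<alpha> + \<gamma>) * a * K * (t - s) powr \<gamma>" .
    have "\<bar>g t - g s\<bar> \<le> K * (t - s) powr \<gamma>" using holder_boundD[OF g, of s t] st by auto
    then have 2: "\<bar>f s * (g t - g s)\<bar> \<le> F * (K * (t - s) powr \<gamma>)"
      unfolding abs_mult using F[of s] st nn by (intro mult_mono) auto
    have "I t = y t" "I s = y s" using Iy[of t] Iy[of s] st by auto
    then show ?thesis using 1 2 unfolding distrib_right mult.assoc by linarith
  qed
  show ?thesis by (rule holder_boundI[OF main])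
qed

section \<open>The series of the theorem and the bootstrap for the given solution\<close>

context analytic_setting
begin

lemma taylor_term_nth: "taylor_term V x0 d b k t $ j = taylor (\<lambda>x. x $ j) k t"
  by (simp add: taylor_term_def taylor_def words_def word_apply_def P_coeff_def)

text \<open>A coordinate and its centred version differ by a constant, which only degree 0 sees. The
  centred one has the advantage of vanishing at x0.\<close>

lemma taylor_term_Suc_nth: "taylor_term V x0 d b (Suc k) t $ j = taylor (coord j) (Suc k) t"
proof -
  have "taylor (\<lambda>x. coord j x + x0 $ j) (Suc k) t = taylor (coord j) (Suc k) t + taylor (\<lambda>x. x0 $ j) (Suc k) t"
    by (intro taylor_add smooth_coordinate smooth_const)
  then show ?thesis by (simp add: taylor_term_nth taylor_const)
qed

lemma taylor_term_sum_nth: "(\<Sum>k=1..N. taylor_term V x0 d b k t) $ j = (\<Sum>k\<le>N. taylor (coord j) k t)"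
proof -
  have "(\<Sum>k=1..N. taylor_term V x0 d b k t) $ j = (\<Sum>k<N. taylor (coord j) (Suc k) t)"
    by (simp add: sum.atLeast1_atMost_eq taylor_term_Suc_nth)
  also have "\<dots> = (\<Sum>k\<le>N. taylor (coord j) k t)"
    by (simp add: lessThan_Suc_atMost[symmetric] sum.lessThan_Suc_shift taylor_0 del: sum.lessThan_Suc)
  finally show ?thesis .
qed

lemma taylor_convergent:
  assumes "0 \<le> t" "t \<le> \<tau>"
  shows "convergent (\<lambda>N. norm x0 + (\<Sum>k=1..N. norm (taylor_term V x0 d b k t)))"
proof -
  have "summable (\<lambda>k. norm (taylor_term V x0 d b (Suc k) t))"
  proof (rule summableI_nonneg_bounded)
    fix N
    have "(\<Sum>k<N. norm (taylor_term V x0 d b (Suc k) t)) \<le> (\<Sum>k<N. \<Sum>j\<in>UNIV. \<bar>taylor (coord j) (Suc k) t\<bar>)"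
      using norm_le_l1_cart by (intro sum_mono) (simp only: taylor_term_Suc_nth[symmetric])
    also have "\<dots> = (\<Sum>j\<in>UNIV. \<Sum>k<N. \<bar>taylor (coord j) (Suc k) t\<bar>)" by (rule sum.swap)
    also have "\<dots> \<le> (\<Sum>j\<in>(UNIV :: 'n set). \<rho>)"
    proof (rule sum_mono)
      fix j
      have "(\<Sum>k<N. \<bar>taylor (coord j) (Suc k) t\<bar>) \<le> (\<Sum>k<Suc N. \<bar>taylor (coord j) k t\<bar>)"
        unfolding sum.lessThan_Suc_shift by simp
      also have "\<dots> \<le> \<rho>"
        unfolding lessThan_Suc_atMost by (rule taylor_le_abs_sum[OF taylor_le_coordinate assms])
      finally show "(\<Sum>k<N. \<bar>taylor (coord j) (Suc k) t\<bar>) \<le> \<rho>" .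
    qed
    finally show "(\<Sum>k<N. norm (taylor_term V x0 d b (Suc k) t)) \<le> (\<Sum>j\<in>(UNIV :: 'n set). \<rho>)" .
  qed simp
  then have "convergent (\<lambda>N. norm x0 + (\<Sum>k<N. norm (taylor_term V x0 d b (Suc k) t)))"
    by (intro convergent_add convergent_const) (simp add: summable_iff_convergent)
  then show ?thesis by (simp add: sum.atLeast1_atMost_eq)
qed

lemma taylor_tendsto:
  assumes "0 \<le> t" "t \<le> \<tau>"
  shows "(\<lambda>N. x0 + (\<Sum>k=1..N. taylor_term V x0 d b k t)) \<longlonglongrightarrow> x0 + taylor_limit t"
proof (intro tendsto_add tendsto_const vec_tendstoI)
  fix j
  show "(\<lambda>N. (\<Sum>k=1..N. taylor_term V x0 d b k t) $ j) \<longlonglongrightarrow> taylor_limit t $ j"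
    unfolding taylor_term_sum_nth by (rule tendsto_taylor_limit[OF assms])
qed

text \<open>A bootstrap precedes the comparison: the solution is known to be \<alpha>-Hoelder only
  for some \<open>\<alpha> > 1 - H\<close>, possibly below 1/2. The equation upgrades it to an
  exponent above \<beta>, which the germ calculus and the a priori bound both require.\<close>

lemma young_solution_eq_taylor_limit:
  assumes H: "\<beta> < H" "H < 1" and sol: "young_solution H V x0 d b x" and lip: "\<And>i. i \<le> d \<Longrightarrow> lipschitz (V i)"
    and reg: "\<And>\<gamma> i. 0 < \<gamma> \<Longrightarrow> \<gamma> < H \<Longrightarrow> i \<le> d \<Longrightarrow> \<exists>K\<ge>0. holder_bound \<gamma> 1 K (b i)"
    and t: "0 \<le> t" "t \<le> \<tau>"
  shows "x t = x0 + taylor_limit t"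
proof -
  obtain \<alpha> where al: "\<alpha> > 1 - H" and lh: "locally_holder \<alpha> x"
    and yi: "\<And>t i. 0 \<le> t \<Longrightarrow> i \<le> d \<Longrightarrow> young_integrable (\<lambda>s. V i (x s)) (b i) 0 t"
    and eq: "\<And>t. 0 \<le> t \<Longrightarrow> x t = x0 + (\<Sum>i\<le>d. young_integral (\<lambda>s. V i (x s)) (b i) 0 t)"
    using sol unfolding young_solution_def by blast
  have al0: "0 < \<alpha>" using al H by linarith
  \<comment> \<open>Young's condition with the raw exponent asks for
    \<open>\<gamma> > 1 - \<alpha>\<close>, the continuation argument for a surplus over \<beta>,
    and the regularity of the driver for \<open>\<gamma> < H\<close>.\<close>
  have "max \<beta> (1 - \<alpha>) < H" using H al by simp
  then obtain \<gamma> where gam: "\<beta> < \<gamma>" "1 - \<alpha> < \<gamma>" "\<gamma> < H" using dense by (metis max_less_iff_conj)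
  have gam0: "0 < \<gamma>" using gam beta by simp
  obtain Kx where Kx: "\<And>s t. s \<in> {0..\<tau>} \<Longrightarrow> t \<in> {0..\<tau>} \<Longrightarrow> dist (x s) (x t) \<le> Kx * \<bar>s - t\<bar> powr \<alpha>"
    using lh unfolding locally_holder_def by blast
  have "\<forall>i\<in>{..d}. \<exists>L. L-lipschitz_on UNIV (V i)" using lip by (simp add: lipschitz_def)
  from bchoice[OF this] obtain L where L: "\<forall>i\<in>{..d}. (L i)-lipschitz_on UNIV (V i)" ..
  have "\<forall>i\<in>{..d}. \<exists>K\<ge>0. holder_bound \<gamma> 1 K (b i)" using reg[OF gam0 gam(3)] by simp
  then have "\<forall>i\<in>{..d}. \<exists>K. 0 \<le> K \<and> holder_bound \<gamma> 1 K (b i)" by blast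
  from bchoice[OF this] obtain Kb where Kb: "\<forall>i\<in>{..d}. 0 \<le> Kb i \<and> holder_bound \<gamma> 1 (Kb i) (b i)" ..
  define Kx' where "Kx' = \<bar>Kx\<bar>"
  have inc: "\<bar>V i (x t) $ j - V i (x s) $ j\<bar> \<le> L i * dist (x s) (x t)" if "i \<le> d" for i j s t
  proof -
    have "\<bar>V i (x t) $ j - V i (x s) $ j\<bar> = \<bar>(V i (x t) - V i (x s)) $ j\<bar>" by simp
    also have "\<dots> \<le> dist (V i (x s)) (V i (x t))"
      unfolding dist_norm norm_minus_commute[of "V i (x s)"] by (rule component_le_norm_cart)
    also have "\<dots> \<le> L i * dist (x s) (x t)" using L that by (auto simp: lipschitz_on_def)
    finally show ?thesis .
  qed
  have L0: "0 \<le> L i" if "i \<le> d" for i using L that by (auto simp: lipschitz_on_def)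
  have dx: "dist (x s) (x t) \<le> Kx' * \<bar>t - s\<bar> powr \<alpha>" if "s \<in> {0..\<tau>}" "t \<in> {0..\<tau>}" for s t
  proof -
    have "dist (x s) (x t) \<le> Kx * \<bar>s - t\<bar> powr \<alpha>" by (rule Kx[OF that])
    also have "\<dots> \<le> Kx' * \<bar>s - t\<bar> powr \<alpha>" unfolding Kx'_def by (intro mult_right_mono) auto
    finally show ?thesis by (simp add: abs_minus_commute)
  qed
  have fh: "holder_bound \<alpha> \<tau> (L i * Kx') (\<lambda>s. V i (x s) $ j)" if "i \<le> d" for i j
    unfolding holder_bound_def
  proof (intro ballI)
    fix s t assume st: "s \<in> {0..\<tau>}" "t \<in> {0..\<tau>}"
    have "\<bar>V i (x t) $ j - V i (x s) $ j\<bar> \<le> L i * (Kx' * \<bar>t - s\<bar> powr \<alpha>)"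
      by (rule order_trans[OF inc[OF that] mult_left_mono[OF dx[OF st] L0[OF that]]])
    then show "\<bar>V i (x t) $ j - V i (x s) $ j\<bar> \<le> L i * Kx' * \<bar>t - s\<bar> powr \<alpha>" by (simp only: mult.assoc)
  qed
  have fb: "\<bar>V i (x s) $ j\<bar> \<le> \<bar>V i (x 0) $ j\<bar> + L i * Kx'" if "i \<le> d" "0 \<le> s" "s \<le> \<tau>" for i j s
  proof -
    have "\<bar>V i (x s) $ j - V i (x 0) $ j\<bar> \<le> L i * Kx' * \<bar>s - 0\<bar> powr \<alpha>"
      using that tau by (intro holder_boundD[OF fh]) auto
    also have "\<dots> \<le> L i * Kx' * 1"
      using that tau al0 L0[OF that(1)] by (intro mult_left_mono powr_le1) (auto simp: Kx'_def)
    finally show ?thesis by linarith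
  qed
  define I where "I i j t = young_integral (\<lambda>s. V i (x s)) (b i) 0 t $ j" for i j t
  have hI: "has_young_integral (\<lambda>s. V i (x s) $ j) (b i) 0 t (I i j t)" if it: "i \<le> d" "0 \<le> t" for i j t
  proof -
    obtain y where y: "has_young_integral (\<lambda>s. V i (x s)) (b i) 0 t y"
      using yi[OF it(2,1)] unfolding young_integrable_def by blast
    show ?thesis unfolding I_def young_integral_eq[OF y] by (rule has_young_integral_vec_nth[OF y])
  qed
  define Z where "Z t = x t - x0" for t
  have ZI: "Z t $ j = (\<Sum>i\<le>d. I i j t)" if "0 \<le> t" for t j
    using eq[OF that] by (simp add: Z_def I_def sum_component)
  define KI where "KI i j = (\<bar>V i (x 0) $ j\<bar> + L i * Kx') * Kb i + young_const (\<alpha> + \<gamma>) * (L i * Kx') * Kb i" for i j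
  have KI0: "0 \<le> KI i j" if "i \<le> d" for i j
    using L0[OF that] Kb that young_const_nonneg[of "\<alpha> + \<gamma>"] gam by (auto simp: KI_def Kx'_def)
  have Ih: "holder_bound \<gamma> \<tau> (KI i j) (I i j)" if "i \<le> d" for i j
    unfolding KI_def
  proof (rule young_integral_holder[OF _ _ _ _ _ _ tau fh[OF that] _ fb[OF that] hI[OF that]])
    have "holder_bound \<gamma> 1 (Kb i) (b i)" using Kb that by simp
    then show "holder_bound \<gamma> \<tau> (Kb i) (b i)" by (rule holder_bound_mono_interval) (rule tau(2))
  qed (use gam gam0 al0 L0[OF that] Kb that in \<open>auto simp: Kx'_def\<close>)
  define KZ where "KZ = (\<Sum>j\<in>UNIV. \<Sum>i\<le>d. KI i j)"
  have KZ0: "0 \<le> KZ" unfolding KZ_def using KI0 by (intro sum_nonneg) auto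
  have Zh: "holder_bound \<gamma> \<tau> KZ (\<lambda>t. Z t $ j)" for j
    unfolding holder_bound_def
  proof (intro ballI)
    fix s t assume st: "s \<in> {0..\<tau>}" "t \<in> {0..\<tau>}"
    have "\<bar>Z t $ j - Z s $ j\<bar> = \<bar>\<Sum>i\<le>d. I i j t - I i j s\<bar>" using st by (simp add: ZI sum_subtractf)
    also have "\<dots> \<le> (\<Sum>i\<le>d. \<bar>I i j t - I i j s\<bar>)" by (rule sum_abs)
    also have "\<dots> \<le> (\<Sum>i\<le>d. KI i j * \<bar>t - s\<bar> powr \<gamma>)"
      using Ih st by (intro sum_mono) (auto simp: holder_bound_def)
    also have "\<dots> = (\<Sum>i\<le>d. KI i j) * \<bar>t - s\<bar> powr \<gamma>" by (simp only: sum_distrib_right)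
    also have "\<dots> \<le> KZ * \<bar>t - s\<bar> powr \<gamma>"
      unfolding KZ_def using KI0 by (intro mult_right_mono member_le_sum[of j UNIV "\<lambda>j. \<Sum>i\<le>d. KI i j"] sum_nonneg) auto
    finally show "\<bar>Z t $ j - Z s $ j\<bar> \<le> KZ * \<bar>t - s\<bar> powr \<gamma>" .
  qed
  have VZ_eq: "VZ Z j i = (\<lambda>t. V i (x t) $ j)" for i j by (simp add: Z_def)
  have dxl: "dist (x s) (x t) \<le> (\<Sum>j\<in>(UNIV :: 'n set). KZ) * (t - s) powr \<beta>" if st: "0 \<le> s" "s < t" "t \<le> \<tau>" for s t
  proof -
    have "dist (x s) (x t) = norm (Z t - Z s)" by (simp add: Z_def dist_norm norm_minus_commute)
    also have "\<dots> \<le> (\<Sum>j\<in>UNIV. \<bar>(Z t - Z s) $ j\<bar>)" by (rule norm_le_l1_cart)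
    also have "\<dots> \<le> (\<Sum>j\<in>(UNIV :: 'n set). KZ * (t - s) powr \<beta>)"
    proof (rule sum_mono)
      fix j
      have "\<bar>(Z t - Z s) $ j\<bar> \<le> KZ * (t - s) powr \<gamma>" using holder_boundD[OF Zh, of s t j] st by simp
      also have "\<dots> \<le> KZ * (t - s) powr \<beta>" using st tau gam KZ0 by (intro mult_left_mono powr_mono') auto
      finally show "\<bar>(Z t - Z s) $ j\<bar> \<le> KZ * (t - s) powr \<beta>" .
    qed
    finally show ?thesis by (simp only: sum_distrib_right)
  qed
  define KV where "KV i j = (\<bar>V i (x 0) $ j\<bar> + L i * Kx') + L i * (\<Sum>j\<in>(UNIV :: 'n set). KZ)" for i j
  have hV: "hn (KV i j) (VZ Z j i)" if "i \<le> d" for i j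
    unfolding VZ_eq KV_def
  proof (rule hnorm_leI[OF fb[OF that] _ _ order_refl])
    fix s t assume st: "0 \<le> s" "s < t" "t \<le> \<tau>"
    show "\<bar>V i (x t) $ j - V i (x s) $ j\<bar> \<le> L i * (\<Sum>j\<in>(UNIV :: 'n set). KZ) * (t - s) powr \<beta>"
      unfolding mult.assoc by (rule order_trans[OF inc[OF that] mult_left_mono[OF dxl[OF st] L0[OF that]]])
  next
    show "0 \<le> L i * (\<Sum>j\<in>(UNIV :: 'n set). KZ)" using L0[OF that] KZ0 by simp
  qed (use L0[OF that] KZ0 in auto)
  have Zint: "integs (VZ Z j) t = Z t $ j" if t: "0 \<le> t" "t \<le> \<tau>" for t j
  proof -
    have "integ i (VZ Z j i) t = I i j t" if "i \<le> d" for i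
      unfolding integ_def VZ_eq by (rule young_integral_eq[OF hI[OF that t(1)]])
    then show ?thesis by (simp add: integs_def ZI t)
  qed
  have g: "germ (\<lambda>t. Z t $ j) (VZ Z j)" for j
    by (rule germ_cong[OF germ_integs[OF hV] Zint refl])
  have Z0: "Z 0 = 0" using Zint[of 0] integs_0[OF hV] tau by (simp add: vec_eq_iff)
  have "Z t = taylor_limit t"
    by (rule solution_eq_taylor_limit[OF hn_solution_a_priori[OF Zh gam(1) KZ0 g Z0] g Z0 t])
  then show ?thesis by (simp add: Z_def algebra_simps)
qed

end

section \<open>Measurability with respect to the usual filtration\<close>

lemma measurable_completed_filtration:
  assumes "i \<in> {1..d}" "0 \<le> u" "ennreal u \<le> s"
  shows "B i u \<in> borel_measurable (completed_filtration M d B s)"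
proof (rule measurableI)
  fix A :: "real set" assume A: "A \<in> sets borel"
  have sub: "{B i r -` A \<inter> space M | i r A. i \<in> {1..d} \<and> 0 \<le> r \<and> ennreal r \<le> s \<and> A \<in> sets borel}
      \<union> null_sets (completion M) \<subseteq> Pow (space M)"
    using sets.sets_into_space[of _ "completion M"] by (auto simp: null_sets_def)
  have "B i u -` A \<inter> space M \<in> {B i r -` A \<inter> space M | i r A. i \<in> {1..d} \<and> 0 \<le> r \<and> ennreal r \<le> s \<and> A \<in> sets borel}"
    using assms A by blast
  then have "B i u -` A \<inter> space M \<in> sets (completed_filtration M d B s)"
    unfolding completed_filtration_def sets_measure_of[OF sub] by (intro sigma_sets.Basic UnI1)
  then show "B i u -` A \<inter> space (completed_filtration M d B s) \<in> sets (completed_filtration M d B s)"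
    by simp
qed simp

text \<open>The infimum need not be attained, so it is at most t exactly if for every m some event
  occurs with a time before t + 1/(m+1). For any s > t these times may be kept below s as well,
  which puts the set into the completed filtration at every such s; right-continuity is what makes
  this sufficient.\<close>

lemma stopping_time_first_event:
  fixes A :: "'z::countable \<Rightarrow> 'w set" and \<theta> :: "'z \<Rightarrow> real" and \<tau>0 :: real
  assumes A: "\<And>z s. ennreal (\<theta> z) \<le> s \<Longrightarrow> A z \<in> sets (completed_filtration M d B s)"
  shows "stopping_time (usual_filtration M d B)
    (\<lambda>\<omega>. min (ennreal \<tau>0) (INF z\<in>{z. \<omega> \<in> A z}. ennreal (\<theta> z)))"
proof (rule stopping_timeI)
  fix t :: ennreal
  let ?I = "\<lambda>\<omega>. INF z\<in>{z. \<omega> \<in> A z}. ennreal (\<theta> z)"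
  have sp: "space (usual_filtration M d B t) = space M"
    by (simp add: usual_filtration_def space_measure_of_conv)
  show "Measurable.pred (usual_filtration M d B t) (\<lambda>\<omega>. min (ennreal \<tau>0) (?I \<omega>) \<le> t)"
  proof (cases "ennreal \<tau>0 \<le> t")
    case True
    then have "(\<lambda>\<omega>. min (ennreal \<tau>0) (?I \<omega>) \<le> t) = (\<lambda>\<omega>. True)" by (auto intro: min.coboundedI1)
    then show ?thesis by simp
  next
    case False
    then have fin: "t < top" by (meson ennreal_less_top less_trans not_le)
    have "{\<omega> \<in> space M. ?I \<omega> \<le> t} \<in> sets (completed_filtration M d B s)" if s: "s \<in> insert \<infinity> {t<..}" for s
    proof -
      have ts: "t < s" using s fin by auto
      have pos: "t < t + ennreal (1 / Suc m)" for m :: nat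
        using fin by (cases t) (auto simp flip: ennreal_plus intro!: ennreal_lessI add_nonneg_pos)
      have eq: "?I \<omega> \<le> t \<longleftrightarrow> (\<forall>m::nat. \<exists>z\<in>{z. ennreal (\<theta> z) < min s (t + ennreal (1 / Suc m))}. \<omega> \<in> A z)" for \<omega>
      proof
        assume le: "?I \<omega> \<le> t"
        show "\<forall>m::nat. \<exists>z\<in>{z. ennreal (\<theta> z) < min s (t + ennreal (1 / Suc m))}. \<omega> \<in> A z"
        proof
          fix m
          have "?I \<omega> < min s (t + ennreal (1 / Suc m))" using le ts pos[of m] by (simp add: le_less_trans)
          then show "\<exists>z\<in>{z. ennreal (\<theta> z) < min s (t + ennreal (1 / Suc m))}. \<omega> \<in> A z"
            unfolding INF_less_iff by blast
        qed
      next
        assume ex: "\<forall>m::nat. \<exists>z\<in>{z. ennreal (\<theta> z) < min s (t + ennreal (1 / Suc m))}. \<omega> \<in> A z"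
        show "?I \<omega> \<le> t"
        proof (rule ennreal_le_epsilon)
          fix e :: real assume "0 < e"
          then obtain m where m: "1 / Suc m < e" using nat_approx_posE by blast
          obtain z where z: "\<omega> \<in> A z" "ennreal (\<theta> z) < t + ennreal (1 / Suc m)" using ex by (auto dest: spec[of _ m])
          have "?I \<omega> \<le> ennreal (\<theta> z)" using z(1) by (intro INF_lower) simp
          also have "\<dots> \<le> t + ennreal (1 / Suc m)" using z(2) by (rule less_imp_le)
          also have "\<dots> \<le> t + ennreal e" using m by (intro add_left_mono ennreal_leI) simp
          finally show "?I \<omega> \<le> t + ennreal e" .
        qed
      qed
      have "{\<omega> \<in> space M. ?I \<omega> \<le> t} = (\<Inter>m::nat. \<Union>z\<in>{z. ennreal (\<theta> z) < min s (t + ennreal (1 / Suc m))}. A z) \<inter> space (completed_filtration M d B s)"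
        unfolding eq by auto
      also have "\<dots> \<in> sets (completed_filtration M d B s)"
      proof (rule sets.Int[OF sets.countable_INT sets.top])
        have "(\<Union>z\<in>{z. ennreal (\<theta> z) < min s (t + ennreal (1 / Suc m))}. A z) \<in> sets (completed_filtration M d B s)" for m :: nat
          by (rule sets.countable_UN') (auto intro!: A)
        then show "range (\<lambda>m::nat. \<Union>z\<in>{z. ennreal (\<theta> z) < min s (t + ennreal (1 / Suc m))}. A z)
            \<subseteq> sets (completed_filtration M d B s)" by blast
      qed simp
      finally show ?thesis .
    qed
    then show ?thesis using False unfolding pred_def sp sets_usual_filtration by (auto simp: min_le_iff_disj)
  qed
qed

section \<open>The stopping time\<close>

text \<open>Rounding down to dyadic points stays inside [0, \<tau>], and continuity does the rest.
  Thus countably many events, each comparing two points of one level, detect the Hoelder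
  constant.\<close>

lemma holder_bound_closure:
  assumes cont: "continuous_on {0..} f" and beta: "0 < \<beta>"
    and dy: "\<And>n j k. real (max j k) / 2^n \<le> \<tau> \<Longrightarrow>
      \<bar>f (real k / 2^n) - f (real j / 2^n)\<bar> \<le> \<kappa> * \<bar>real k / 2^n - real j / 2^n\<bar> powr \<beta>"
  shows "holder_bound \<beta> \<tau> \<kappa> f"
  unfolding holder_bound_def
proof (intro ballI)
  fix s t assume st: "s \<in> {0..\<tau>}" "t \<in> {0..\<tau>}"
  define p where "p n u = real (nat \<lfloor>u * 2^n\<rfloor>) / 2^n" for n and u :: real
  have p: "(\<lambda>n. p n u) \<longlonglongrightarrow> u" "\<And>n. p n u \<le> u" "\<And>n. 0 \<le> p n u" if "u \<in> {0..\<tau>}" for u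
    using that dyadic_floor(1)[of u] tendsto_dyadic_floor[of u] by (simp_all add: p_def)
  have fp: "(\<lambda>n. f (p n u)) \<longlonglongrightarrow> f u" if "u \<in> {0..\<tau>}" for u
    by (rule continuous_on_tendsto_compose[OF cont p(1)[OF that]]) (use that p(3)[OF that] in auto)
  have bd: "\<bar>f (p n t) - f (p n s)\<bar> \<le> \<kappa> * \<bar>p n t - p n s\<bar> powr \<beta>" for n
    unfolding p_def
  proof (rule dy)
    have "real (nat \<lfloor>s * 2^n\<rfloor>) / 2^n \<le> \<tau>" "real (nat \<lfloor>t * 2^n\<rfloor>) / 2^n \<le> \<tau>"
      using p(2)[OF st(1), of n] p(2)[OF st(2), of n] st by (auto simp: p_def)
    then show "real (max (nat \<lfloor>s * 2^n\<rfloor>) (nat \<lfloor>t * 2^n\<rfloor>)) / 2^n \<le> \<tau>" by (simp add: max_def)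
  qed
  have "(\<lambda>n. \<bar>p n t - p n s\<bar> powr \<beta>) \<longlonglongrightarrow> \<bar>t - s\<bar> powr \<beta>"
    by (rule tendsto_powr'[OF tendsto_rabs[OF tendsto_diff[OF p(1)[OF st(2)] p(1)[OF st(1)]]] tendsto_const])
      (use beta in auto)
  then have R: "(\<lambda>n. \<kappa> * \<bar>p n t - p n s\<bar> powr \<beta>) \<longlonglongrightarrow> \<kappa> * \<bar>t - s\<bar> powr \<beta>"
    by (rule tendsto_mult_left)
  have L: "(\<lambda>n. \<bar>f (p n t) - f (p n s)\<bar>) \<longlonglongrightarrow> \<bar>f t - f s\<bar>"
    by (intro tendsto_rabs tendsto_diff fp st)
  show "\<bar>f t - f s\<bar> \<le> \<kappa> * \<bar>t - s\<bar> powr \<beta>"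
    by (rule LIMSEQ_le[OF L R]) (use bd in blast)
qed

lemma holder_bound_ident:
  assumes "\<gamma> \<le> 1" "0 \<le> \<tau>"
  shows "holder_bound \<gamma> \<tau> (\<tau> powr (1 - \<gamma>)) (\<lambda>t. t)"
proof -
  have "holder_bound 1 \<tau> 1 (\<lambda>t. t)" by (simp add: holder_bound_def)
  from holder_bound_lower_exponent[OF this assms(1)] show ?thesis by simp
qed

lemma ex_common_expansion:
  fixes V :: "nat \<Rightarrow> real ^ 'n \<Rightarrow> real ^ 'n"
  assumes "\<And>i. i \<le> d \<Longrightarrow> real_analytic_on (V i) S" "x0 \<in> S"
  shows "\<exists>\<rho> c M. 0 < \<rho> \<and> 0 \<le> M \<and> (\<forall>i\<le>d. \<forall>j. expansion (\<lambda>x. V i x $ j) x0 (c i j) (2 * \<rho>) M)"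
proof -
  have "\<forall>i\<in>{..d}. \<exists>z. 0 < fst z \<and> 0 \<le> snd (snd z) \<and>
      (\<forall>j. expansion (\<lambda>x. V i x $ j) x0 (\<lambda>\<alpha>. fst (snd z) \<alpha> $ j) (fst z) (snd (snd z)))"
  proof
    fix i assume "i \<in> {..d}"
    then have "real_analytic_on (V i) S" using assms(1) by simp
    from real_analytic_on_expansion[OF this assms(2)]
    obtain r c M where "0 < r" "0 \<le> M" "\<forall>j. expansion (\<lambda>x. V i x $ j) x0 (\<lambda>\<alpha>. c \<alpha> $ j) r M"
      by (elim exE conjE) (rule that)
    then show "\<exists>z. 0 < fst z \<and> 0 \<le> snd (snd z) \<and>
        (\<forall>j. expansion (\<lambda>x. V i x $ j) x0 (\<lambda>\<alpha>. fst (snd z) \<alpha> $ j) (fst z) (snd (snd z)))"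
      by (intro exI[of _ "(r, c, M)"]) simp
  qed
  from bchoice[OF this] obtain z where z: "\<forall>i\<in>{..d}. 0 < fst (z i) \<and> 0 \<le> snd (snd (z i)) \<and>
      (\<forall>j. expansion (\<lambda>x. V i x $ j) x0 (\<lambda>\<alpha>. fst (snd (z i)) \<alpha> $ j) (fst (z i)) (snd (snd (z i))))" ..
  define r where "r = Min ((\<lambda>i. fst (z i)) ` {..d})"
  define M where "M = (\<Sum>i\<le>d. snd (snd (z i)))"
  have r: "0 < r" unfolding r_def using z by (subst Min_gr_iff) auto
  have ri: "r \<le> fst (z i)" if "i \<le> d" for i unfolding r_def using that by (intro Min_le) auto
  have Mi: "snd (snd (z i)) \<le> M" if "i \<le> d" for i unfolding M_def using that z by (intro member_le_sum) auto
  have "0 \<le> M" unfolding M_def using z by (intro sum_nonneg) auto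
  moreover have "expansion (\<lambda>x. V i x $ j) x0 (\<lambda>\<alpha>. fst (snd (z i)) \<alpha> $ j) (2 * (r / 2)) M" if "i \<le> d" for i j
  proof -
    have "expansion (\<lambda>x. V i x $ j) x0 (\<lambda>\<alpha>. fst (snd (z i)) \<alpha> $ j) (fst (z i)) (snd (snd (z i)))"
      using z that by simp
    from expansion_mono[OF this r ri[OF that] Mi[OF that]] show ?thesis by simp
  qed
  ultimately show ?thesis
    using r by (intro exI[of _ "r / 2"] exI[of _ "\<lambda>i j \<alpha>. fst (snd (z i)) \<alpha> $ j"] exI[of _ M]) auto
qed

text \<open>The exponents form an uncountable family, which null sets do not tolerate. A sequence
  tending to H from below suffices, as on [0, 1] a larger exponent implies the smaller ones.\<close>

lemma fbm_all_holder:
  assumes "prob_space M" and H: "0 < H" "H < 1" and fbm: "fractional_brownian_motion M H d B"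
    and B0: "\<And>t \<omega>. B 0 t \<omega> = t"
  shows "AE \<omega> in M. \<forall>\<gamma> i. 0 < \<gamma> \<longrightarrow> \<gamma> < H \<longrightarrow> i \<le> d \<longrightarrow> (\<exists>K\<ge>0. holder_bound \<gamma> 1 K (\<lambda>t. B i t \<omega>))"
proof -
  define g where "g n = H - H / (real n + 2)" for n :: nat
  have g: "0 < g n" "g n < H" for n using H by (simp_all add: g_def field_simps add_pos_nonneg)
  have "AE \<omega> in M. \<forall>n. \<forall>i\<in>{1..d}. \<exists>K\<ge>0. holder_bound (g n) 1 K (\<lambda>t. B i t \<omega>)"
    unfolding AE_all_countable
  proof (intro allI AE_finite_allI)
    fix n i assume i: "i \<in> {1..d}"
    show "AE \<omega> in M. \<exists>K\<ge>0. holder_bound (g n) 1 K (\<lambda>t. B i t \<omega>)"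
      using fbm i unfolding fractional_brownian_motion_def
      by (intro fbm_holder[OF assms(1) _ _ _ _ g]) auto
  qed simp
  then show ?thesis
  proof eventually_elim
    case (elim \<omega>)
    show ?case
    proof (intro allI impI)
      fix \<gamma> and i :: nat assume gam: "0 < \<gamma>" "\<gamma> < H" and i: "i \<le> d"
      show "\<exists>K\<ge>0. holder_bound \<gamma> 1 K (\<lambda>t. B i t \<omega>)"
      proof (cases "i = 0")
        case True
        have "holder_bound \<gamma> 1 1 (\<lambda>t. t)" using holder_bound_ident[of \<gamma> 1] gam H by simp
        then show ?thesis using True B0 by (intro exI[of _ 1]) simp
      next
        case False
        obtain n :: nat where "H / (H - \<gamma>) < n" using reals_Archimedean2 by blast
        then have "H < real n * (H - \<gamma>)" using gam by (simp add: divide_less_eq)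
        also have "\<dots> \<le> (real n + 2) * (H - \<gamma>)" using gam by (intro mult_right_mono) auto
        finally have "\<gamma> \<le> g n" by (simp add: g_def field_simps)
        moreover obtain K where "0 \<le> K" "holder_bound (g n) 1 K (\<lambda>t. B i t \<omega>)"
          using elim False i by fastforce
        ultimately have "holder_bound \<gamma> 1 (K * 1 powr (g n - \<gamma>)) (\<lambda>t. B i t \<omega>)"
          by (intro holder_bound_lower_exponent)
        then show ?thesis using \<open>0 \<le> K\<close> by (intro exI[of _ K]) simp
      qed
    qed
  qed
qed

theorem theorem3p1:
  fixes M :: "'w measure"
    and H :: real and d :: nat
    and B :: "nat \<Rightarrow> real \<Rightarrow> 'w \<Rightarrow> real"
    and V :: "nat \<Rightarrow> real ^ 'n \<Rightarrow> real ^ 'n"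
    and x0 :: "real ^ 'n" and C :: real
    and X :: "real \<Rightarrow> 'w \<Rightarrow> real ^ 'n"
  assumes "prob_space M"
    and "1/2 < H" and "H < 1"
    and "fractional_brownian_motion M H d B"
    and "\<And>t \<omega>. B 0 t \<omega> = t"
    and "\<And>i. i \<le> d \<Longrightarrow> smooth (V i)"
    and "\<And>i. i \<le> d \<Longrightarrow> lipschitz (V i)"
    and "\<And>i. i \<le> d \<Longrightarrow> lipschitz_derivative (V i)"
    and "C > 0"
    and "\<And>i. i \<le> d \<Longrightarrow> real_analytic_on (V i) {x. norm (x - x0) \<le> C}"
    and "AE \<omega> in M. young_solution H V x0 d (\<lambda>i t. B i t \<omega>) (\<lambda>t. X t \<omega>)"
  shows "\<exists>T :: 'w \<Rightarrow> ennreal.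
           stopping_time (usual_filtration M d B) T \<and>
           (AE \<omega> in M. T \<omega> > 0) \<and>
           (AE \<omega> in M. \<forall>t\<ge>0. ennreal t < T \<omega> \<longrightarrow>
              convergent (\<lambda>N. norm x0 +
                (\<Sum>k=1..N. norm (taylor_term V x0 d (\<lambda>i t. B i t \<omega>) k t))) \<and>
              (\<lambda>N. x0 + (\<Sum>k=1..N. taylor_term V x0 d (\<lambda>i t. B i t \<omega>) k t))
                \<longlonglongrightarrow> X t \<omega>)"
proof -
  note ps = assms(1) and H = assms(2,3) and fbm = assms(4) and B0 = assms(5)
  \<comment> \<open>The midpoint of 1/2 and H: above 1/2 for Young's condition, and below H so that
    the paths have regularity to spare.\<close>
  define \<beta> where "\<beta> = (1/2 + H) / 2"
  have beta: "1/2 < \<beta>" "\<beta> < H" "\<beta> < 1" using H by (simp_all add: \<beta>_def)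
  have "x0 \<in> {x. norm (x - x0) \<le> C}" using assms(9) by simp
  have "\<exists>\<rho> c M. 0 < \<rho> \<and> 0 \<le> M \<and> (\<forall>i\<le>d. \<forall>j. expansion (\<lambda>x. V i x $ j) x0 (c i j) (2 * \<rho>) M)"
    by (rule ex_common_expansion[OF assms(10) \<open>x0 \<in> _\<close>])
  then
  obtain \<rho> c L where rho: "0 < \<rho>" and L: "0 \<le> L"
    and ex0: "\<forall>i\<le>d. \<forall>j. expansion (\<lambda>x. V i x $ j) x0 (c i j) (2 * \<rho>) L"
    by (elim exE conjE) (rule that)
  have ex: "expansion (\<lambda>x. V i x $ j) x0 (c i j) (2 * \<rho>) L" if "i \<le> d" for i j using ex0 that by blast
  define y where "y = 1 + young_const (2 * \<beta>)"
  have y: "0 < y" using young_const_nonneg[of "2 * \<beta>"] beta by (simp add: y_def)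
  \<comment> \<open>As \<open>eta\<close> will be \<open>2 * \<kappa> * y\<close>, this turns
    \<open>(d + 1) * eta * L\<close> into \<open>\<rho> / 4 * (L / (L + 1))\<close>; the L + 1
    covers L = 0.\<close>
  define \<kappa> where "\<kappa> = \<rho> / (8 * (real d + 1) * y * (L + 1))"
  have kap: "0 < \<kappa>" using rho y L by (simp add: \<kappa>_def)
  have small: "(d + 1) * (2 * \<kappa> * y) * L \<le> \<rho> / 4"
  proof -
    define D L1 where "D = real d + 1" and "L1 = L + 1"
    have "0 < D" "0 < L1" using L by (simp_all add: D_def L1_def)
    then have "D * (2 * \<kappa> * y) * L = \<rho> / 4 * (L / L1)"
      using y by (simp add: \<kappa>_def D_def[symmetric] L1_def[symmetric])
    then have "(d + 1) * (2 * \<kappa> * y) * L = \<rho> / 4 * (L / (L + 1))" by (simp add: D_def L1_def add.commute)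
    also have "\<dots> \<le> \<rho> / 4 * 1" using rho L by (intro mult_left_mono) auto
    finally show ?thesis by simp
  qed
  \<comment> \<open>The time component is deterministic with \<beta>-Hoelder constant
    \<open>\<tau> powr (1 - \<beta>)\<close> on [0, \<tau>], which stays at most \<kappa> up to this
    time. The events below therefore concern the components 1 to d only.\<close>
  define \<tau>0 where "\<tau>0 = min 1 (\<kappa> powr (1 / (1 - \<beta>)))"
  have tau0: "0 < \<tau>0" "\<tau>0 \<le> 1" using kap by (simp_all add: \<tau>0_def)
  have time: "\<tau> powr (1 - \<beta>) \<le> \<kappa>" if "0 \<le> \<tau>" "\<tau> \<le> \<tau>0" for \<tau>
  proof -
    have "\<tau> powr (1 - \<beta>) \<le> (\<kappa> powr (1 / (1 - \<beta>))) powr (1 - \<beta>)"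
      using that beta by (intro powr_mono2) (auto simp: \<tau>0_def)
    then show ?thesis using kap beta by (simp add: powr_powr)
  qed
  \<comment> \<open>An event compares two points of one dyadic level; \<theta> is the later of them,
    the time at which the event is decided.\<close>
  define \<theta> :: "nat \<times> nat \<times> nat \<times> nat \<Rightarrow> real" where "\<theta> = (\<lambda>(i, n, j, k). real (max j k) / 2^n)"
  define A where "A = (\<lambda>(i, n, j, k). {\<omega> \<in> space M. i \<in> {1..d} \<and>
      \<kappa> * \<bar>real k / 2^n - real j / 2^n\<bar> powr \<beta> < \<bar>B i (real k / 2^n) \<omega> - B i (real j / 2^n) \<omega>\<bar>})"
  define T where "T \<omega> = min (ennreal \<tau>0) (INF z\<in>{z. \<omega> \<in> A z}. ennreal (\<theta> z))" for \<omega>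
  have st: "stopping_time (usual_filtration M d B) T"
    unfolding T_def[abs_def]
  proof (rule stopping_time_first_event)
    fix z s assume zs: "ennreal (\<theta> z) \<le> s"
    obtain i n j k where z: "z = (i, n, j, k)" by (cases z)
    show "A z \<in> sets (completed_filtration M d B s)"
    proof (cases "i \<in> {1..d}")
      case True
      have "ennreal (real k / 2^n) \<le> ennreal (\<theta> z)" "ennreal (real j / 2^n) \<le> ennreal (\<theta> z)"
        by (auto simp: z \<theta>_def intro!: ennreal_leI divide_right_mono)
      then have m: "B i (real k / 2^n) \<in> borel_measurable (completed_filtration M d B s)"
        "B i (real j / 2^n) \<in> borel_measurable (completed_filtration M d B s)"
        using True zs by (auto intro!: measurable_completed_filtration)
      have "(\<lambda>\<omega>. \<bar>B i (real k / 2^n) \<omega> - B i (real j / 2^n) \<omega>\<bar>) \<in> borel_measurable (completed_filtration M d B s)"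
        by (rule borel_measurable_abs[OF borel_measurable_diff[OF m]])
      then have "{\<omega> \<in> space (completed_filtration M d B s). a < \<bar>B i (real k / 2^n) \<omega> - B i (real j / 2^n) \<omega>\<bar>}
          \<in> sets (completed_filtration M d B s)" for a
        by (rule borel_measurable_iff_greater[THEN iffD1, THEN spec])
      from this[of "\<kappa> * \<bar>real k / 2^n - real j / 2^n\<bar> powr \<beta>"] show ?thesis
        unfolding z A_def prod.case space_completed_filtration by (simp only: True simp_thms)
    next
      case False
      then have "A z = {}" unfolding z A_def prod.case by blast
      then show ?thesis by simp
    qed
  qed
  have reg: "AE \<omega> in M. \<forall>\<gamma> i. 0 < \<gamma> \<longrightarrow> \<gamma> < H \<longrightarrow> i \<le> d \<longrightarrow> (\<exists>K\<ge>0. holder_bound \<gamma> 1 K (\<lambda>t. B i t \<omega>))"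
    using H by (intro fbm_all_holder[OF ps _ _ fbm B0]) auto
  have "AE \<omega> in M. \<forall>i\<in>{1..d}. continuous_on {0..} (\<lambda>t. B i t \<omega>)"
    using fbm unfolding fractional_brownian_motion_def by (intro AE_finite_allI) auto
  then have cont: "AE \<omega> in M. \<forall>i\<le>d. continuous_on {0..} (\<lambda>t. B i t \<omega>)"
  proof eventually_elim
    case (elim \<omega>)
    show ?case
    proof (intro allI impI)
      fix i assume "i \<le> d"
      then show "continuous_on {0..} (\<lambda>t. B i t \<omega>)"
        using elim B0 by (cases "i = 0") auto
    qed
  qed
  have pos: "AE \<omega> in M. T \<omega> > 0"
    using reg
  proof eventually_elim
    case (elim \<omega>)
    define \<gamma> where "\<gamma> = (\<beta> + H) / 2"
    have gam: "0 < \<gamma>" "\<beta> < \<gamma>" "\<gamma> < H" using beta by (simp_all add: \<gamma>_def)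
    have "\<forall>i\<in>{..d}. \<exists>K. 0 \<le> K \<and> holder_bound \<gamma> 1 K (\<lambda>t. B i t \<omega>)" using elim gam by blast
    from bchoice[OF this] obtain K where K: "\<forall>i\<in>{..d}. 0 \<le> K i \<and> holder_bound \<gamma> 1 (K i) (\<lambda>t. B i t \<omega>)" ..
    define K' where "K' = (\<Sum>i\<le>d. K i) + 1"
    have K': "0 < K'" unfolding K'_def using K by (intro add_nonneg_pos sum_nonneg) auto
    have KK: "K i \<le> K'" if "i \<le> d" for i
      unfolding K'_def using that K member_le_sum[of i "{..d}" K] by auto
    \<comment> \<open>Chosen so that
      \<open>K' * \<delta> powr (\<gamma> - \<beta>) \<le> \<kappa>\<close>: up to time \<delta> the
      surplus of \<gamma> over \<beta> keeps all \<beta>-Hoelder constants below \<kappa>, so that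
      no event is decided by then.\<close>
    define \<delta> where "\<delta> = min 1 ((\<kappa> / K') powr (1 / (\<gamma> - \<beta>)))"
    have del: "0 < \<delta>" "\<delta> \<le> 1" using kap K' by (simp_all add: \<delta>_def)
    have "\<delta> powr (\<gamma> - \<beta>) \<le> ((\<kappa> / K') powr (1 / (\<gamma> - \<beta>))) powr (\<gamma> - \<beta>)"
      using del gam by (intro powr_mono2) (auto simp: \<delta>_def)
    then have dk: "K' * \<delta> powr (\<gamma> - \<beta>) \<le> \<kappa>" using kap K' gam by (simp add: powr_powr field_simps)
    have "\<delta> < \<theta> z" if "\<omega> \<in> A z" for z
    proof (rule ccontr)
      obtain i n j k where z: "z = (i, n, j, k)" by (cases z)
      have i: "i \<in> {1..d}" and gt: "\<kappa> * \<bar>real k / 2^n - real j / 2^n\<bar> powr \<beta> < \<bar>B i (real k / 2^n) \<omega> - B i (real j / 2^n) \<omega>\<bar>"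
        using that by (auto simp: A_def z)
      assume "\<not> \<delta> < \<theta> z"
      then have "real (max j k) / 2^n \<le> \<delta>" by (simp add: z \<theta>_def)
      moreover have "real j / 2^n \<le> real (max j k) / 2^n" "real k / 2^n \<le> real (max j k) / 2^n"
        by (intro divide_right_mono; simp)+
      ultimately have le: "real j / 2^n \<le> \<delta>" "real k / 2^n \<le> \<delta>" by linarith+
      have "holder_bound \<beta> \<delta> (K i * \<delta> powr (\<gamma> - \<beta>)) (\<lambda>t. B i t \<omega>)"
        by (rule holder_bound_lower_exponent[OF holder_bound_mono_interval[of _ 1]]) (use K i gam del in auto)
      then have "\<bar>B i (real k / 2^n) \<omega> - B i (real j / 2^n) \<omega>\<bar> \<le> K i * \<delta> powr (\<gamma> - \<beta>) * \<bar>real k / 2^n - real j / 2^n\<bar> powr \<beta>"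
        using le by (intro holder_boundD) auto
      also have "\<dots> \<le> \<kappa> * \<bar>real k / 2^n - real j / 2^n\<bar> powr \<beta>"
      proof (rule mult_right_mono)
        have "K i * \<delta> powr (\<gamma> - \<beta>) \<le> K' * \<delta> powr (\<gamma> - \<beta>)" using KK i by (intro mult_right_mono) auto
        then show "K i * \<delta> powr (\<gamma> - \<beta>) \<le> \<kappa>" using dk by linarith
      qed simp
      finally show False using gt by simp
    qed
    then have "ennreal \<delta> \<le> (INF z\<in>{z. \<omega> \<in> A z}. ennreal (\<theta> z))"
      by (intro INF_greatest ennreal_leI) (simp add: less_imp_le)
    moreover have "0 < ennreal \<delta>" using del by simp
    ultimately have "0 < (INF z\<in>{z. \<omega> \<in> A z}. ennreal (\<theta> z))" by (rule less_le_trans[rotated])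
    then show "T \<omega> > 0" using tau0 by (simp add: T_def)
  qed
  have "AE \<omega> in M. \<forall>t\<ge>0. ennreal t < T \<omega> \<longrightarrow>
              convergent (\<lambda>N. norm x0 +
                (\<Sum>k=1..N. norm (taylor_term V x0 d (\<lambda>i t. B i t \<omega>) k t))) \<and>
              (\<lambda>N. x0 + (\<Sum>k=1..N. taylor_term V x0 d (\<lambda>i t. B i t \<omega>) k t))
                \<longlonglongrightarrow> X t \<omega>"
    using reg cont assms(11) AE_space
  proof eventually_elim
    case (elim \<omega>)
    show ?case
    proof (intro allI impI)
      fix t :: real assume t: "0 \<le> t" "ennreal t < T \<omega>"
      then have tt: "t < \<tau>0" by (simp add: T_def ennreal_less_iff)
      \<comment> \<open>For a component from 1 to d, a violation at dyadic points of [0, t] would be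
        an event decided by time t and force \<open>T \<omega> \<le> t\<close>.\<close>
      have hb: "holder_bound \<beta> t \<kappa> (\<lambda>t. B i t \<omega>)" if i: "i \<le> d" for i
      proof (cases "i = 0")
        case True
        have "holder_bound \<beta> t (t powr (1 - \<beta>)) (\<lambda>t. t)" using holder_bound_ident[of \<beta> t] beta t by simp
        moreover have "t powr (1 - \<beta>) * w \<le> \<kappa> * w" if "0 \<le> w" for w
          using time[of t] t tt that by (intro mult_right_mono) auto
        ultimately show ?thesis unfolding True B0 holder_bound_def by (meson order_trans powr_ge_zero)
      next
        case False
        show ?thesis
        proof (rule holder_bound_closure)
          show "continuous_on {0..} (\<lambda>t. B i t \<omega>)" using elim(2) i by blast
          show "0 < \<beta>" using beta by simp
          fix n j k assume le: "real (max j k) / 2^n \<le> t"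
          show "\<bar>B i (real k / 2^n) \<omega> - B i (real j / 2^n) \<omega>\<bar> \<le> \<kappa> * \<bar>real k / 2^n - real j / 2^n\<bar> powr \<beta>"
          proof (rule ccontr)
            assume "\<not> ?thesis"
            then have "\<omega> \<in> A (i, n, j, k)" using elim(4) False i by (simp add: A_def)
            then have "T \<omega> \<le> ennreal (\<theta> (i, n, j, k))" unfolding T_def by (intro min.coboundedI2 INF_lower) simp
            also have "\<dots> \<le> ennreal t" using le by (intro ennreal_leI) (simp add: \<theta>_def)
            finally show False using t(2) by simp
          qed
        qed
      qed
      \<comment> \<open>The pathwise results are applied on [0, t] for each t separately; the terms
        of the series at t do not depend on the interval.\<close>
      interpret hd: holder_driver \<beta> t \<kappa> d "\<lambda>i t. B i t \<omega>"
        by unfold_locales (use beta t tt tau0 kap hb in auto)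
      interpret an: analytic_setting \<beta> t \<kappa> d "\<lambda>i t. B i t \<omega>" V x0 c \<rho> L
        by unfold_locales (use assms(6) ex small in \<open>auto simp: hd.eta_def y_def\<close>)
      have "X t \<omega> = x0 + an.taylor_limit t"
        by (rule an.young_solution_eq_taylor_limit[OF beta(2) H(2) elim(3) assms(7)]) (use elim(1) t in auto)
      then show "convergent (\<lambda>N. norm x0 + (\<Sum>k=1..N. norm (taylor_term V x0 d (\<lambda>i t. B i t \<omega>) k t))) \<and>
          (\<lambda>N. x0 + (\<Sum>k=1..N. taylor_term V x0 d (\<lambda>i t. B i t \<omega>) k t)) \<longlonglongrightarrow> X t \<omega>"
        using an.taylor_convergent[of t] an.taylor_tendsto[of t] t by simp
    qed
  qed
  with st pos show ?thesis by blast
qed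

end
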